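(* Let $F$ be a field of characteristic zero, let $\mathfrak{g}$ be the split simple Lie algebra over $F$ of type $B_n$, $C_n$ or $D_n$ with corresponding group $G$, and let $r$ be an $r$-matrix from the Belavin--Drinfeld list for $\mathfrak{g}$ associated to an admissible triple $(\Gamma_1,\Gamma_2,\tau)$. (i) For type $B_n$ or $C_n$, the set $H^1_{BD}(G,r)$ contains exactly one element. (ii) For type $D_n$: if there exists $k\in\mathbb{Z}$ such that $\tau^k(\alpha_{n-1})=\alpha_n$, then $H^1_{BD}(G,r)$ is parametrized by (is in bijection with) the elements of $F^*/(F^* )^2$; otherwise $H^1_{BD}(G,r)$ is trivial (contains exactly one element).
   Context: Setting. $\overline F$ is an algebraic closure of $F$. $\mathfrak{g}$ is assumed simple (so $n\ge 3$ for $D_n$). Put $M=2n+1$ for $B_n$ and $M=2n$ for $C_n, D_n$. $B$ is the $M\times M$ matrix with $1$'s on the antidiagonal and $0$ elsewhere for $B_n, D_n$; for $C_n$ it has $1$'s on the upper half of the antidiagonal, $-1$'s on the lower half and $0$ elsewhere. $G=\{X\in SL(M): XBX^T=B\}$, $\mathfrak{g}=\{X: XB+BX^T=0\}$. $H\subset G$ is the subgroup of diagonal matrices and $\mathfrak{h}\subset\mathfrak{g}$ the subalgebra of diagonal matrices. Elements of $H$ are $(d_1,\dots,d_n):=\mathrm{diag}(d_1,\dots,d_n,1,d_n^{-1},\dots,d_1^{-1})$ for $B_n$ and $(d_1,\dots,d_n):=\mathrm{diag}(d_1,\dots,d_n,d_n^{-1},\dots,d_1^{-1})$ for $C_n,D_n$.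 The simple roots $\alpha_1,\dots,\alpha_n$ correspond to the characters $e^{\alpha_i}(d_1,\dots,d_n)=d_id_{i+1}^{-1}$ for $i<n$, and $e^{\alpha_n}(d_1,\dots,d_n)=d_n$ for $B_n$, $d_n^2$ for $C_n$, $d_{n-1}d_n$ for $D_n$. Belavin--Drinfeld list. An admissible triple $(\Gamma_1,\Gamma_2,\tau)$ consists of subsets $\Gamma_1,\Gamma_2$ of the set of simple roots and an isometric bijection $\tau:\Gamma_1\to\Gamma_2$ such that for every $\alpha\in\Gamma_1$ there is $k\ge 1$ with $\tau^k(\alpha)\notin\Gamma_1$. Powers $\tau^k$, $k\in\mathbb{Z}$, are understood as partially defined maps (where defined). A Belavin--Drinfeld $r$-matrix for this triple is $$r=r_0+\sum_{\alpha>0}e_{-\alpha}\otimes e_\alpha+\sum_{\alpha\in \mathrm{Span}(\Gamma_1)^+}\sum_{k\ge1}e_{-\alpha}\wedge e_{\tau^k(\alpha)}\in\mathfrak{g}(\overline F)\otimes\mathfrak{g}(\overline F),$$ where $\mathrm{Span}(\Gamma_1)^+$ is the set of positive roots that are integer combinations of $\Gamma_1$, $\tau$ is extended linearly, only defined $\tau^k(\alpha)$ occur, $a\wedge b=a\otimes b-b\otimes a$, the root vectors satisfy $K(e_\alpha,e_{-\alpha})=1$ ($K$ the Killing form) and are compatible with the Lie algebra isomorphism given by $e_{\pm\alpha}\mapsto e_{\pm\tau(\alpha)}$, $\alpha\in\Gamma_1$, and $r_0\in\mathfrak{h}\otimes\mathfrak{h}$ satisfies $r_0+r_0^{21}=\sum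 t_k\otimes t_k$ ($t_k$ an orthonormal basis of $\mathfrak{h}$) and $(\tau(\alpha)\otimes\mathrm{id}+\mathrm{id}\otimes\alpha)r_0=0$ for all $\alpha\in\Gamma_1$. Cohomology. $C(r)=\{X\in G(\overline F): \mathrm{Ad}_X r=r\}$, where $\mathrm{Ad}_X$ acts on tensors as $\mathrm{Ad}_X\otimes\mathrm{Ad}_X$. A non-twisted Belavin--Drinfeld cocycle for $r$ is $X\in G(\overline F)$ with $X^{-1}\sigma(X)\in C(r)$ for all $\sigma\in\mathrm{Gal}(\overline F/F)$. Two cocycles $X_1,X_2$ are equivalent if $X_1=QX_2C$ for some $Q\in G(F)$, $C\in C(r)$. $H^1_{BD}(G,r)$ is the set of equivalence classes of non-twisted cocycles. *)

theory Defs
  imports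
    "HOL-Algebra.Algebraic_Closure_Type"
    "HOL-Algebra.Multiplicative_Group"
    "Jordan_Normal_Form.Determinant"
    "Jordan_Normal_Form.Gauss_Jordan_Elimination"
begin

section \<open>Matrices and tensors\<close>

text \<open>Square matrices of a fixed size form a vector space, but the type of all matrices is not
  an instance of the additive classes; hence finite sums of \<open>m \<times> m\<close> matrices are taken entrywise.\<close>

definition mat_sum :: "nat \<Rightarrow> ('i \<Rightarrow> 'k::field mat) \<Rightarrow> 'i set \<Rightarrow> 'k mat" where
  "mat_sum m f I = mat m m (\<lambda>p. \<Sum>i\<in>I. f i $$ p)"

definition mat_unit :: "nat \<Rightarrow> nat \<Rightarrow> nat \<Rightarrow> 'k::field mat" where
  "mat_unit m i j = mat m m (\<lambda>(a, b). if a = i \<and> b = j then 1 else 0)"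

definition mat_inv :: "'k::field mat \<Rightarrow> 'k mat" where
  "mat_inv A = the (mat_inverse A)"

definition lie_bracket :: "'k::field mat \<Rightarrow> 'k mat \<Rightarrow> 'k mat" where
  "lie_bracket x y = x * y - y * x"

definition mat_basis :: "nat \<Rightarrow> 'k::field mat set \<Rightarrow> 'k mat list \<Rightarrow> bool" where
  "mat_basis m V bs \<longleftrightarrow> set bs \<subseteq> V \<and>
     (\<forall>x\<in>V. \<exists>!c. c \<in> carrier_vec (length bs) \<and>
        x = mat_sum m (\<lambda>i. c $ i \<cdot>\<^sub>m bs ! i) {..<length bs})"

definition mat_coords :: "nat \<Rightarrow> 'k::field mat list \<Rightarrow> 'k mat \<Rightarrow> 'k vec" where
  "mat_coords m bs x = (THE c. c \<in> carrier_vec (length bs) \<and>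
     x = mat_sum m (\<lambda>i. c $ i \<cdot>\<^sub>m bs ! i) {..<length bs})"

text \<open>The trace of a linear endomorphism \<open>f\<close> of a space \<open>V\<close> of matrices; as usual it does not
  depend on the basis that is chosen.\<close>

definition trace_on :: "nat \<Rightarrow> 'k::field mat set \<Rightarrow> ('k mat \<Rightarrow> 'k mat) \<Rightarrow> 'k" where
  "trace_on m V f = (let bs = (SOME bs. mat_basis m V bs)
     in \<Sum>i<length bs. mat_coords m bs (f (bs ! i)) $ i)"

text \<open>Tensors in \<open>Mat\<^sub>m \<otimes> Mat\<^sub>m\<close> are \<open>m\<^sup>2 \<times> m\<^sup>2\<close> matrices, \<open>A \<otimes> B\<close> being the Kronecker product.
  The coefficient of \<open>E\<^sub>i\<^sub>j \<otimes> E\<^sub>k\<^sub>l\<close> in \<open>T\<close> is \<open>tensor_coeff m T i j k l\<close>.\<close>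

definition kron :: "'k::field mat \<Rightarrow> 'k mat \<Rightarrow> 'k mat" where
  "kron A B = mat (dim_row A * dim_row B) (dim_col A * dim_col B)
     (\<lambda>(a, b). A $$ (a div dim_row B, b div dim_col B) * B $$ (a mod dim_row B, b mod dim_col B))"

definition tensor_coeff :: "nat \<Rightarrow> 'k::field mat \<Rightarrow> nat \<Rightarrow> nat \<Rightarrow> nat \<Rightarrow> nat \<Rightarrow> 'k" where
  "tensor_coeff m T i j k l = T $$ (i * m + k, j * m + l)"

definition wedge :: "'k::field mat \<Rightarrow> 'k mat \<Rightarrow> 'k mat" where
  "wedge A B = kron A B - kron B A"

definition tensor_space :: "nat \<Rightarrow> 'k::field mat set \<Rightarrow> 'k mat set \<Rightarrow> 'k mat set" where
  "tensor_space m V W = {T. \<exists>N a b. (\<forall>i<N. a i \<in> V \<and> b i \<in> W) \<and>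
     T = mat_sum (m * m) (\<lambda>i. kron (a i) (b i)) {..<N::nat}}"

text \<open>For linear \<open>f\<close>, \<open>g\<close> on \<open>Mat\<^sub>m\<close> and a linear functional \<open>\<phi>\<close> on \<open>Mat\<^sub>m\<close>, the maps
  \<open>f \<otimes> g\<close>, \<open>\<phi> \<otimes> id\<close>, \<open>id \<otimes> \<phi>\<close> and the flip \<open>T \<mapsto> T\<^sup>2\<^sup>1\<close>.\<close>

definition tensor_map ::
  "nat \<Rightarrow> ('k::field mat \<Rightarrow> 'k mat) \<Rightarrow> ('k mat \<Rightarrow> 'k mat) \<Rightarrow> 'k mat \<Rightarrow> 'k mat" where
  "tensor_map m f g T = mat_sum (m * m)
     (\<lambda>(i, j, k, l). tensor_coeff m T i j k l \<cdot>\<^sub>m kron (f (mat_unit m i j)) (g (mat_unit m k l)))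
     ({..<m} \<times> {..<m} \<times> {..<m} \<times> {..<m})"

definition contract_fst :: "nat \<Rightarrow> ('k::field mat \<Rightarrow> 'k) \<Rightarrow> 'k mat \<Rightarrow> 'k mat" where
  "contract_fst m \<phi> T = mat_sum m
     (\<lambda>(i, j, k, l). (tensor_coeff m T i j k l * \<phi> (mat_unit m i j)) \<cdot>\<^sub>m mat_unit m k l)
     ({..<m} \<times> {..<m} \<times> {..<m} \<times> {..<m})"

definition contract_snd :: "nat \<Rightarrow> ('k::field mat \<Rightarrow> 'k) \<Rightarrow> 'k mat \<Rightarrow> 'k mat" where
  "contract_snd m \<phi> T = mat_sum m
     (\<lambda>(i, j, k, l). (tensor_coeff m T i j k l * \<phi> (mat_unit m k l)) \<cdot>\<^sub>m mat_unit m i j)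
     ({..<m} \<times> {..<m} \<times> {..<m} \<times> {..<m})"

definition tensor_flip :: "nat \<Rightarrow> 'k::field mat \<Rightarrow> 'k mat" where
  "tensor_flip m T = mat_sum (m * m)
     (\<lambda>(i, j, k, l). tensor_coeff m T i j k l \<cdot>\<^sub>m kron (mat_unit m k l) (mat_unit m i j))
     ({..<m} \<times> {..<m} \<times> {..<m} \<times> {..<m})"


section \<open>The classical groups and Lie algebras\<close>

datatype cartan_type = TypeB | TypeC | TypeD

definition std_dim :: "cartan_type \<Rightarrow> nat \<Rightarrow> nat" where
  "std_dim t n = (if t = TypeB then 2 * n + 1 else 2 * n)"

text \<open>Rows and columns are numbered from \<open>0\<close>, so the antidiagonal is \<open>i + j + 1 = M\<close> and its lower
  half consists of the rows \<open>i \<ge> n\<close>.\<close>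

definition form_mat :: "cartan_type \<Rightarrow> nat \<Rightarrow> 'k::field mat" where
  "form_mat t n = mat (std_dim t n) (std_dim t n)
     (\<lambda>(i, j). if i + j + 1 = std_dim t n then (if t = TypeC \<and> n \<le> i then - 1 else 1) else 0)"

definition classical_group :: "cartan_type \<Rightarrow> nat \<Rightarrow> 'k::field mat set" where
  "classical_group t n = {x \<in> carrier_mat (std_dim t n) (std_dim t n).
     det x = 1 \<and> x * form_mat t n * transpose_mat x = form_mat t n}"

definition classical_lie :: "cartan_type \<Rightarrow> nat \<Rightarrow> 'k::field mat set" where
  "classical_lie t n = {x \<in> carrier_mat (std_dim t n) (std_dim t n).
     x * form_mat t n + form_mat t n * transpose_mat x = 0\<^sub>m (std_dim t n) (std_dim t n)}"

definition cartan_subalg :: "cartan_type \<Rightarrow> nat \<Rightarrow> 'k::field mat set" where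
  "cartan_subalg t n = {x \<in> classical_lie t n. diagonal_mat x}"

definition killing_form :: "cartan_type \<Rightarrow> nat \<Rightarrow> 'k::field mat \<Rightarrow> 'k mat \<Rightarrow> 'k" where
  "killing_form t n x y =
     trace_on (std_dim t n) (classical_lie t n) (\<lambda>z. lie_bracket x (lie_bracket y z))"

inductive_set lie_generated :: "nat \<Rightarrow> 'k::field mat set \<Rightarrow> 'k mat set"
  for m :: nat and S :: "'k mat set" where
  zero: "0\<^sub>m m m \<in> lie_generated m S"
| gen: "x \<in> S \<Longrightarrow> x \<in> lie_generated m S"
| add: "x \<in> lie_generated m S \<Longrightarrow> y \<in> lie_generated m S \<Longrightarrow> x + y \<in> lie_generated m S"
| smult: "x \<in> lie_generated m S \<Longrightarrow> c \<cdot>\<^sub>m x \<in> lie_generated m S"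
| bracket: "x \<in> lie_generated m S \<Longrightarrow> y \<in> lie_generated m S \<Longrightarrow>
    lie_bracket x y \<in> lie_generated m S"

definition lie_iso :: "'k::field mat set \<Rightarrow> 'k mat set \<Rightarrow> ('k mat \<Rightarrow> 'k mat) \<Rightarrow> bool" where
  "lie_iso V W \<phi> \<longleftrightarrow> bij_betw \<phi> V W \<and>
     (\<forall>x\<in>V. \<forall>y\<in>V. \<phi> (x + y) = \<phi> x + \<phi> y) \<and>
     (\<forall>c. \<forall>x\<in>V. \<phi> (c \<cdot>\<^sub>m x) = c \<cdot>\<^sub>m \<phi> x) \<and>
     (\<forall>x\<in>V. \<forall>y\<in>V. \<phi> (lie_bracket x y) = lie_bracket (\<phi> x) (\<phi> y))"


section \<open>Roots\<close>

text \<open>The simple roots are indexed by \<open>1, \<dots>, n\<close>. The functional \<open>simple_root_fun t n i\<close> is the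
  differential of the character \<open>e\<^bsup>\<alpha>\<^sub>i\<^esup>\<close> of the diagonal torus; the formula, which only makes
  sense on the Cartan subalgebra, is a linear functional on all matrices, so that contracting a
  tensor of \<open>\<hh> \<otimes> \<hh>\<close> with it is unambiguous.\<close>

definition simple_root_fun :: "cartan_type \<Rightarrow> nat \<Rightarrow> nat \<Rightarrow> 'k::field mat \<Rightarrow> 'k" where
  "simple_root_fun t n i D =
     (if i < n then D $$ (i - 1, i - 1) - D $$ (i, i)
      else (case t of
          TypeB \<Rightarrow> D $$ (n - 1, n - 1)
        | TypeC \<Rightarrow> 2 * D $$ (n - 1, n - 1)
        | TypeD \<Rightarrow> D $$ (n - 2, n - 2) + D $$ (n - 1, n - 1)))"

text \<open>An element \<open>\<Sum>i. a i \<cdot> \<alpha>\<^sub>i\<close> of the root lattice is given by its coefficient function \<open>a\<close>,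
  which vanishes outside \<open>{1..n}\<close>.\<close>

type_synonym lattice_vec = "nat \<Rightarrow> int"

definition supp :: "lattice_vec \<Rightarrow> nat set" where
  "supp a = {i. a i \<noteq> 0}"

definition simple_root :: "nat \<Rightarrow> lattice_vec" where
  "simple_root i = (\<lambda>j. if j = i then 1 else 0)"

definition neg_root :: "lattice_vec \<Rightarrow> lattice_vec" where
  "neg_root a = (\<lambda>i. - a i)"

definition root_fun :: "cartan_type \<Rightarrow> nat \<Rightarrow> lattice_vec \<Rightarrow> 'k::field mat \<Rightarrow> 'k" where
  "root_fun t n a D = (\<Sum>i\<in>{1..n}. of_int (a i) * simple_root_fun t n i D)"

definition root_space :: "cartan_type \<Rightarrow> nat \<Rightarrow> lattice_vec \<Rightarrow> 'k::field mat set" where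
  "root_space t n a = {x \<in> classical_lie t n.
     \<forall>D \<in> cartan_subalg t n. lie_bracket D x = root_fun t n a D \<cdot>\<^sub>m x}"

definition roots :: "'k::field itself \<Rightarrow> cartan_type \<Rightarrow> nat \<Rightarrow> lattice_vec set" where
  "roots K t n = {a. supp a \<noteq> {} \<and> supp a \<subseteq> {1..n} \<and>
     (\<exists>x \<in> (root_space t n a :: 'k mat set). x \<noteq> 0\<^sub>m (std_dim t n) (std_dim t n))}"

definition pos_roots :: "'k::field itself \<Rightarrow> cartan_type \<Rightarrow> nat \<Rightarrow> lattice_vec set" where
  "pos_roots K t n = {a \<in> roots K t n. \<forall>i. 0 \<le> a i}"

text \<open>The form on \<open>\<hh>\<^sup>*\<close> that is dual to the restriction of the Killing form to \<open>\<hh>\<close>.\<close>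

definition dual_vec :: "cartan_type \<Rightarrow> nat \<Rightarrow> lattice_vec \<Rightarrow> 'k::field mat" where
  "dual_vec t n a = (THE D. D \<in> cartan_subalg t n \<and>
     (\<forall>D' \<in> cartan_subalg t n. killing_form t n D D' = root_fun t n a D'))"

definition root_form :: "'k::field itself \<Rightarrow> cartan_type \<Rightarrow> nat \<Rightarrow> lattice_vec \<Rightarrow> lattice_vec \<Rightarrow> 'k"
  where "root_form K t n a b = killing_form t n (dual_vec t n a) (dual_vec t n b)"


section \<open>Admissible triples and Belavin-Drinfeld r-matrices\<close>

text \<open>Subsets of the set of simple roots are sets of indices. The partial map
  \<open>\<tau> : \<Gamma>\<^sub>1 \<rightarrow> \<Gamma>\<^sub>2\<close> is identified with its graph, so that its integer powers are relational powers.\<close>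

definition tau_graph :: "nat set \<Rightarrow> (nat \<Rightarrow> nat) \<Rightarrow> (nat \<times> nat) set" where
  "tau_graph \<Gamma>\<^sub>1 \<tau> = {(i, \<tau> i) | i. i \<in> \<Gamma>\<^sub>1}"

definition rel_int_pow :: "('a \<times> 'a) set \<Rightarrow> int \<Rightarrow> ('a \<times> 'a) set" where
  "rel_int_pow R k = (if 0 \<le> k then R ^^ nat k else (R\<inverse>) ^^ nat (- k))"

definition admissible_triple ::
  "'k::field itself \<Rightarrow> cartan_type \<Rightarrow> nat \<Rightarrow> nat set \<Rightarrow> nat set \<Rightarrow> (nat \<Rightarrow> nat) \<Rightarrow> bool" where
  "admissible_triple K t n \<Gamma>\<^sub>1 \<Gamma>\<^sub>2 \<tau> \<longleftrightarrow>
     \<Gamma>\<^sub>1 \<subseteq> {1..n} \<and> \<Gamma>\<^sub>2 \<subseteq> {1..n} \<and> bij_betw \<tau> \<Gamma>\<^sub>1 \<Gamma>\<^sub>2 \<and>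
     (\<forall>i\<in>\<Gamma>\<^sub>1. \<forall>j\<in>\<Gamma>\<^sub>1. root_form K t n (simple_root (\<tau> i)) (simple_root (\<tau> j)) =
        root_form K t n (simple_root i) (simple_root j)) \<and>
     (\<forall>i\<in>\<Gamma>\<^sub>1. \<exists>k\<ge>1. \<exists>j. (i, j) \<in> tau_graph \<Gamma>\<^sub>1 \<tau> ^^ k \<and> j \<notin> \<Gamma>\<^sub>1)"

text \<open>The linear extension \<open>\<Sum>i\<in>\<Gamma>\<^sub>1. a i \<cdot> \<alpha>\<^sub>i \<mapsto> \<Sum>i\<in>\<Gamma>\<^sub>1. a i \<cdot> \<tau>(\<alpha>\<^sub>i)\<close>, again as a partial map.\<close>

definition tau_lin :: "nat set \<Rightarrow> (nat \<Rightarrow> nat) \<Rightarrow> lattice_vec \<Rightarrow> lattice_vec" where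
  "tau_lin \<Gamma>\<^sub>1 \<tau> a = (\<lambda>j. \<Sum>i\<in>\<Gamma>\<^sub>1. a i * simple_root (\<tau> i) j)"

definition tau_lin_graph ::
  "nat set \<Rightarrow> (nat \<Rightarrow> nat) \<Rightarrow> (lattice_vec \<times> lattice_vec) set" where
  "tau_lin_graph \<Gamma>\<^sub>1 \<tau> = {(a, tau_lin \<Gamma>\<^sub>1 \<tau> a) | a. supp a \<subseteq> \<Gamma>\<^sub>1}"

definition root_vectors ::
  "cartan_type \<Rightarrow> nat \<Rightarrow> nat set \<Rightarrow> nat set \<Rightarrow> (nat \<Rightarrow> nat) \<Rightarrow> (lattice_vec \<Rightarrow> 'k::field mat) \<Rightarrow> bool"
  where
  "root_vectors t n \<Gamma>\<^sub>1 \<Gamma>\<^sub>2 \<tau> e \<longleftrightarrow>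
     (\<forall>a \<in> roots TYPE('k) t n. e a \<in> root_space t n a \<and> killing_form t n (e a) (e (neg_root a)) = 1) \<and>
     (let gens = (\<lambda>\<Gamma>. e ` (simple_root ` \<Gamma> \<union> (neg_root \<circ> simple_root) ` \<Gamma>))
      in \<exists>\<phi>. lie_iso (lie_generated (std_dim t n) (gens \<Gamma>\<^sub>1)) (lie_generated (std_dim t n) (gens \<Gamma>\<^sub>2)) \<phi> \<and>
         (\<forall>i\<in>\<Gamma>\<^sub>1. \<phi> (e (simple_root i)) = e (simple_root (\<tau> i)) \<and>
            \<phi> (e (neg_root (simple_root i))) = e (neg_root (simple_root (\<tau> i)))) \<and>
         (\<forall>a \<in> roots TYPE('k) t n. supp a \<subseteq> \<Gamma>\<^sub>1 \<longrightarrow> \<phi> (e a) = e (tau_lin \<Gamma>\<^sub>1 \<tau> a)))"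

definition cartan_part ::
  "cartan_type \<Rightarrow> nat \<Rightarrow> nat set \<Rightarrow> (nat \<Rightarrow> nat) \<Rightarrow> 'k::field mat \<Rightarrow> bool" where
  "cartan_part t n \<Gamma>\<^sub>1 \<tau> r\<^sub>0 \<longleftrightarrow> (let m = std_dim t n in
     r\<^sub>0 \<in> tensor_space m (cartan_subalg t n) (cartan_subalg t n) \<and>
     (\<exists>ts. mat_basis m (cartan_subalg t n) ts \<and>
        (\<forall>i<length ts. \<forall>j<length ts. killing_form t n (ts ! i) (ts ! j) = (if i = j then 1 else 0)) \<and>
        r\<^sub>0 + tensor_flip m r\<^sub>0 = mat_sum (m * m) (\<lambda>i. kron (ts ! i) (ts ! i)) {..<length ts}) \<and>
     (\<forall>i\<in>\<Gamma>\<^sub>1. contract_fst m (simple_root_fun t n (\<tau> i)) r\<^sub>0 +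
        contract_snd m (simple_root_fun t n i) r\<^sub>0 = 0\<^sub>m m m))"

text \<open>The index set of the last sum consists of the triples \<open>(\<alpha>, k, \<tau>\<^sup>k(\<alpha>))\<close> for which
  \<open>\<tau>\<^sup>k(\<alpha>)\<close> is defined; it is finite for an admissible triple.\<close>

definition bd_r_matrix ::
  "cartan_type \<Rightarrow> nat \<Rightarrow> nat set \<Rightarrow> nat set \<Rightarrow> (nat \<Rightarrow> nat) \<Rightarrow> 'k::field mat \<Rightarrow> bool" where
  "bd_r_matrix t n \<Gamma>\<^sub>1 \<Gamma>\<^sub>2 \<tau> r \<longleftrightarrow> (let m = std_dim t n in
     \<exists>e r\<^sub>0. root_vectors t n \<Gamma>\<^sub>1 \<Gamma>\<^sub>2 \<tau> e \<and> cartan_part t n \<Gamma>\<^sub>1 \<tau> r\<^sub>0 \<and>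
       r = r\<^sub>0
         + mat_sum (m * m) (\<lambda>a. kron (e (neg_root a)) (e a)) (pos_roots TYPE('k) t n)
         + mat_sum (m * m) (\<lambda>(a, k, b). wedge (e (neg_root a)) (e b))
             {(a, k, b). a \<in> pos_roots TYPE('k) t n \<and> supp a \<subseteq> \<Gamma>\<^sub>1 \<and> 1 \<le> k \<and>
                (a, b) \<in> tau_lin_graph \<Gamma>\<^sub>1 \<tau> ^^ k})"


section \<open>Non-twisted Belavin-Drinfeld cohomology\<close>

definition Ad :: "'k::field mat \<Rightarrow> 'k mat \<Rightarrow> 'k mat" where
  "Ad x z = x * z * mat_inv x"

definition bd_centralizer :: "cartan_type \<Rightarrow> nat \<Rightarrow> 'k::field mat \<Rightarrow> 'k mat set" where
  "bd_centralizer t n r = {x \<in> classical_group t n. tensor_map (std_dim t n) (Ad x) (Ad x) r = r}"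

definition galois_group :: "('f::field alg_closure \<Rightarrow> 'f alg_closure) set" where
  "galois_group = {\<sigma>. bij \<sigma> \<and> (\<forall>x y. \<sigma> (x + y) = \<sigma> x + \<sigma> y) \<and> (\<forall>x y. \<sigma> (x * y) = \<sigma> x * \<sigma> y) \<and>
     (\<forall>x. \<sigma> (to_ac x) = to_ac x)}"

definition bd_cocycles :: "cartan_type \<Rightarrow> nat \<Rightarrow> 'f::field alg_closure mat \<Rightarrow> 'f alg_closure mat set"
  where
  "bd_cocycles t n r = {x \<in> classical_group t n.
     \<forall>\<sigma>\<in>galois_group. mat_inv x * map_mat \<sigma> x \<in> bd_centralizer t n r}"

definition bd_equiv ::
  "cartan_type \<Rightarrow> nat \<Rightarrow> 'f::field alg_closure mat \<Rightarrow> ('f alg_closure mat \<times> 'f alg_closure mat) set"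
  where
  "bd_equiv t n r = {(x\<^sub>1, x\<^sub>2). x\<^sub>1 \<in> bd_cocycles t n r \<and> x\<^sub>2 \<in> bd_cocycles t n r \<and>
     (\<exists>Q \<in> (classical_group t n :: 'f mat set). \<exists>C \<in> bd_centralizer t n r.
        x\<^sub>1 = map_mat to_ac Q * x\<^sub>2 * C)}"

definition bd_cohomology ::
  "cartan_type \<Rightarrow> nat \<Rightarrow> 'f::field alg_closure mat \<Rightarrow> 'f alg_closure mat set set" where
  "bd_cohomology t n r = bd_cocycles t n r // bd_equiv t n r"

definition square_classes :: "'f::field set set" where
  "square_classes = carrier (mult_of (ring_of_type_algebra :: 'f ring) Mod {x\<^sup>2 | x. x \<noteq> 0})"

end

theory Submission
  imports Defs
begin

text \<open>Contracting the first tensor factor of \<open>r\<close> with the trace form gives an operator on \<open>\<gg>\<close> which,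
  graded by a coweight that increases along \<open>\<tau>\<close>, is triangular. An element of \<open>C(r)\<close> commutes with this
  operator and with the one of the other factor, hence preserves the generalised kernels and normalizes
  both opposite nilpotent subalgebras; so it is diagonal, and \<open>C(r)\<close> consists of the \<open>D \<in> H\<close> with
  \<open>e\<^bsup>\<alpha>\<^esup>(D) = e\<^bsup>\<tau>(\<alpha>)\<^esup>(D)\<close> for \<open>\<alpha> \<in> \<Gamma>\<^sub>1\<close>. Every cocycle is therefore \<open>Q D\<close> with \<open>Q \<in> G(F)\<close> and \<open>D \<in> H\<close>
  whose ratios \<open>e\<^bsup>\<alpha>\<^esup>(D) / e\<^bsup>\<tau>(\<alpha>)\<^esup>(D)\<close> are rational, and its class only depends on these ratios up to those
  of \<open>H(F)\<close>. Any values of the simple characters, normalized to \<open>1\<close> at one root of each \<open>\<tau>\<close>-orbit, come from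
  a rational diagonal matrix provided that a square root can be extracted: in type \<open>B\<close> none is
  needed, in type \<open>C\<close> that of the value at \<open>\<alpha>\<^sub>n\<close>, and in type \<open>D\<close> that of \<open>e\<^bsup>\<alpha>\<^sub>n\<^esup> / e\<^bsup>\<alpha>\<^sub>n\<^sub>-\<^sub>1\<^esup> = d\<^sub>n\<^sup>2\<close>. The normalization
  makes these \<open>1\<close> unless \<open>\<alpha>\<^sub>n\<^sub>-\<^sub>1\<close> and \<open>\<alpha>\<^sub>n\<close> share an orbit, when the class of \<open>d\<^sub>n\<^sup>2\<close> modulo squares remains.\<close>

section \<open>The fixed field of the Galois group\<close>

text \<open>Two obstacles shape the argument. The action of \<open>r0\<close> on the Cartan
  subalgebra is not explicit, so a generalised kernel may contain diagonal matrices, and nilpotency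
  has to single out the strictly triangular elements. In type D the antidiagonal entries of the Lie
  algebra vanish, so exchanging the two middle basis vectors preserves both opposite nilpotent
  subalgebras; this symmetry of the fork has determinant -1, and the condition det = 1 is what
  excludes it. The square roots come from lattices: the roots span a sublattice of the characters of
  H that has index 1 in type B and index 2 in types C and D, so rational values of the simple
  characters determine a rational torus element only up to one square root. As C(r) is diagonal,
  Galois descent amounts to scaling columns, and the essential fact about the Galois group is that
  its fixed field is F. For this, automorphisms are constructed as maximal partial isomorphisms of
  the algebraic closure.\<close>

definition partial_iso :: "('f::field alg_closure \<times> 'f alg_closure) set \<Rightarrow> bool" where
  "partial_iso G \<longleftrightarrow> (\<forall>a. (to_ac a, to_ac a) \<in> G) \<and>
     (\<forall>x x' y y'. (x, x') \<in> G \<longrightarrow> (y, y') \<in> G \<longrightarrow> (x + y, x' + y') \<in> G \<and> (x * y, x' * y') \<in> G) \<and>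
     (\<forall>y. (0, y) \<in> G \<longrightarrow> y = 0)"

text \<open>\<open>q\<close> plays the role of the image of \<open>p\<close> under the partial
  isomorphism. Keeping the isomorphism as a relation avoids naming its domain; that it is
  single-valued follows by subtraction from the clause about 0 in
  \<open>partial_iso\<close>.\<close>

definition coeffs_in :: "('f::field alg_closure \<times> 'f alg_closure) set \<Rightarrow>
    'f alg_closure poly \<Rightarrow> 'f alg_closure poly \<Rightarrow> bool" where
  "coeffs_in G p q \<longleftrightarrow> (\<forall>i. (Polynomial.coeff p i, Polynomial.coeff q i) \<in> G)"

text \<open>The candidate for an extension that sends \<open>z\<close> to \<open>z'\<close>.
  Polynomial values are enough, because \<open>z\<close> is algebraic and the field it generates
  consists of polynomials in \<open>z\<close>.\<close>

definition adjoin :: "('f::field alg_closure \<times> 'f alg_closure) set \<Rightarrow>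
    'f alg_closure \<Rightarrow> 'f alg_closure \<Rightarrow> ('f alg_closure \<times> 'f alg_closure) set" where
  "adjoin G z z' = {(poly p z, poly q z') | p q. coeffs_in G p q}"

context
  fixes G :: "('f::field alg_closure \<times> 'f alg_closure) set"
  assumes G: "partial_iso G"
begin

lemma base_in: "(to_ac a, to_ac a) \<in> G"
  and add_in: "(x, x') \<in> G \<Longrightarrow> (y, y') \<in> G \<Longrightarrow> (x + y, x' + y') \<in> G"
  and mult_in: "(x, x') \<in> G \<Longrightarrow> (y, y') \<in> G \<Longrightarrow> (x * y, x' * y') \<in> G"
  and zero_unique: "(0, y) \<in> G \<Longrightarrow> y = 0"
  using G unfolding partial_iso_def by blast+

lemma zero_in: "(0, 0) \<in> G" and one_in: "(1, 1) \<in> G" and minus_one_in: "(-1, -1) \<in> G"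
  using base_in[of 0] base_in[of 1] base_in[of "-1"] by simp_all

lemma uminus_in: "(x, x') \<in> G \<Longrightarrow> (- x, - x') \<in> G"
  using mult_in[OF minus_one_in] by fastforce

lemma diff_in: "(x, x') \<in> G \<Longrightarrow> (y, y') \<in> G \<Longrightarrow> (x - y, x' - y') \<in> G"
  using add_in[OF _ uminus_in] by fastforce

lemma sum_in: "(\<And>i. i \<in> A \<Longrightarrow> (f i, g i) \<in> G) \<Longrightarrow> (sum f A, sum g A) \<in> G"
  by (induction A rule: infinite_finite_induct) (auto intro: zero_in add_in)

lemma poly_in:
  assumes "coeffs_in G p q" "(x, y) \<in> G"
  shows "(poly p x, poly q y) \<in> G"
proof -
  have pow: "(x ^ i, y ^ i) \<in> G" for i
    by (induction i) (auto intro: one_in mult_in assms)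
  define N where "N = max (degree p) (degree q)"
  have "poly p x = (\<Sum>i\<le>N. Polynomial.coeff p i * x ^ i)" "poly q y = (\<Sum>i\<le>N. Polynomial.coeff q i * y ^ i)"
    by (auto simp: N_def poly_altdef intro!: sum.mono_neutral_left coeff_eq_0)
  moreover have "((\<Sum>i\<le>N. Polynomial.coeff p i * x ^ i), (\<Sum>i\<le>N. Polynomial.coeff q i * y ^ i)) \<in> G"
    using assms(1) by (intro sum_in mult_in pow) (auto simp: coeffs_in_def)
  ultimately show ?thesis by simp
qed

lemma coeffs_in_to_ac: "coeffs_in G (map_poly to_ac p) (map_poly to_ac p)"
  by (auto simp: coeffs_in_def coeff_map_poly base_in)

lemma coeffs_in_const: "(x, y) \<in> G \<Longrightarrow> coeffs_in G [:x:] [:y:]"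
  by (auto simp: coeffs_in_def coeff_pCons zero_in split: nat.split)

lemma coeffs_in_pCons: "(x, y) \<in> G \<Longrightarrow> coeffs_in G p q \<Longrightarrow> coeffs_in G (pCons x p) (pCons y q)"
  by (auto simp: coeffs_in_def coeff_pCons split: nat.split)

lemma coeffs_in_add: "coeffs_in G p q \<Longrightarrow> coeffs_in G p' q' \<Longrightarrow> coeffs_in G (p + p') (q + q')"
  by (auto simp: coeffs_in_def add_in)

lemma coeffs_in_diff: "coeffs_in G p q \<Longrightarrow> coeffs_in G p' q' \<Longrightarrow> coeffs_in G (p - p') (q - q')"
  by (auto simp: coeffs_in_def diff_in)

lemma coeffs_in_mult: "coeffs_in G p q \<Longrightarrow> coeffs_in G p' q' \<Longrightarrow> coeffs_in G (p * p') (q * q')"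
  by (auto simp: coeffs_in_def coeff_mult intro!: sum_in mult_in)

lemma coeffs_in_monom: "(x, y) \<in> G \<Longrightarrow> coeffs_in G (Polynomial.monom x d) (Polynomial.monom y d)"
  by (auto simp: coeffs_in_def coeff_monom zero_in)

text \<open>Every \<open>w\<close> is algebraic over F. A polynomial a + X q over F of least degree
  that kills \<open>w\<close> has a nonzero, since otherwise q would kill \<open>w\<close> in
  smaller degree. Hence 1/w = -q(w)/a is a polynomial in \<open>w\<close>, and closure under sums
  and products already makes the domain a field.\<close>

lemma inverse_in:
  assumes "(w, v) \<in> G" "w \<noteq> 0"
  shows "\<exists>v'. (inverse w, v') \<in> G"
proof -
  obtain p :: "'f poly" where "p \<noteq> 0" "poly (map_poly to_ac p) w = 0"
    by (rule alg_closure_algebraic)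
  from ex_has_least_nat[of "\<lambda>p :: 'f poly. p \<noteq> 0 \<and> poly (map_poly to_ac p) w = 0", OF conjI[OF this]]
  obtain p :: "'f poly" where p: "p \<noteq> 0" "poly (map_poly to_ac p) w = 0"
    and min: "\<And>q :: 'f poly. q \<noteq> 0 \<Longrightarrow> poly (map_poly to_ac q) w = 0 \<Longrightarrow> degree p \<le> degree q"
    by metis
  obtain a q where pq: "p = pCons a q" by (cases p)
  have ev: "to_ac a + w * poly (map_poly to_ac q) w = 0"
    using p(2) unfolding pq by (simp add: map_poly_pCons)
  have a: "a \<noteq> 0"
  proof
    assume "a = 0"
    hence "q \<noteq> 0" "poly (map_poly to_ac q) w = 0" using p(1) pq ev assms(2) by auto
    from min[OF this] show False using \<open>q \<noteq> 0\<close> \<open>a = 0\<close> pq by simp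
  qed
  have "(to_ac (- inverse a) * poly (map_poly to_ac q) w, to_ac (- inverse a) * poly (map_poly to_ac q) v) \<in> G"
    by (intro mult_in base_in poly_in coeffs_in_to_ac assms)
  moreover have "to_ac (- inverse a) * poly (map_poly to_ac q) w = inverse w"
  proof -
    have "w * (to_ac (- inverse a) * poly (map_poly to_ac q) w) = to_ac (- inverse a) * (- to_ac a)"
      using ev by (metis (no_types, lifting) add_eq_0_iff2 mult.left_commute minus_minus add.commute)
    also have "\<dots> = 1" using a by (simp flip: to_ac_mult)
    finally show ?thesis using assms(2) by (metis inverse_unique)
  qed
  ultimately show ?thesis by auto
qed

text \<open>The relation w w' = 1 is carried to v v' = 1, because the difference of both sides is 0
  and 0 corresponds to 0 alone.\<close>

lemma nonzero_in:
  assumes "(w, v) \<in> G" "w \<noteq> 0"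
  shows "v \<noteq> 0" "(inverse w, inverse v) \<in> G"
proof -
  obtain v' where v': "(inverse w, v') \<in> G" using inverse_in[OF assms] by blast
  have "(w * inverse w - 1, v * v' - 1) \<in> G" by (intro diff_in mult_in assms v' one_in)
  hence eq: "v * v' = 1" using zero_unique[of "v * v' - 1"] assms(2) by simp
  thus "v \<noteq> 0" by auto
  from eq have "v' = inverse v" by (metis inverse_unique)
  thus "(inverse w, inverse v) \<in> G" using v' by simp
qed

lemma degree_in:
  assumes "coeffs_in G p q"
  shows "degree p = degree q" "p \<noteq> 0 \<Longrightarrow> q \<noteq> 0"
proof -
  have *: "Polynomial.coeff p i = 0 \<longleftrightarrow> Polynomial.coeff q i = 0" for i
    using assms nonzero_in(1) zero_unique unfolding coeffs_in_def by metis
  show "degree p = degree q"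
    by (rule antisym; rule degree_le) (use * coeff_eq_0 in auto)
  show "p \<noteq> 0 \<Longrightarrow> q \<noteq> 0" using * by (metis coeff_0 leading_coeff_0_iff)
qed

text \<open>Minimality of the degree among all polynomials over the domain takes the place of
  irreducibility.\<close>

lemma minimal_poly_in:
  obtains p q where "coeffs_in G p q" "p \<noteq> 0" "poly p z = 0"
    "\<forall>p' q'. coeffs_in G p' q' \<longrightarrow> p' \<noteq> 0 \<longrightarrow> poly p' z = 0 \<longrightarrow> degree p \<le> degree p'"
proof -
  obtain p :: "'f poly" where "p \<noteq> 0" "poly (map_poly to_ac p) z = 0"
    by (rule alg_closure_algebraic)
  moreover have "map_poly to_ac p \<noteq> 0" using \<open>p \<noteq> 0\<close>
    by (metis coeff_0 coeff_map_poly leading_coeff_0_iff to_ac_0 to_ac_eq_0_iff)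
  ultimately have "\<exists>u. coeffs_in G (fst u) (snd u) \<and> fst u \<noteq> 0 \<and> poly (fst u) z = 0"
    using coeffs_in_to_ac[of p] by (intro exI[of _ "(map_poly to_ac p, map_poly to_ac p)"]) auto
  then obtain u0 where u0: "coeffs_in G (fst u0) (snd u0) \<and> fst u0 \<noteq> 0 \<and> poly (fst u0) z = 0" ..
  define P where "P u \<longleftrightarrow> coeffs_in G (fst u) (snd u) \<and> fst u \<noteq> 0 \<and> poly (fst u) z = 0" for u
  have "P u0" using u0 by (simp add: P_def)
  then obtain u where u: "P u" and min: "\<And>v. P v \<Longrightarrow> degree (fst u) \<le> degree (fst v)"
    using ex_has_least_nat[of P u0 "\<lambda>u. degree (fst u)"] by blast
  have "degree (fst u) \<le> degree p'" if "coeffs_in G p' q'" "p' \<noteq> 0" "poly p' z = 0" for p' q'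
    using min[of "(p', q')"] that by (simp add: P_def)
  with u show ?thesis unfolding P_def by (intro that[of "fst u" "snd u"]) auto
qed

text \<open>Division by \<open>p\<close> is performed in parallel on \<open>f\<close> and, with
  \<open>q\<close>, on \<open>g\<close>: leading terms are cancelled until minimality of
  \<open>p\<close> forces the remainder of \<open>f\<close> to be 0. This is what makes the
  assignment of \<open>z'\<close> to \<open>z\<close> well defined.\<close>

lemma minimal_poly_transfer:
  assumes pq: "coeffs_in G p q" "p \<noteq> 0" "poly p z = 0"
    and min: "\<forall>p' q'. coeffs_in G p' q' \<longrightarrow> p' \<noteq> 0 \<longrightarrow> poly p' z = 0 \<longrightarrow> degree p \<le> degree p'"
    and z': "poly q z' = 0"
    and fg: "coeffs_in G f g" "poly f z = 0"
  shows "poly g z' = 0"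
  using fg
proof (induction "degree f" arbitrary: f g rule: less_induct)
  case less
  show ?case
  proof (cases "f = 0")
    case True
    hence "Polynomial.coeff g i = 0" for i using less.prems(1) zero_unique by (auto simp: coeffs_in_def)
    hence "g = 0" by (simp add: poly_eq_iff)
    thus ?thesis by simp
  next
    case False
    have le: "degree p \<le> degree f" using min less.prems False by blast
    define d where "d = degree f - degree p"
    define x where "x = Polynomial.lead_coeff f * inverse (Polynomial.lead_coeff p)"
    define y where "y = Polynomial.coeff g (degree f) * inverse (Polynomial.coeff q (degree p))"
    have lp: "Polynomial.lead_coeff p \<noteq> 0" using pq(2) by simp
    have xy: "(x, y) \<in> G"
      unfolding x_def y_def using less.prems(1) pq(1) lp
      by (intro mult_in nonzero_in(2)) (auto simp: coeffs_in_def)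
    define f' where "f' = f - Polynomial.monom x d * p"
    define g' where "g' = g - Polynomial.monom y d * q"
    have c: "coeffs_in G f' g'"
      unfolding f'_def g'_def by (intro coeffs_in_diff coeffs_in_mult coeffs_in_monom xy less.prems pq)
    have ev: "poly f' z = 0" by (simp add: f'_def less.prems pq)
    have "poly g' z' = 0"
    proof (cases "degree f = 0")
      case True
      hence "degree p = 0" using le by simp
      then obtain a where "p = [:a:]" by (metis degree_eq_zeroE)
      hence False using pq(2,3) by simp
      thus ?thesis ..
    next
      case False
      have dx: "degree (Polynomial.monom x d * p) \<le> degree f"
        using le by (metis d_def degree_monom_le degree_mult_le le_add_diff_inverse2 nat_add_left_cancel_le add.commute order_trans)
      have "Polynomial.coeff (Polynomial.monom x d * p) (degree f) = x * Polynomial.lead_coeff p"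
        using le by (simp add: coeff_monom_mult d_def)
      hence "Polynomial.coeff f' (degree f) = 0"
        using lp by (simp add: f'_def x_def)
      moreover have "degree f' \<le> degree f" unfolding f'_def using dx by (rule degree_diff_le[OF order_refl])
      ultimately have "degree f' < degree f"
        using False by (metis le_neq_implies_less leading_coeff_0_iff degree_0)
      thus ?thesis using less.hyps c ev by blast
    qed
    thus ?thesis using z' by (simp add: g'_def)
  qed
qed

lemma adjoin:
  assumes pq: "coeffs_in G p q" "p \<noteq> 0" "poly p z = 0"
    and min: "\<forall>p' q'. coeffs_in G p' q' \<longrightarrow> p' \<noteq> 0 \<longrightarrow> poly p' z = 0 \<longrightarrow> degree p \<le> degree p'"
    and z': "poly q z' = 0"
  shows "partial_iso (adjoin G z z')" "G \<subseteq> adjoin G z z'" "(z, z') \<in> adjoin G z z'"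
proof -
  show sub: "G \<subseteq> adjoin G z z'"
  proof clarify
    fix x y assume "(x, y) \<in> G"
    thus "(x, y) \<in> adjoin G z z'"
      unfolding adjoin_def using coeffs_in_const[of x y] by (intro CollectI exI[of _ "[:x:]"] exI[of _ "[:y:]"]) auto
  qed
  show "(z, z') \<in> adjoin G z z'"
    unfolding adjoin_def using coeffs_in_pCons[OF zero_in coeffs_in_const[OF one_in]]
    by (intro CollectI exI[of _ "[:0, 1:]"]) auto
  have 1: "(x + y, x' + y') \<in> adjoin G z z' \<and> (x * y, x' * y') \<in> adjoin G z z'"
    if A: "(x, x') \<in> adjoin G z z'" "(y, y') \<in> adjoin G z z'" for x x' y y'
  proof -
    obtain a b where ab: "x = poly a z" "x' = poly b z'" "coeffs_in G a b"
      using A(1) unfolding adjoin_def by auto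
    obtain c d where cd: "y = poly c z" "y' = poly d z'" "coeffs_in G c d"
      using A(2) unfolding adjoin_def by auto
    have "x + y = poly (a + c) z" "x' + y' = poly (b + d) z'" "x * y = poly (a * c) z" "x' * y' = poly (b * d) z'"
      using ab cd by auto
    thus ?thesis unfolding adjoin_def using coeffs_in_add[OF ab(3) cd(3)] coeffs_in_mult[OF ab(3) cd(3)] by blast
  qed
  have 2: "y = 0" if A: "(0, y) \<in> adjoin G z z'" for y
  proof -
    obtain a b where "poly a z = 0" "y = poly b z'" "coeffs_in G a b"
      using A unfolding adjoin_def by auto
    thus ?thesis using minimal_poly_transfer[OF pq min z'] by blast
  qed
  show "partial_iso (adjoin G z z')"
    unfolding partial_iso_def using 1 2 sub base_in by blast
qed

end

section \<open>Extension of partial isomorphisms to automorphisms of the algebraic closure\<close>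

lemma partial_iso_maximal:
  assumes "partial_iso G"
  obtains G' where "partial_iso G'" "G \<subseteq> G'" "\<And>z. \<exists>z'. (z, z') \<in> G'"
proof -
  let ?A = "{H. partial_iso H \<and> G \<subseteq> H}"
  have ch: "\<Union>C \<in> ?A" if C: "C \<noteq> {}" "subset.chain ?A C" for C
  proof -
    have C1: "\<And>H. H \<in> C \<Longrightarrow> partial_iso H \<and> G \<subseteq> H"
      and C2: "\<And>H H'. H \<in> C \<Longrightarrow> H' \<in> C \<Longrightarrow> H \<subseteq> H' \<or> H' \<subseteq> H"
      using C(2) unfolding subset.chain_def by blast+
    obtain H0 where H0: "H0 \<in> C" using C(1) by blast
    have "(x + y, x' + y') \<in> \<Union>C \<and> (x * y, x' * y') \<in> \<Union>C"
      if "(x, x') \<in> \<Union>C" "(y, y') \<in> \<Union>C" for x x' y y'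
    proof -
      from that obtain H where H: "H \<in> C" "(x, x') \<in> H" "(y, y') \<in> H" using C2 by blast
      thus ?thesis using C1[OF H(1)] add_in[of H] mult_in[of H] by blast
    qed
    moreover have "(to_ac a, to_ac a) \<in> \<Union>C" for a using base_in[of H0] C1[OF H0] H0 by blast
    moreover have "y = 0" if "(0, y) \<in> \<Union>C" for y using that C1 zero_unique by blast
    ultimately have "partial_iso (\<Union>C)" unfolding partial_iso_def by blast
    thus ?thesis using C1[OF H0] H0 by blast
  qed
  obtain M where M: "M \<in> ?A" and max: "\<And>H. H \<in> ?A \<Longrightarrow> M \<subseteq> H \<Longrightarrow> H = M"
    using subset_Zorn_nonempty[of ?A] ch assms by auto
  have Mp: "partial_iso M" "G \<subseteq> M" using M by auto
  have "\<exists>z'. (z, z') \<in> M" for z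
  proof -
    obtain p q where pq: "coeffs_in M p q" "p \<noteq> 0" "poly p z = 0"
      "\<forall>p' q'. coeffs_in M p' q' \<longrightarrow> p' \<noteq> 0 \<longrightarrow> poly p' z = 0 \<longrightarrow> degree p \<le> degree p'"
      using minimal_poly_in[OF Mp(1)] by metis
    have "degree p \<noteq> 0" using pq(2,3) by (metis degree_eq_zeroE mult_zero_right poly_const_conv pCons_0_0)
    hence "degree q > 0" using degree_in(1)[OF Mp(1) pq(1)] by simp
    \<comment> \<open>The image of the minimal polynomial of \<open>z\<close> has a root in the
      algebraic closure; sending \<open>z\<close> to it extends the graph, so by maximality
      \<open>z\<close> was in the domain already.\<close>
    then obtain z' where z': "poly q z' = 0" using alg_closed_imp_poly_has_root by blast
    note a = adjoin[OF Mp(1) pq z']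
    hence "adjoin M z z' = M" using max[of "adjoin M z z'"] Mp(2) by blast
    thus ?thesis using a(3) by blast
  qed
  thus ?thesis using that Mp by blast
qed

lemma galois_group_of_partial_iso:
  assumes G: "partial_iso G" and dom: "\<And>z. \<exists>z'. (z, z') \<in> G"
  obtains \<sigma> where "\<sigma> \<in> galois_group" "\<And>x y. (x, y) \<in> G \<Longrightarrow> \<sigma> x = y"
proof -
  have uniq: "y = y'" if "(x, y) \<in> G" "(x, y') \<in> G" for x y y'
    using zero_unique[OF G, of "y - y'"] diff_in[OF G that] by simp
  define \<sigma> where "\<sigma> x = (SOME y. (x, y) \<in> G)" for x
  have in_G: "(x, \<sigma> x) \<in> G" for x unfolding \<sigma>_def using dom by (rule someI_ex)
  have eq: "\<sigma> x = y" if "(x, y) \<in> G" for x y using uniq in_G that by blast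
  have add: "\<sigma> (x + y) = \<sigma> x + \<sigma> y" and mult: "\<sigma> (x * y) = \<sigma> x * \<sigma> y" for x y
    using eq add_in[OF G] mult_in[OF G] in_G by blast+
  have fix_F: "\<sigma> (to_ac a) = to_ac a" for a using eq base_in[OF G] by blast
  have inj: "inj \<sigma>"
  proof (rule injI)
    fix x y assume "\<sigma> x = \<sigma> y"
    hence "(x - y, 0) \<in> G" using diff_in[OF G in_G in_G, of x y] by simp
    thus "x = y" using nonzero_in(1)[OF G, of "x - y" 0] by auto
  qed
  \<comment> \<open>\<sigma> maps the finite root set of a polynomial over F injectively into
    itself, hence permutes it.\<close>
  have surj: "y \<in> range \<sigma>" for y
  proof -
    obtain p :: "'a poly" where p: "p \<noteq> 0" "poly (map_poly to_ac p) y = 0" by (rule alg_closure_algebraic)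
    let ?p = "map_poly to_ac p"
    have p0: "?p \<noteq> 0" using \<open>p \<noteq> 0\<close>
      by (metis coeff_0 coeff_map_poly leading_coeff_0_iff to_ac_0 to_ac_eq_0_iff)
    let ?S = "{x. poly ?p x = 0}"
    have fin: "finite ?S" using p0 by (rule poly_roots_finite)
    have "\<sigma> x \<in> ?S" if "x \<in> ?S" for x
    proof -
      have "(poly ?p x, poly ?p (\<sigma> x)) \<in> G"
        by (rule poly_in[OF G coeffs_in_to_ac[OF G] in_G])
      thus ?thesis using that zero_unique[OF G] by simp
    qed
    hence "\<sigma> ` ?S \<subseteq> ?S" by blast
    moreover have "inj_on \<sigma> ?S" using inj by (rule inj_on_subset) simp
    ultimately have "\<sigma> ` ?S = ?S" using fin endo_inj_surj by blast
    thus ?thesis using p(2) by blast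
  qed
  have "bij \<sigma>" using inj surj by (auto simp: bij_def)
  hence "\<sigma> \<in> galois_group" using add mult fix_F unfolding galois_group_def by auto
  thus ?thesis using that eq by blast
qed

text \<open>A fixed element is the only root of its minimal polynomial, since some automorphism
  would move it to any other root. So this polynomial is c (X - x)^d, whose coefficient at d - 1 is
  -d c x; characteristic zero allows division by d.\<close>

theorem fixed_field_galois_group:
  fixes x :: "'f::field_char_0 alg_closure"
  assumes fixed: "\<And>\<sigma>. \<sigma> \<in> galois_group \<Longrightarrow> \<sigma> x = x"
  shows "x \<in> range to_ac"
proof -
  define G :: "('f alg_closure \<times> 'f alg_closure) set" where "G = (\<lambda>a. (to_ac a, to_ac a)) ` UNIV"
  have GI: "(a, b) \<in> G \<longleftrightarrow> a = b \<and> a \<in> range to_ac" for a b unfolding G_def by auto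
  have clos: "a + b \<in> range to_ac" "a * b \<in> range to_ac" if ab: "a \<in> range to_ac" "b \<in> range to_ac" for a b :: "'f alg_closure"
  proof -
    obtain u v where "a = to_ac u" "b = to_ac v" using ab by blast
    hence "a + b = to_ac (u + v)" "a * b = to_ac (u * v)" by auto
    thus "a + b \<in> range to_ac" "a * b \<in> range to_ac" by blast+
  qed
  have G: "partial_iso G"
    unfolding partial_iso_def GI using clos by auto
  obtain p q where pq: "coeffs_in G p q" "p \<noteq> 0" "poly p x = 0"
    and min: "\<forall>p' q'. coeffs_in G p' q' \<longrightarrow> p' \<noteq> 0 \<longrightarrow> poly p' x = 0 \<longrightarrow> degree p \<le> degree p'"
    using minimal_poly_in[OF G] by metis
  have qp: "q = p" using pq(1) unfolding coeffs_in_def GI by (metis poly_eqI)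
  have cp: "Polynomial.coeff p i \<in> range to_ac" for i using pq(1) unfolding coeffs_in_def GI by blast
  have only: "y = x" if y: "poly p y = 0" for y
  proof -
    have "poly q y = 0" using y qp by simp
    note a = adjoin[OF G pq min this]
    from a obtain G' where "partial_iso G'" "adjoin G x y \<subseteq> G'" "\<And>z. \<exists>z'. (z, z') \<in> G'"
      using partial_iso_maximal by metis
    then obtain \<sigma> where "\<sigma> \<in> galois_group" "\<sigma> x = y"
      using galois_group_of_partial_iso[of G'] a(3) by (metis subsetD)
    thus ?thesis using fixed[of \<sigma>] by simp
  qed
  obtain r where r: "p = [:- x, 1:] ^ order x p * r" "\<not> [:- x, 1:] dvd r"
    using order_decomp[OF pq(2)] by blast
  define d where "d = order x p"
  have "degree r = 0"
  proof (rule ccontr)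
    assume "degree r \<noteq> 0"
    then obtain y where y: "poly r y = 0" using alg_closed_imp_poly_has_root[of r] by auto
    hence "poly p y = 0" by (subst r(1)) simp
    hence "poly r x = 0" using only y by blast
    thus False using r(2) by (simp add: poly_eq_0_iff_dvd)
  qed
  then obtain c where c: "r = [:c:]" by (metis degree_eq_zeroE)
  have peq: "p = Polynomial.smult c ([:- x, 1:] ^ d)" using r(1) c unfolding d_def by simp
  have c0: "c \<noteq> 0" using pq(2) peq by auto
  have d0: "d > 0" using pq(3) peq c0 by (cases d) auto
  have lead: "Polynomial.coeff ([:- x, 1:] ^ d) d = 1"
    using lead_coeff_power[of "[:- x, 1:]" d] by (simp add: degree_power_eq)
  have sub: "Polynomial.coeff ([:- x, 1:] ^ k) (k - 1) = - of_nat k * x" if "k > 0" for k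
    using that
  proof (induction k)
    case (Suc k)
    show ?case
    proof (cases k)
      case (Suc j)
      have m: "Polynomial.coeff ([:- x, 1:] ^ k) k = 1"
        using lead_coeff_power[of "[:- x, 1:]" k] by (simp add: degree_power_eq)
      have "Polynomial.coeff ([:- x, 1:] ^ Suc k) (Suc k - 1) = - x * Polynomial.coeff ([:- x, 1:] ^ k) k
            + Polynomial.coeff ([:- x, 1:] ^ k) (k - 1)"
        using Suc by (simp add: mult_pCons_left coeff_pCons)
      also have "\<dots> = - of_nat (Suc k) * x"
        using Suc.IH Suc m by (simp add: algebra_simps)
      finally show ?thesis .
    qed simp
  qed simp
  have "c \<in> range to_ac" using cp[of d] lead peq by simp
  then obtain c' where c': "c = to_ac c'" by blast
  have "- of_nat d * (c * x) \<in> range to_ac" using cp[of "d - 1"] sub[OF d0] peq by (simp add: algebra_simps)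
  then obtain b where b: "- of_nat d * (c * x) = to_ac b" by blast
  have "x = to_ac (b / (- of_nat d * c'))"
    using b[symmetric] c0 d0 c' by (auto simp: field_simps)
  thus ?thesis by blast
qed

section \<open>Products with diagonal matrices\<close>

lemma mat_mult_diag_left:
  assumes "D \<in> carrier_mat m m" "x \<in> carrier_mat m m" "diagonal_mat D" "i < m" "j < m"
  shows "(D * x) $$ (i, j) = (D $$ (i, i) :: 'a::comm_semiring_0) * x $$ (i, j)"
proof -
  have "(D * x) $$ (i, j) = (\<Sum>k<m. D $$ (i, k) * x $$ (k, j))"
    using assms by (simp add: scalar_prod_def atLeast0LessThan)
  also have "\<dots> = (\<Sum>k<m. if k = i then D $$ (i, i) * x $$ (i, j) else 0)"
    using assms by (intro sum.cong) (auto simp: diagonal_mat_def)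
  finally show ?thesis using assms by simp
qed

lemma mat_mult_diag_right:
  assumes "D \<in> carrier_mat m m" "x \<in> carrier_mat m m" "diagonal_mat D" "i < m" "j < m"
  shows "(x * D) $$ (i, j) = x $$ (i, j) * (D $$ (j, j) :: 'a::comm_semiring_0)"
proof -
  have "(x * D) $$ (i, j) = (\<Sum>k<m. x $$ (i, k) * D $$ (k, j))"
    using assms by (simp add: scalar_prod_def atLeast0LessThan)
  also have "\<dots> = (\<Sum>k<m. if k = j then x $$ (i, j) * D $$ (j, j) else 0)"
    using assms by (intro sum.cong) (auto simp: diagonal_mat_def)
  finally show ?thesis using assms by simp
qed

section \<open>The classical Lie algebras\<close>

locale classical_type =
  fixes K :: "'k::field_char_0 itself" and t :: cartan_type and n :: nat
  assumes rank_pos: "1 \<le> n" and rank_D: "t = TypeD \<Longrightarrow> 3 \<le> n"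
begin

abbreviation m :: nat where "m \<equiv> std_dim t n"

text \<open>Opaque versions of \<open>t = TypeB\<close> etc., which the simplifier does not use to rewrite \<open>t\<close>.\<close>

definition isB :: bool where "isB \<longleftrightarrow> t = TypeB"
definition isC :: bool where "isC \<longleftrightarrow> t = TypeC"
definition isD :: bool where "isD \<longleftrightarrow> t = TypeD"

lemma type_exhaust: "isB \<or> isC \<or> isD"
  unfolding isB_def isC_def isD_def by (cases t) simp_all

lemma type_cases [simp]: "isB \<Longrightarrow> \<not> isC" "isB \<Longrightarrow> \<not> isD" "isC \<Longrightarrow> \<not> isD"
  unfolding isB_def isC_def isD_def by simp_all

lemma rank_D': "isD \<Longrightarrow> 3 \<le> n"
  using rank_D by (simp add: isD_def)

lemma case_type: "(case t of TypeB \<Rightarrow> x | TypeC \<Rightarrow> y | TypeD \<Rightarrow> z) = (if isB then x else if isC then y else z)"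
  by (simp add: isB_def isC_def split: cartan_type.split)

definition opp :: "nat \<Rightarrow> nat" where "opp i = m - 1 - i"

definition sg :: "nat \<Rightarrow> 'k" where "sg i = (if isC \<and> n \<le> i then - 1 else 1)"

lemma m_pos: "0 < m"
  and m_cases: "m = 2 * n \<or> isB \<and> m = 2 * n + 1"
  and m_B: "isB \<Longrightarrow> m = 2 * n + 1" and m_C: "isC \<Longrightarrow> m = 2 * n" and m_D: "isD \<Longrightarrow> m = 2 * n"
  and n_le_m: "n \<le> m"
  using rank_pos by (auto simp: std_dim_def isB_def isC_def isD_def)

lemma opp_less [simp]: "i < m \<Longrightarrow> opp i < m"
  and opp_opp [simp]: "i < m \<Longrightarrow> opp (opp i) = i"
  and opp_iff: "i < m \<Longrightarrow> j < m \<Longrightarrow> i + j + 1 = m \<longleftrightarrow> j = opp i"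
  and opp_less_iff: "i < m \<Longrightarrow> j < m \<Longrightarrow> opp i < opp j \<longleftrightarrow> j < i"
  by (auto simp: opp_def)

lemma opp_inj [simp]: "i < m \<Longrightarrow> j < m \<Longrightarrow> opp i = opp j \<longleftrightarrow> i = j"
  by (metis opp_opp)

lemma opp_swap: "i < m \<Longrightarrow> j < m \<Longrightarrow> i = opp j \<longleftrightarrow> j = opp i"
  by (metis opp_opp)

lemma sg_sq [simp]: "sg i * sg i = 1" "sg i * (sg i * x) = x"
  and sg_nonzero [simp]: "sg i \<noteq> 0"
  by (auto simp: sg_def)

lemma sg_opp: "i < m \<Longrightarrow> sg (opp i) = (if isC then - sg i else sg i)"
  using m_C unfolding sg_def opp_def by (cases isC) auto

lemma sg_opp_mult: "i < m \<Longrightarrow> j < m \<Longrightarrow> sg (opp i) * sg (opp j) = sg i * sg j"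
  by (simp add: sg_opp)

lemma form_mat_index: "i < m \<Longrightarrow> j < m \<Longrightarrow> form_mat t n $$ (i, j) = (if j = opp i then sg i else 0)"
  using opp_iff by (auto simp: form_mat_def sg_def isC_def)

lemma form_mat_carrier [simp]: "form_mat t n \<in> carrier_mat m m"
  and form_mat_dim [simp]: "dim_row (form_mat t n) = m" "dim_col (form_mat t n) = m"
  by (simp_all add: form_mat_def)

lemma mult_form_mat:
  assumes "x \<in> carrier_mat m m" "i < m" "j < m"
  shows "(x * form_mat t n) $$ (i, j) = x $$ (i, opp j) * sg (opp j)"
proof -
  have "(x * form_mat t n) $$ (i, j) = (\<Sum>k<m. x $$ (i, k) * form_mat t n $$ (k, j))"
    using assms form_mat_dim by (simp add: scalar_prod_def atLeast0LessThan)
  also have "\<dots> = (\<Sum>k<m. if k = opp j then x $$ (i, opp j) * sg (opp j) else 0)"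
    using assms by (intro sum.cong) (auto simp: form_mat_index opp_swap)
  finally show ?thesis using assms by simp
qed

lemma form_mat_mult_transpose:
  assumes "x \<in> carrier_mat m m" "i < m" "j < m"
  shows "(form_mat t n * transpose_mat x) $$ (i, j) = sg i * x $$ (j, opp i)"
proof -
  have "(form_mat t n * transpose_mat x) $$ (i, j) = (\<Sum>k<m. form_mat t n $$ (i, k) * x $$ (j, k))"
    using assms form_mat_dim by (simp add: scalar_prod_def atLeast0LessThan)
  also have "\<dots> = (\<Sum>k<m. if k = opp i then sg i * x $$ (j, opp i) else 0)"
    using assms by (intro sum.cong) (auto simp: form_mat_index)
  finally show ?thesis using assms by simp
qed

text \<open>Read at the position (i, \<open>opp j\<close>), the defining equation compares an entry
  with its mirror image in the antidiagonal. Up to signs, the Lie algebra is the space of matrices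
  antisymmetric under this reflection.\<close>

lemma lie_iff:
  fixes x :: "'k mat"
  shows "x \<in> classical_lie t n \<longleftrightarrow> x \<in> carrier_mat m m \<and>
    (\<forall>i<m. \<forall>j<m. x $$ (opp j, opp i) = - (sg i * sg j * x $$ (i, j)))"
proof (cases "x \<in> carrier_mat m m")
  case True
  have "x \<in> classical_lie t n \<longleftrightarrow>
      (\<forall>i<m. \<forall>j<m. (x * form_mat t n + form_mat t n * transpose_mat x) $$ (i, j) = 0)"
    unfolding classical_lie_def using True by (auto simp: mat_eq_iff)
  also have "\<dots> \<longleftrightarrow> (\<forall>i<m. \<forall>j<m. x $$ (i, opp j) * sg (opp j) + sg i * x $$ (j, opp i) = 0)"
  proof -
    have "(x * form_mat t n + form_mat t n * transpose_mat x) $$ (i, j) =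
       x $$ (i, opp j) * sg (opp j) + sg i * x $$ (j, opp i)" if "i < m" "j < m" for i j
      using True form_mat_carrier that mult_form_mat[OF True that] form_mat_mult_transpose[OF True that]
      by (subst index_add_mat) auto
    thus ?thesis by auto
  qed
  also have "\<dots> \<longleftrightarrow> (\<forall>i<m. \<forall>j<m. x $$ (i, j) * sg j + sg i * x $$ (opp j, opp i) = 0)"
    by (metis opp_less opp_opp)
  also have "\<dots> \<longleftrightarrow> (\<forall>i<m. \<forall>j<m. x $$ (opp j, opp i) = - (sg i * sg j * x $$ (i, j)))"
  proof -
    have "x $$ (i, j) * sg j + sg i * x $$ (opp j, opp i) = 0 \<longleftrightarrow> x $$ (opp j, opp i) = - (sg i * sg j * x $$ (i, j))" for i j
    proof -
      have "x $$ (i, j) * sg j + sg i * x $$ (opp j, opp i) = sg i * (x $$ (opp j, opp i) + sg i * sg j * x $$ (i, j))"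
        by (simp add: algebra_simps)
      thus ?thesis by (simp add: eq_neg_iff_add_eq_0)
    qed
    thus ?thesis by blast
  qed
  finally show ?thesis using True by simp
qed (auto simp: classical_lie_def)

lemma lie_carrier: "x \<in> classical_lie t n \<Longrightarrow> (x :: 'k mat) \<in> carrier_mat m m"
  and lie_opp: "x \<in> classical_lie t n \<Longrightarrow> i < m \<Longrightarrow> j < m \<Longrightarrow> (x :: 'k mat) $$ (opp j, opp i) = - (sg i * sg j * x $$ (i, j))"
  using lie_iff by auto

text \<open>Outside type C an antidiagonal entry is its own mirror image and equals its negative, so
  these positions carry no root.\<close>

lemma lie_antidiag:
  assumes "(x :: 'k mat) \<in> classical_lie t n" "\<not> isC" "i < m"
  shows "x $$ (i, opp i) = 0"
proof -
  have "x $$ (i, opp i) = - x $$ (i, opp i)"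
    using lie_opp[OF assms(1), of i "opp i"] assms by (simp add: sg_opp)
  hence "2 * x $$ (i, opp i) = 0" by (metis add.right_inverse mult_2)
  thus ?thesis by simp
qed

lemma lie_zero: "0\<^sub>m m m \<in> (classical_lie t n :: 'k mat set)"
  and lie_add: "x \<in> classical_lie t n \<Longrightarrow> y \<in> classical_lie t n \<Longrightarrow> x + (y :: 'k mat) \<in> classical_lie t n"
  and lie_smult: "x \<in> classical_lie t n \<Longrightarrow> c \<cdot>\<^sub>m (x :: 'k mat) \<in> classical_lie t n"
  by (auto simp: lie_iff algebra_simps)

lemma bracket_carrier: "x \<in> carrier_mat m m \<Longrightarrow> y \<in> carrier_mat m m \<Longrightarrow> lie_bracket x y \<in> carrier_mat m m"
  by (auto simp: lie_bracket_def)

lemma bracket_index: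
  assumes "x \<in> carrier_mat m m" "y \<in> carrier_mat m m" "i < m" "j < m"
  shows "lie_bracket x y $$ (i, j) = (\<Sum>k<m. x $$ (i, k) * y $$ (k, j) - y $$ (i, k) * (x $$ (k, j) :: 'k))"
  using assms by (simp add: lie_bracket_def scalar_prod_def atLeast0LessThan sum_subtractf)

lemma opp_bij: "bij_betw opp {..<m} {..<m}"
  by (rule bij_betw_byWitness[of _ opp]) auto

lemma lie_bracket_closed:
  assumes "x \<in> classical_lie t n" "(y :: 'k mat) \<in> classical_lie t n"
  shows "lie_bracket x y \<in> classical_lie t n"
  unfolding lie_iff
proof (intro conjI allI impI)
  note xc = lie_carrier[OF assms(1)] and yc = lie_carrier[OF assms(2)]
  show "lie_bracket x y \<in> carrier_mat m m" using bracket_carrier xc yc .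
  fix i j assume ij: "i < m" "j < m"
  have "lie_bracket x y $$ (opp j, opp i) = (\<Sum>k<m. x $$ (opp j, k) * y $$ (k, opp i) - y $$ (opp j, k) * x $$ (k, opp i))"
    using ij xc yc by (simp add: bracket_index)
  also have "\<dots> = (\<Sum>k<m. x $$ (opp j, opp k) * y $$ (opp k, opp i) - y $$ (opp j, opp k) * x $$ (opp k, opp i))"
    by (rule sum.reindex_bij_betw[OF opp_bij, symmetric])
  also have "\<dots> = (\<Sum>k<m. - (sg i * sg j * (x $$ (i, k) * y $$ (k, j) - y $$ (i, k) * x $$ (k, j))))"
    using ij by (intro sum.cong refl) (simp add: lie_opp[OF assms(1)] lie_opp[OF assms(2)] algebra_simps)
  also have "\<dots> = - (sg i * sg j * lie_bracket x y $$ (i, j))"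
    using ij xc yc by (simp add: bracket_index sum_negf sum_distrib_left)
  finally show "lie_bracket x y $$ (opp j, opp i) = - (sg i * sg j * lie_bracket x y $$ (i, j))" .
qed

subsection \<open>The Cartan subalgebra\<close>

lemma cartan_iff:
  "(D :: 'k mat) \<in> cartan_subalg t n \<longleftrightarrow> D \<in> carrier_mat m m \<and> diagonal_mat D \<and>
     (\<forall>i<m. D $$ (opp i, opp i) = - D $$ (i, i))"
proof -
  have "D $$ (opp j, opp i) = - (sg i * sg j * D $$ (i, j))" if "D \<in> carrier_mat m m" "diagonal_mat D"
     "(\<forall>i<m. D $$ (opp i, opp i) = - D $$ (i, i))" "i < m" "j < m" for i j
    using that by (cases "i = j") (auto simp: diagonal_mat_def)
  thus ?thesis unfolding cartan_subalg_def lie_iff by auto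
qed

text \<open>The last branch is reached at the middle index of type B, where the diagonal elements of
  the Lie algebra vanish.\<close>

definition dvals :: "(nat \<Rightarrow> 'k) \<Rightarrow> nat \<Rightarrow> 'k" where
  "dvals d i = (if i < n then d i else if opp i < n then - d (opp i) else 0)"

definition cartan_mat :: "(nat \<Rightarrow> 'k) \<Rightarrow> 'k mat" where
  "cartan_mat d = mat m m (\<lambda>(i, j). if i = j then dvals d i else 0)"

lemma opp_less_n: "i < n \<Longrightarrow> \<not> opp i < n" "i < m \<Longrightarrow> \<not> i < n \<Longrightarrow> opp i < n \<or> opp i = i \<and> isB \<and> i = n"
  using m_cases by (auto simp: opp_def)

lemma dvals_opp: "i < m \<Longrightarrow> dvals d (opp i) = - dvals d i"
  using opp_less_n by (auto simp: dvals_def)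

lemma cartan_mat_in: "cartan_mat d \<in> cartan_subalg t n"
  unfolding cartan_iff using dvals_opp by (auto simp: cartan_mat_def diagonal_mat_def)

lemma cartan_mat_index [simp]: "i < m \<Longrightarrow> cartan_mat d $$ (i, i) = dvals d i"
  by (simp add: cartan_mat_def)

lemma cartan_bracket:
  assumes "D \<in> cartan_subalg t n" "x \<in> carrier_mat m m" "i < m" "j < m"
  shows "lie_bracket D x $$ (i, j) = (D $$ (i, i) - D $$ (j, j)) * (x $$ (i, j) :: 'k)"
  using assms mat_mult_diag_left[of D m x i j] mat_mult_diag_right[of D m x i j]
  by (auto simp: lie_bracket_def cartan_iff algebra_simps)

text \<open>Solves \<open>\<alpha>\<^sub>k(D) = u\<^sub>k\<close>.\<close>

definition coweight :: "(nat \<Rightarrow> 'k) \<Rightarrow> 'k mat" where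
  "coweight u = cartan_mat (\<lambda>i. (if isB then u n else if isC then u n / 2 else (u n - u (n - 1)) / 2) +
     (\<Sum>k\<in>{i<..<n}. u k))"

lemma coweight_in: "coweight u \<in> cartan_subalg t n"
  unfolding coweight_def by (rule cartan_mat_in)

lemma simple_root_coweight:
  assumes "k \<in> {1..n}"
  shows "simple_root_fun t n k (coweight u) = u k"
proof -
  \<comment> \<open>\<open>s\<close> is the last coordinate of the diagonal matrix. In type D it
    comes from \<open>\<alpha>\<^sub>n - \<alpha>\<^sub>n\<^sub>-\<^sub>1\<close>, which is twice
    that coordinate; the other coordinates follow by telescoping.\<close>
  define s where "s = (if isB then u n else if isC then u n / 2 else (u n - u (n - 1)) / 2)"
  have e: "coweight u $$ (i, i) = s + (\<Sum>k\<in>{i<..<n}. u k)" if "i < n" for i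
    using that n_le_m by (simp add: coweight_def s_def dvals_def)
  have last: "{n - 1<..<n} = {}" by auto
  show ?thesis
  proof (cases "k < n")
    case True
    have "{k - 1<..<n} = insert k {k<..<n}" using assms True by auto
    thus ?thesis using True assms by (simp add: simple_root_fun_def e)
  next
    case False
    hence k: "k = n" using assms by simp
    have "{n - 2<..<n} = {n - 1}" if "isD" using rank_D'[OF that] by auto
    thus ?thesis using k rank_pos last
      using type_exhaust by (auto simp: simple_root_fun_def case_type e s_def field_simps)
  qed
qed

lemma root_fun_coweight: "root_fun t n a (coweight u) = (\<Sum>k\<in>{1..n}. of_int (a k) * u k)"
  unfolding root_fun_def by (intro sum.cong refl) (simp add: simple_root_coweight)

text \<open>The coweights dual to the simple roots read off the coefficients, and in characteristic
  zero distinct integers stay distinct in the field.\<close>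

lemma root_fun_inject:
  assumes "supp a \<subseteq> {1..n}" "supp b \<subseteq> {1..n}"
    and eq: "\<And>D :: 'k mat. D \<in> cartan_subalg t n \<Longrightarrow> root_fun t n a D = root_fun t n b D"
  shows "a = b"
proof
  fix k
  show "a k = b k"
  proof (cases "k \<in> {1..n}")
    case True
    let ?u = "\<lambda>j. if j = k then 1 else (0 :: 'k)"
    have "(of_int (c k) :: 'k) = root_fun t n c (coweight ?u)" for c
    proof -
      have "root_fun t n c (coweight ?u) = (\<Sum>j\<in>{1..n}. if j = k then of_int (c k) else 0)"
        unfolding root_fun_coweight by (intro sum.cong) auto
      thus ?thesis using True by simp
    qed
    hence "(of_int (a k) :: 'k) = of_int (b k)" using eq[OF coweight_in] by metis
    thus ?thesis by simp
  next
    case False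
    thus ?thesis using assms(1,2) unfolding supp_def by (metis (mono_tags, lifting) mem_Collect_eq subsetD)
  qed
qed

lemma root_fun_add: "root_fun t n (\<lambda>k. a k + b k) D = root_fun t n a D + (root_fun t n b D :: 'k)"
  by (simp add: root_fun_def algebra_simps sum.distrib)

lemma root_fun_neg: "root_fun t n (neg_root a) D = - (root_fun t n a D :: 'k)"
  by (simp add: root_fun_def neg_root_def sum_negf)

lemma root_fun_simple: "k \<in> {1..n} \<Longrightarrow> root_fun t n (simple_root k) D = (simple_root_fun t n k D :: 'k)"
proof -
  assume k: "k \<in> {1..n}"
  have "root_fun t n (simple_root k) D = (\<Sum>j\<in>{1..n}. if j = k then simple_root_fun t n k D else 0)"
    unfolding root_fun_def simple_root_def by (intro sum.cong) auto
  thus ?thesis using k by simp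
qed

subsection \<open>Roots as pairs of indices\<close>

text \<open>The off-diagonal positions at which an element of the Lie algebra can be nonzero. Mirror
  positions (i, j) and (\<open>opp j\<close>, \<open>opp i\<close>) carry the same root.\<close>

definition root_pair :: "nat \<Rightarrow> nat \<Rightarrow> bool" where
  "root_pair i j \<longleftrightarrow> i < m \<and> j < m \<and> i \<noteq> j \<and> (isC \<or> j \<noteq> opp i)"

definition has_weight :: "lattice_vec \<Rightarrow> nat \<Rightarrow> nat \<Rightarrow> bool" where
  "has_weight a i j \<longleftrightarrow> supp a \<subseteq> {1..n} \<and>
     (\<forall>D :: 'k mat. D \<in> cartan_subalg t n \<longrightarrow> root_fun t n a D = D $$ (i, i) - D $$ (j, j))"

text \<open>The simple root k sits at the position (\<open>simple_row k\<close>, k). With indices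
  from 0 this is the superdiagonal, except at the end of type D, where (n - 1, n) is antidiagonal
  and \<open>\<alpha>\<^sub>n\<close> moves to (n - 2, n).\<close>

definition simple_row :: "nat \<Rightarrow> nat" where
  "simple_row k = (if isD \<and> k = n then n - 2 else k - 1)"

lemma root_pair_sym: "root_pair i j \<Longrightarrow> root_pair j i"
  unfolding root_pair_def by (metis opp_less opp_opp)

lemma simple_pair:
  assumes "k \<in> {1..n}"
  shows "root_pair (simple_row k) k" "simple_row k < k"
proof -
  have "root_pair (simple_row k) k \<and> simple_row k < k"
    using assms m_C m_D m_B rank_D' rank_pos type_exhaust
    by (cases isC; cases isD) (auto simp: root_pair_def simple_row_def opp_def)
  thus "root_pair (simple_row k) k" "simple_row k < k" by auto
qed

text \<open>Every root position above the diagonal arises from the simple positions by reflection in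
  the antidiagonal and by joining (i, p) with (p, j). Induction on j - i over positions serves as
  the expansion of positive roots in simple ones.\<close>

lemma pos_pair_induct [consumes 2, case_names simple opp add]:
  assumes "root_pair i j" "i < j"
    and simple: "\<And>k. k \<in> {1..n} \<Longrightarrow> Q (simple_row k) k"
    and opp: "\<And>i j. root_pair i j \<Longrightarrow> i < j \<Longrightarrow> Q i j \<Longrightarrow> Q (opp j) (opp i)"
    and add: "\<And>i p j. root_pair i p \<Longrightarrow> root_pair p j \<Longrightarrow> root_pair i j \<Longrightarrow> i < p \<Longrightarrow> p < j \<Longrightarrow>
       Q i p \<Longrightarrow> Q p j \<Longrightarrow> Q i j"
  shows "Q i j"
  using assms(1,2)
proof (induction "j - i" arbitrary: i j rule: less_induct)
  case less
  have ij: "i < m" "j < m" using less.prems by (auto simp: root_pair_def)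
  have mirror: "Q i j" if "k \<in> {1..n}" "opp j = simple_row k" "opp i = k" for k
  proof -
    have "Q (opp k) (opp (simple_row k))"
      using opp[OF simple_pair(1) simple_pair(2) simple] that(1) by blast
    thus ?thesis using that ij by (metis opp_opp)
  qed
  have split: "Q i j" if "root_pair i p" "root_pair p j" "i < p" "p < j" for p
    using that less by (intro add[of i p j]) auto
  \<comment> \<open>The natural splitting point is the next index. In type D it fails when one of
    the two pieces would lie on the antidiagonal, so the configurations around the middle are
    separated.\<close>
  have D: "isD \<and> ((i = n - 1 \<and> j = n + 1) \<or> (i = n - 1 \<and> j > n + 1) \<or> (i = n - 2 \<and> j = n) \<or>
      (i \<noteq> n - 1 \<and> j \<noteq> opp (Suc i)) \<or> (i \<noteq> n - 1 \<and> i \<noteq> n - 2 \<and> j = opp (Suc i)))"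
    if "isD" "j > Suc i"
  proof -
    have "opp (Suc i) = 2 * n - Suc (Suc i)" "3 \<le> n" using that rank_D' by (simp_all add: opp_def m_D)
    moreover have "j = n + 1 \<or> j > n + 1" if "i = n - 1" using that \<open>j > Suc i\<close> by auto
    moreover have "i = n - 2 \<Longrightarrow> 2 * n - Suc (Suc i) = n" using \<open>3 \<le> n\<close> by simp
    ultimately show ?thesis using that(1) by metis
  qed
  have "j = Suc i \<and> Suc i \<le> n \<or> j = Suc i \<and> n \<le> i \<or> j > Suc i" using less.prems by linarith
  then consider "j = Suc i" "Suc i \<le> n" | "j = Suc i" "n \<le> i" | "j > Suc i" "isC"
    | "j > Suc i" "isB" "j \<noteq> opp (Suc i)" | "j > Suc i" "isB" "j = opp (Suc i)"
    | "j > Suc i" "isD" "i = n - 1" "j = n + 1" | "j > Suc i" "isD" "i = n - 1" "j > n + 1"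
    | "j > Suc i" "isD" "i = n - 2" "j = n"
    | "j > Suc i" "isD" "i \<noteq> n - 1" "j \<noteq> opp (Suc i)"
    | "j > Suc i" "isD" "i \<noteq> n - 1" "i \<noteq> n - 2" "j = opp (Suc i)"
    using type_exhaust D by argo
  thus ?case
  proof cases
    case 1
    have "isD \<Longrightarrow> j \<noteq> n"
      using less.prems 1 by (auto simp: root_pair_def opp_def m_D)
    hence "simple_row j = i" using 1 by (auto simp: simple_row_def)
    thus ?thesis using simple[of j] 1 by simp
  next
    case 2
    show ?thesis
      using 2 ij m_cases rank_D' by (intro mirror[of "opp i"]) (auto simp: opp_def simple_row_def)
  next
    case 3
    thus ?thesis using ij by (intro split[of "Suc i"]; auto simp: root_pair_def; presburger)
  next
    case 4
    thus ?thesis using ij less.prems by (intro split[of "Suc i"]; auto simp: root_pair_def opp_def m_B; presburger)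
  next
    \<comment> \<open>Here (\<open>Suc i\<close>, j) lies on the antidiagonal, so the middle index
      is taken as the splitting point instead.\<close>
    case 5
    thus ?thesis using ij less.prems by (intro split[of n]; auto simp: root_pair_def opp_def m_B; presburger)
  next
    case 6
    thus ?thesis using ij rank_D' by (intro mirror[of n]) (auto simp: opp_def m_D simple_row_def)
  next
    case 7
    thus ?thesis using ij rank_D' by (intro split[of "n + 1"]; auto simp: root_pair_def opp_def m_D; presburger)
  next
    case 8
    have "simple_row n = n - 2" using 8 by (simp add: simple_row_def)
    thus ?thesis using simple[of n] 8 rank_pos by simp
  next
    case 9
    thus ?thesis using ij rank_D' less.prems by (intro split[of "Suc i"]; auto simp: root_pair_def opp_def m_D; presburger)
  next
    case 10
    thus ?thesis using ij rank_D' less.prems by (intro split[of "Suc (Suc i)"]; auto simp: root_pair_def opp_def m_D; presburger)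
  qed
qed

end

context classical_type begin

lemma has_weight_unique: "has_weight a i j \<Longrightarrow> has_weight b i j \<Longrightarrow> a = b"
  unfolding has_weight_def by (intro root_fun_inject) auto

lemma has_weight_neg: "has_weight a i j \<Longrightarrow> has_weight (neg_root a) j i"
  unfolding has_weight_def by (auto simp: root_fun_neg) (auto simp: supp_def neg_root_def)

lemma supp_add: "supp a \<subseteq> S \<Longrightarrow> supp b \<subseteq> S \<Longrightarrow> supp (\<lambda>k. a k + b k) \<subseteq> S"
proof
  fix x assume s: "supp a \<subseteq> S" "supp b \<subseteq> S" "x \<in> supp (\<lambda>k. a k + b k)"
  hence "a x \<noteq> 0 \<or> b x \<noteq> 0" by (auto simp: supp_def)
  thus "x \<in> S" using s(1,2) by (auto simp: supp_def subset_iff)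
qed

lemma has_weight_add: "has_weight a i p \<Longrightarrow> has_weight b p j \<Longrightarrow> has_weight (\<lambda>k. a k + b k) i j"
  unfolding has_weight_def by (simp add: root_fun_add supp_add)

lemma has_weight_opp: "has_weight a i j \<Longrightarrow> i < m \<Longrightarrow> j < m \<Longrightarrow> has_weight a (opp j) (opp i)"
  unfolding has_weight_def by (auto simp: cartan_iff)

text \<open>The formulas for the last simple root become differences of diagonal entries because
  entry n of the diagonal is 0 in type B and the negative of entry n - 1 otherwise.\<close>

lemma simple_root_fun_index:
  assumes "k \<in> {1..n}" "(D :: 'k mat) \<in> cartan_subalg t n"
  shows "simple_root_fun t n k D = D $$ (simple_row k, simple_row k) - D $$ (k, k)"
proof -
  have opp: "D $$ (n, n) = - D $$ (n - 1, n - 1)" if "\<not> isB"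
  proof -
    have "opp (n - 1) = n" "n - 1 < m" using that type_exhaust rank_pos by (auto simp: opp_def m_C m_D)
    thus ?thesis using assms(2) by (metis cartan_iff)
  qed
  have mid: "D $$ (n, n) = 0" if "isB"
  proof -
    have "opp n = n" "n < m" using that by (auto simp: opp_def m_B)
    hence "D $$ (n, n) = - D $$ (n, n)" using assms(2) by (metis cartan_iff)
    hence "2 * D $$ (n, n) = 0" by (metis add.right_inverse mult_2)
    thus ?thesis by simp
  qed
  show ?thesis
  proof (cases "k < n")
    case True
    thus ?thesis by (simp add: simple_root_fun_def simple_row_def)
  next
    case False
    thus ?thesis using assms(1) opp mid type_exhaust
      by (cases isB; cases isC) (auto simp: simple_root_fun_def simple_row_def case_type)
  qed
qed

lemma has_weight_simple: "k \<in> {1..n} \<Longrightarrow> has_weight (simple_root k) (simple_row k) k"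
  unfolding has_weight_def by (auto simp: root_fun_simple simple_root_fun_index) (auto simp: supp_def simple_root_def split: if_splits)

lemma pos_weight_exists:
  assumes "root_pair i j" "i < j"
  shows "\<exists>a. has_weight a i j \<and> (\<forall>k. 0 \<le> a k)"
  using assms
proof (induction rule: pos_pair_induct)
  case (simple k)
  show ?case using has_weight_simple[OF simple] by (intro exI[of _ "simple_root k"]) (auto simp: simple_root_def)
next
  case (opp i j)
  thus ?case using has_weight_opp unfolding root_pair_def by blast
next
  case (add i p j)
  then obtain a b where "has_weight a i p" "has_weight b p j" "\<forall>k. 0 \<le> a k" "\<forall>k. 0 \<le> b k" by blast
  thus ?case using has_weight_add[of a i p b j] by (intro exI[of _ "\<lambda>k. a k + b k"]) auto
qed

text \<open>The index pairs \<open>(i, j)\<close> and \<open>(p, q)\<close> are compared on \<open>D = diag(0, \<dots>, 1, \<dots>, -1, \<dots>, 0)\<close>.\<close>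

lemma has_weight_pair_unique:
  assumes "root_pair i j" "root_pair p q" and a: "has_weight a i j" "has_weight a p q"
  shows "p = i \<and> q = j \<or> p = opp j \<and> q = opp i"
proof -
  have lt: "i < m" "j < m" "p < m" "q < m" using assms by (auto simp: root_pair_def)
  define \<epsilon> where "\<epsilon> k l = (if l = k then 1 else if l = opp k then - 1 else 0 :: int)" for k l
  have dv: "dvals (\<lambda>l. of_int (\<epsilon> k l)) l = of_int (\<epsilon> k l)" if "k < n" "l < m" for k l
    using opp_less_n[of l] that opp_swap[of k l] opp_opp[of l] n_le_m unfolding dvals_def \<epsilon>_def
    by (auto simp: opp_less_n)
  have eq: "\<epsilon> k i - \<epsilon> k j = \<epsilon> k p - \<epsilon> k q" if k: "k < n" for k
  proof -
    have "(of_int (\<epsilon> k i) :: 'k) - of_int (\<epsilon> k j) = of_int (\<epsilon> k p) - of_int (\<epsilon> k q)"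
      using a cartan_mat_in[of "\<lambda>l. of_int (\<epsilon> k l)"] lt unfolding has_weight_def
      by (metis cartan_mat_index dv[OF k])
    thus ?thesis by (simp flip: of_int_diff)
  qed
  have eq': "\<epsilon> k i - \<epsilon> k j = \<epsilon> k p - \<epsilon> k q" if k: "k < m" "k \<noteq> opp k" for k
  proof (cases "k < n")
    case False
    hence o: "opp k < n" using opp_less_n(2)[OF k(1)] k by auto
    have "\<epsilon> (opp k) l = - \<epsilon> k l" if "l < m" for l using that k unfolding \<epsilon>_def by auto
    thus ?thesis using eq[OF o] lt by simp
  qed (rule eq)
  have mid: "k = l" if "k < m" "l < m" "opp k = k" "opp l = l" for k l
    using that by (auto simp: opp_def)
  have ij: "i \<noteq> j" and pq: "p \<noteq> q" using assms by (auto simp: root_pair_def)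
  \<comment> \<open>No test diagonal detects an index fixed by \<open>opp\<close>. There is at most
    one such index, and the cases in which it occurs are treated apart.\<close>
  consider "opp i = i" | "opp j = j" | "opp i \<noteq> i" "opp j \<noteq> j" by blast
  thus ?thesis
  proof cases
    case 1
    hence j: "opp j \<noteq> j" using mid lt ij by blast
    have "\<epsilon> j i - \<epsilon> j j = \<epsilon> j p - \<epsilon> j q" using eq' j lt by metis
    moreover have "\<epsilon> j i - \<epsilon> j j = - 1" using ij 1 lt by (auto simp: \<epsilon>_def opp_swap)
    ultimately have "q = j \<and> p \<noteq> opp j \<and> p \<noteq> j \<or> p = opp j \<and> q \<noteq> j \<and> q \<noteq> opp j"
      by (auto simp: \<epsilon>_def split: if_splits)
    thus ?thesis
    proof
      assume h: "q = j \<and> p \<noteq> opp j \<and> p \<noteq> j"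
      have "opp p = p"
      proof (rule ccontr)
        assume np: "opp p \<noteq> p"
        hence "\<epsilon> p i - \<epsilon> p j = \<epsilon> p p - \<epsilon> p q" using eq' lt by metis
        moreover have "\<epsilon> p i = 0" using np 1 lt by (auto simp: \<epsilon>_def)
        moreover have "\<epsilon> p j = 0" using h lt by (auto simp: \<epsilon>_def)
        ultimately show False using h by (simp add: \<epsilon>_def)
      qed
      thus ?thesis using h mid 1 lt by metis
    next
      assume h: "p = opp j \<and> q \<noteq> j \<and> q \<noteq> opp j"
      have "opp q = q"
      proof (rule ccontr)
        assume nq: "opp q \<noteq> q"
        hence "\<epsilon> q i - \<epsilon> q j = \<epsilon> q p - \<epsilon> q q" using eq' lt by metis
        moreover have "\<epsilon> q i = 0" using nq 1 lt by (auto simp: \<epsilon>_def)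
        moreover have "\<epsilon> q j = 0" using h lt by (auto simp: \<epsilon>_def)
        moreover have "\<epsilon> q p = 0" using h lt by (auto simp: \<epsilon>_def)
        ultimately show False by (simp add: \<epsilon>_def)
      qed
      thus ?thesis using h mid 1 lt by metis
    qed
  next
    case 2
    hence i: "opp i \<noteq> i" using mid lt ij by blast
    have "\<epsilon> i i - \<epsilon> i j = \<epsilon> i p - \<epsilon> i q" using eq' i lt by metis
    moreover have "\<epsilon> i i - \<epsilon> i j = 1" using ij 2 lt by (auto simp: \<epsilon>_def opp_swap)
    ultimately have "p = i \<and> q \<noteq> opp i \<and> q \<noteq> i \<or> q = opp i \<and> p \<noteq> i \<and> p \<noteq> opp i"
      by (auto simp: \<epsilon>_def split: if_splits)
    thus ?thesis
    proof
      assume h: "p = i \<and> q \<noteq> opp i \<and> q \<noteq> i"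
      have "opp q = q"
      proof (rule ccontr)
        assume nq: "opp q \<noteq> q"
        hence "\<epsilon> q i - \<epsilon> q j = \<epsilon> q p - \<epsilon> q q" using eq' lt by metis
        moreover have "\<epsilon> q j = 0" using nq 2 lt by (auto simp: \<epsilon>_def)
        moreover have "\<epsilon> q i = 0" using h lt by (auto simp: \<epsilon>_def)
        ultimately show False using h by (simp add: \<epsilon>_def)
      qed
      thus ?thesis using h mid 2 lt by metis
    next
      assume h: "q = opp i \<and> p \<noteq> i \<and> p \<noteq> opp i"
      have "opp p = p"
      proof (rule ccontr)
        assume np: "opp p \<noteq> p"
        hence "\<epsilon> p i - \<epsilon> p j = \<epsilon> p p - \<epsilon> p q" using eq' lt by metis
        moreover have "\<epsilon> p j = 0" using np 2 lt by (auto simp: \<epsilon>_def)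
        moreover have "\<epsilon> p i = 0" "\<epsilon> p q = 0" using h lt by (auto simp: \<epsilon>_def)
        ultimately show False by (simp add: \<epsilon>_def)
      qed
      thus ?thesis using h mid 2 lt by metis
    qed
  next
    case 3
    have I: "\<epsilon> i i - \<epsilon> i j = \<epsilon> i p - \<epsilon> i q" and J: "\<epsilon> j i - \<epsilon> j j = \<epsilon> j p - \<epsilon> j q"
      using eq' 3 lt by metis+
    show ?thesis
    proof (cases "j = opp i")
      case True
      have "\<epsilon> i i - \<epsilon> i j = 2" using 3 True ij by (auto simp: \<epsilon>_def)
      hence "p = i \<and> q = opp i" using I by (auto simp: \<epsilon>_def split: if_splits)
      thus ?thesis using True by simp
    next
      case False
      have ei: "\<epsilon> i i - \<epsilon> i j = 1" using False ij by (auto simp: \<epsilon>_def)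
      have ej: "\<epsilon> j i - \<epsilon> j j = - 1" using False ij lt by (auto simp: \<epsilon>_def opp_swap)
      have A: "p = i \<or> q = opp i" using ei I by (auto simp: \<epsilon>_def split: if_splits)
      have B: "q = j \<or> p = opp j" using ej J by (auto simp: \<epsilon>_def split: if_splits)
      show ?thesis using A B False lt ij by (metis opp_opp)
    qed
  qed
qed

definition rt :: "nat \<Rightarrow> nat \<Rightarrow> lattice_vec" where
  "rt i j = (THE a. has_weight a i j)"

lemma rt_eqI: "has_weight a i j \<Longrightarrow> rt i j = a"
  unfolding rt_def using has_weight_unique by blast

lemma has_weight_rt: "root_pair i j \<Longrightarrow> has_weight (rt i j) i j"
proof -
  assume ij: "root_pair i j"
  hence "i < j \<or> j < i" by (auto simp: root_pair_def)
  hence "\<exists>a. has_weight a i j"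
    using pos_weight_exists ij has_weight_neg root_pair_sym by metis
  thus ?thesis using rt_eqI by blast
qed

lemma rt_nonneg: "root_pair i j \<Longrightarrow> i < j \<Longrightarrow> 0 \<le> rt i j k"
  using pos_weight_exists rt_eqI by metis

text \<open>If the weight were 0, the opposite position (j, i) would carry it as well, and
  uniqueness of positions would force both indices to be the middle one.\<close>

lemma has_weight_nonzero:
  assumes "root_pair i j" "has_weight a i j"
  shows "supp a \<noteq> {}"
proof
  assume "supp a = {}"
  hence a: "a = (\<lambda>_. 0)" by (auto simp: supp_def)
  have "D $$ (i, i) = D $$ (j, j)" if "D \<in> cartan_subalg t n" for D :: "'k mat"
    using assms(2) that by (simp add: has_weight_def a root_fun_def)
  hence "has_weight a j i" unfolding has_weight_def a by (auto simp: root_fun_def supp_def)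
  from has_weight_pair_unique[OF assms(1) root_pair_sym[OF assms(1)] assms(2) this]
  have o: "j = opp j" "i = opp i" using assms(1) by (auto simp: root_pair_def)
  hence "i = j" using assms(1) by (auto simp: root_pair_def opp_def)
  thus False using assms(1) by (simp add: root_pair_def)
qed

lemma rt_simple: "k \<in> {1..n} \<Longrightarrow> rt (simple_row k) k = simple_root k"
  by (rule rt_eqI[OF has_weight_simple])

lemma rt_swap: "root_pair i j \<Longrightarrow> rt j i = neg_root (rt i j)"
  by (rule rt_eqI[OF has_weight_neg[OF has_weight_rt]])

lemma rt_opp: "root_pair i j \<Longrightarrow> rt (opp j) (opp i) = rt i j"
  by (rule rt_eqI[OF has_weight_opp[OF has_weight_rt]]) (auto simp: root_pair_def)

lemma rt_add: "root_pair i p \<Longrightarrow> root_pair p j \<Longrightarrow> rt i j = (\<lambda>k. rt i p k + rt p j k)"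
  by (rule rt_eqI[OF has_weight_add[OF has_weight_rt has_weight_rt]])

subsection \<open>Root spaces\<close>

lemma root_space_carrier: "x \<in> root_space t n a \<Longrightarrow> (x :: 'k mat) \<in> carrier_mat m m"
  and root_space_lie: "x \<in> root_space t n a \<Longrightarrow> (x :: 'k mat) \<in> classical_lie t n"
  by (auto simp: root_space_def lie_carrier)

lemma root_space_iff:
  fixes x :: "'k mat"
  assumes "supp a \<subseteq> {1..n}"
  shows "x \<in> root_space t n a \<longleftrightarrow> x \<in> classical_lie t n \<and>
     (\<forall>i<m. \<forall>j<m. x $$ (i, j) \<noteq> 0 \<longrightarrow> has_weight a i j)"
proof -
  have "lie_bracket D x = root_fun t n a D \<cdot>\<^sub>m x \<longleftrightarrow>
      (\<forall>i<m. \<forall>j<m. x $$ (i, j) \<noteq> 0 \<longrightarrow> root_fun t n a D = D $$ (i, i) - D $$ (j, j))"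
    if x: "x \<in> carrier_mat m m" and D: "D \<in> cartan_subalg t n" for D :: "'k mat"
  proof -
    have Dc: "D \<in> carrier_mat m m" using D by (simp add: cartan_iff)
    have "lie_bracket D x = root_fun t n a D \<cdot>\<^sub>m x \<longleftrightarrow>
       (\<forall>i<m. \<forall>j<m. lie_bracket D x $$ (i, j) = root_fun t n a D * x $$ (i, j))"
      using bracket_carrier[OF Dc x] x by (auto simp: mat_eq_iff)
    also have "\<dots> \<longleftrightarrow> (\<forall>i<m. \<forall>j<m. x $$ (i, j) \<noteq> 0 \<longrightarrow> root_fun t n a D = D $$ (i, i) - D $$ (j, j))"
      using cartan_bracket[OF D x] by (metis mult_right_cancel mult_zero_right)
    finally show ?thesis .
  qed
  thus ?thesis unfolding root_space_def has_weight_def using assms lie_carrier by blast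
qed

lemma root_space_weight:
  assumes "(x :: 'k mat) \<in> root_space t n a" "supp a \<subseteq> {1..n}" "i < m" "j < m" "x $$ (i, j) \<noteq> 0"
  shows "has_weight a i j"
  using assms root_space_iff by blast

lemma root_space_pair:
  assumes x: "(x :: 'k mat) \<in> root_space t n a" "supp a \<subseteq> {1..n}" "supp a \<noteq> {}" "i < m" "j < m" "x $$ (i, j) \<noteq> 0"
  shows "root_pair i j" "a = rt i j"
proof -
  have w: "has_weight a i j" using root_space_weight x by blast
  have "i \<noteq> j"
  proof
    assume "i = j"
    hence "a = (\<lambda>_. 0)"
      using w by (intro root_fun_inject) (auto simp: has_weight_def root_fun_def supp_def)
    thus False using x(3) by (simp add: supp_def)
  qed
  moreover have "isC \<or> j \<noteq> opp i"
    using lie_antidiag[OF root_space_lie[OF x(1)]] x(4,6) by blast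
  ultimately show "root_pair i j" using x by (simp add: root_pair_def)
  show "a = rt i j" using rt_eqI w by blast
qed

text \<open>The standard root vector: a matrix unit minus its signed mirror image. On the
  antidiagonal the two terms coincide, giving twice the matrix unit in type C and 0
  otherwise.\<close>

definition rvec :: "nat \<Rightarrow> nat \<Rightarrow> 'k mat" where
  "rvec i j = mat m m (\<lambda>(p, q). (if p = i \<and> q = j then 1 else 0) -
     (if p = opp j \<and> q = opp i then sg i * sg j else 0))"

lemma rvec_lie: "i < m \<Longrightarrow> j < m \<Longrightarrow> rvec i j \<in> classical_lie t n"
  unfolding lie_iff
proof (intro conjI allI impI)
  fix p q assume l: "i < m" "j < m" "p < m" "q < m"
  have "sg p * sg q * (sg i * sg j) = 1" if "p = opp j" "q = opp i"
    using l that sg_opp_mult[of j i] by (simp add: sg_def)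
  thus "rvec i j $$ (opp q, opp p) = - (sg p * sg q * rvec i j $$ (p, q))"
    using l by (auto simp: rvec_def opp_swap algebra_simps)
qed (simp add: rvec_def)

lemma rvec_nonzero: "root_pair i j \<Longrightarrow> rvec i j $$ (i, j) \<noteq> 0"
  using sg_opp[of i] by (auto simp: rvec_def root_pair_def opp_swap)

lemma rvec_root_space: "root_pair i j \<Longrightarrow> rvec i j \<in> root_space t n (rt i j)"
  using has_weight_rt[of i j] has_weight_opp[of "rt i j" i j] rvec_lie[of i j]
  by (subst root_space_iff) (auto simp: has_weight_def root_pair_def rvec_def split: if_splits)

lemma roots_iff: "a \<in> roots K t n \<longleftrightarrow> (\<exists>i j. root_pair i j \<and> a = rt i j)"
proof
  assume "a \<in> roots K t n"
  then obtain x :: "'k mat" where x: "supp a \<noteq> {}" "supp a \<subseteq> {1..n}" "x \<in> root_space t n a" "x \<noteq> 0\<^sub>m m m"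
    unfolding roots_def by blast
  have "\<exists>i<m. \<exists>j<m. x $$ (i, j) \<noteq> 0"
    using x(4) root_space_carrier[OF x(3)] by (auto simp: mat_eq_iff)
  then obtain i j where "i < m" "j < m" "x $$ (i, j) \<noteq> 0" by blast
  thus "\<exists>i j. root_pair i j \<and> a = rt i j" using root_space_pair[OF x(3,2,1)] by blast
next
  assume "\<exists>i j. root_pair i j \<and> a = rt i j"
  then obtain i j where ij: "root_pair i j" "a = rt i j" by blast
  have "rvec i j \<noteq> 0\<^sub>m m m"
    using rvec_nonzero[OF ij(1)] ij(1) by (metis index_zero_mat(1) root_pair_def)
  thus "a \<in> roots K t n" unfolding roots_def
    using has_weight_nonzero[OF ij(1) has_weight_rt[OF ij(1)]] has_weight_rt[OF ij(1)] rvec_root_space[OF ij(1)] ij(2)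
    by (auto simp: has_weight_def)
qed

text \<open>Positions above the diagonal have non-negative coefficients. A root with non-negative
  coefficients below the diagonal would also have non-positive ones and be 0.\<close>

lemma pos_roots_iff: "a \<in> pos_roots K t n \<longleftrightarrow> (\<exists>i j. root_pair i j \<and> i < j \<and> a = rt i j)"
proof
  assume "a \<in> pos_roots K t n"
  then obtain i j where ij: "root_pair i j" "a = rt i j" and pos: "\<And>k. 0 \<le> a k"
    unfolding pos_roots_def roots_iff by blast
  have "\<not> j < i"
  proof
    assume "j < i"
    hence "0 \<le> rt j i k" for k using rt_nonneg ij root_pair_sym by blast
    hence "a k = 0" for k using pos[of k] rt_swap[OF ij(1)] ij(2) by (metis antisym neg_0_le_iff_le neg_root_def)
    hence "supp a = {}" by (simp add: supp_def)
    thus False using has_weight_nonzero has_weight_rt ij by blast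
  qed
  thus "\<exists>i j. root_pair i j \<and> i < j \<and> a = rt i j" using ij by (metis linorder_neqE_nat root_pair_def)
next
  assume "\<exists>i j. root_pair i j \<and> i < j \<and> a = rt i j"
  thus "a \<in> pos_roots K t n" unfolding pos_roots_def using roots_iff rt_nonneg by auto
qed

lemma root_space_pair_pos:
  assumes "(x :: 'k mat) \<in> root_space t n a" "a \<in> pos_roots K t n" "i < m" "j < m" "x $$ (i, j) \<noteq> 0"
  shows "root_pair i j" "a = rt i j" "i < j"
proof -
  have s: "supp a \<noteq> {}" "supp a \<subseteq> {1..n}" using assms(2) by (auto simp: pos_roots_def roots_def)
  show ij: "root_pair i j" "a = rt i j" using root_space_pair assms s by blast+
  obtain p q where pq: "root_pair p q" "p < q" "a = rt p q" using assms(2) pos_roots_iff by blast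
  have "i = p \<and> j = q \<or> i = opp q \<and> j = opp p"
    using has_weight_pair_unique[OF pq(1) ij(1), of a] has_weight_rt pq(1,3) ij by metis
  thus "i < j" using pq by (auto simp: root_pair_def opp_less_iff)
qed

lemma finite_roots: "finite (roots K t n)"
proof -
  have "roots K t n \<subseteq> (\<lambda>(i, j). rt i j) ` ({..<m} \<times> {..<m})"
    by (force simp: roots_iff root_pair_def)
  thus ?thesis by (rule finite_subset) simp
qed

lemma finite_pos_roots: "finite (pos_roots K t n)"
  using finite_roots unfolding pos_roots_def by simp

lemma neg_root_in: "a \<in> roots K t n \<Longrightarrow> neg_root a \<in> roots K t n"
  using roots_iff rt_swap root_pair_sym by metis

lemma simple_root_in: "k \<in> {1..n} \<Longrightarrow> simple_root k \<in> pos_roots K t n"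
  unfolding pos_roots_iff using simple_pair rt_simple by metis

text \<open>Subtracting the multiple that clears the entry (i, j) clears its mirror entry too, and
  no other position has this weight.\<close>

lemma root_space_multiple:
  assumes "(x :: 'k mat) \<in> root_space t n (rt i j)" "root_pair i j"
  shows "x = (x $$ (i, j) / rvec i j $$ (i, j)) \<cdot>\<^sub>m rvec i j"
proof -
  define y where "y = x + (- (x $$ (i, j) / rvec i j $$ (i, j))) \<cdot>\<^sub>m rvec i j"
  have xc: "x \<in> carrier_mat m m" using root_space_carrier assms(1) by blast
  have rc: "rvec i j \<in> carrier_mat m m" by (simp add: rvec_def)
  have ij: "i < m" "j < m" using assms by (auto simp: root_pair_def)
  have yl: "y \<in> classical_lie t n"
    unfolding y_def using ij by (intro lie_add lie_smult rvec_lie root_space_lie[OF assms(1)]) auto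
  have yij: "y $$ (i, j) = 0" using rvec_nonzero[OF assms(2)] ij xc rc by (simp add: y_def)
  have s: "supp (rt i j) \<subseteq> {1..n}" "supp (rt i j) \<noteq> {}"
    using has_weight_rt[OF assms(2)] has_weight_nonzero[OF assms(2)] by (auto simp: has_weight_def)
  have "y $$ (p, q) = 0" if pq: "p < m" "q < m" for p q
  proof (rule ccontr)
    assume ne: "y $$ (p, q) \<noteq> 0"
    hence "x $$ (p, q) \<noteq> 0 \<or> rvec i j $$ (p, q) \<noteq> 0" using pq xc rc by (auto simp: y_def)
    hence "root_pair p q" "rt i j = rt p q"
      using root_space_pair[OF _ s _ _] pq assms(1) rvec_root_space[OF assms(2)] by blast+
    hence "p = i \<and> q = j \<or> p = opp j \<and> q = opp i"
      using has_weight_pair_unique[OF assms(2)] has_weight_rt assms(2) by metis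
    thus False using ne yij lie_opp[OF yl ij] by auto
  qed
  hence "x $$ (p, q) = (x $$ (i, j) / rvec i j $$ (i, j)) * rvec i j $$ (p, q)" if "p < m" "q < m" for p q
    using that xc rc by (auto simp: y_def)
  thus ?thesis using xc rc by (intro eq_matI) auto
qed

lemma root_space_bracket:
  assumes "(x :: 'k mat) \<in> root_space t n a" "y \<in> root_space t n b" "supp a \<subseteq> {1..n}" "supp b \<subseteq> {1..n}"
  shows "lie_bracket x y \<in> root_space t n (\<lambda>k. a k + b k)"
proof -
  have s: "supp (\<lambda>k. a k + b k) \<subseteq> {1..n}" using assms(3,4) by (rule supp_add)
  note xc = root_space_carrier[OF assms(1)] and yc = root_space_carrier[OF assms(2)]
  have "has_weight (\<lambda>k. a k + b k) i j" if ij: "i < m" "j < m" "lie_bracket x y $$ (i, j) \<noteq> 0" for i j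
  proof -
    have "\<exists>k<m. x $$ (i, k) * y $$ (k, j) - y $$ (i, k) * x $$ (k, j) \<noteq> 0"
      using ij(3) unfolding bracket_index[OF xc yc ij(1,2)] by (metis (no_types, lifting) lessThan_iff sum.not_neutral_contains_not_neutral)
    then obtain k where k: "k < m" "x $$ (i, k) * y $$ (k, j) - y $$ (i, k) * x $$ (k, j) \<noteq> 0" by blast
    hence "x $$ (i, k) \<noteq> 0 \<and> y $$ (k, j) \<noteq> 0 \<or> y $$ (i, k) \<noteq> 0 \<and> x $$ (k, j) \<noteq> 0" by auto
    thus ?thesis
    proof
      assume "x $$ (i, k) \<noteq> 0 \<and> y $$ (k, j) \<noteq> 0"
      thus ?thesis using has_weight_add root_space_weight assms ij k by blast
    next
      assume "y $$ (i, k) \<noteq> 0 \<and> x $$ (k, j) \<noteq> 0"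
      hence "has_weight (\<lambda>k. b k + a k) i j" using has_weight_add root_space_weight assms ij k by blast
      thus ?thesis by (simp add: add.commute)
    qed
  qed
  thus ?thesis unfolding root_space_iff[OF s] using lie_bracket_closed root_space_lie assms by blast
qed

text \<open>In general the entry (i, j) of the bracket is the product of the two leading entries.
  When i and j are opposite, which happens in type C alone, both halves of the commutator contribute
  and add up to 2.\<close>

lemma rvec_bracket_nonzero:
  assumes "root_pair i p" "root_pair p j" "root_pair i j" "i < p" "p < j"
  shows "lie_bracket (rvec i p) (rvec p j) $$ (i, j) \<noteq> 0"
proof -
  have lt: "i < m" "p < m" "j < m" using assms by (auto simp: root_pair_def)
  have A: "rvec i p $$ (i, k) = 0" if "k < m" "k \<noteq> p" for k
    using that lt by (auto simp: rvec_def opp_swap)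
  have Bv: "rvec p j $$ (i, k) = (if i = opp j \<and> k = opp p then - (sg p * sg j) else 0)" if "k < m" for k
    using that lt assms by (auto simp: rvec_def)
  have "lie_bracket (rvec i p) (rvec p j) $$ (i, j) =
      (\<Sum>k<m. rvec i p $$ (i, k) * rvec p j $$ (k, j) - rvec p j $$ (i, k) * rvec i p $$ (k, j))"
    using lt by (intro bracket_index) (auto simp: rvec_def)
  also have "\<dots> = (\<Sum>k<m. if k = p then rvec i p $$ (i, p) * rvec p j $$ (p, j) else 0) -
      (\<Sum>k<m. if k = opp p then (if i = opp j then - (sg p * sg j) * rvec i p $$ (opp p, j) else 0) else 0)"
    unfolding sum_subtractf[symmetric] by (intro sum.cong refl) (use lt in \<open>auto simp: A Bv\<close>)
  also have "\<dots> = rvec i p $$ (i, p) * rvec p j $$ (p, j) -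
       (if i = opp j then - (sg p * sg j) * rvec i p $$ (opp p, j) else 0)"
    using lt by simp
  also have "\<dots> \<noteq> 0"
  proof (cases "i = opp j")
    case True
    hence jo: "j = opp i" using lt by simp
    hence C: isC using assms by (auto simp: root_pair_def)
    have v: "rvec i p $$ (i, p) = 1" "rvec p j $$ (p, j) = 1" "rvec i p $$ (opp p, j) = - (sg i * sg p)"
      using lt assms jo by (auto simp: rvec_def)
    have "sg j = - sg i" using C jo lt by (simp add: sg_opp)
    hence "- (sg p * sg j) * rvec i p $$ (opp p, j) = - 1"
      unfolding v by (auto simp: sg_def)
    thus ?thesis unfolding if_P[OF True] by (simp add: v)
  next
    case False
    thus ?thesis using rvec_nonzero assms by simp
  qed
  finally show ?thesis .
qed

end

section \<open>Traces and the Killing form\<close>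

lemma mat_sum_index [simp]: "i < m \<Longrightarrow> j < m \<Longrightarrow> mat_sum m f I $$ (i, j) = (\<Sum>k\<in>I. f k $$ (i, j))"
  and mat_sum_carrier [simp]: "mat_sum m f I \<in> carrier_mat m m"
  and mat_sum_dim [simp]: "dim_row (mat_sum m f I) = m" "dim_col (mat_sum m f I) = m"
  by (simp_all add: mat_sum_def)

lemma smult_sum_index:
  assumes "\<And>i. i < length bs \<Longrightarrow> bs ! i \<in> carrier_mat m m" "a < m" "b < m"
  shows "mat_sum m (\<lambda>i. g i \<cdot>\<^sub>m bs ! i) {..<length bs} $$ (a, b) = (\<Sum>i<length bs. g i * bs ! i $$ (a, b))"
proof -
  have "(g i \<cdot>\<^sub>m bs ! i) $$ (a, b) = g i * bs ! i $$ (a, b)" if "i < length bs" for i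
    using assms(1)[OF that] assms(2,3) by auto
  thus ?thesis using assms(2,3) by simp
qed

abbreviation lincomb :: "nat \<Rightarrow> 'k::field mat list \<Rightarrow> 'k vec \<Rightarrow> 'k mat" where
  "lincomb m bs c \<equiv> mat_sum m (\<lambda>i. c $ i \<cdot>\<^sub>m bs ! i) {..<length bs}"

lemma mat_coords_unique:
  assumes "mat_basis m V bs" "x \<in> V" "c \<in> carrier_vec (length bs)" "x = lincomb m bs c"
  shows "mat_coords m bs x = c"
proof -
  have "\<exists>!c. c \<in> carrier_vec (length bs) \<and> x = lincomb m bs c"
    using assms(1,2) unfolding mat_basis_def by blast
  thus ?thesis unfolding mat_coords_def using assms(3,4) by (intro the1_equality) auto
qed

lemma mat_coords:
  assumes "mat_basis m V bs" "x \<in> V"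
  shows "mat_coords m bs x \<in> carrier_vec (length bs)" "x = lincomb m bs (mat_coords m bs x)"
proof -
  obtain c where "c \<in> carrier_vec (length bs)" "x = lincomb m bs c"
    using assms unfolding mat_basis_def by blast
  thus "mat_coords m bs x \<in> carrier_vec (length bs)" "x = lincomb m bs (mat_coords m bs x)"
    using mat_coords_unique[OF assms] by auto
qed

lemma mat_basis_carrier:
  assumes "mat_basis m V bs" "i < length bs"
  shows "bs ! i \<in> V" "bs ! i \<in> carrier_mat m m"
proof -
  show V: "bs ! i \<in> V" using assms unfolding mat_basis_def by auto
  show "bs ! i \<in> carrier_mat m m" by (subst mat_coords(2)[OF assms(1) V]) simp
qed

text \<open>\<open>trace_on\<close> picks an unspecified basis; exhibiting \<open>cs\<close>
  guarantees that the choice really is a basis.\<close>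

lemma trace_on_zero:
  fixes f :: "'k::field mat \<Rightarrow> 'k mat"
  assumes cs: "mat_basis m V cs" and V: "0\<^sub>m m m \<in> V" and f: "\<And>x. x \<in> V \<Longrightarrow> f x = 0\<^sub>m m m"
  shows "trace_on m V f = 0"
proof -
  define bs where "bs = (SOME bs. mat_basis m V bs)"
  have bs: "mat_basis m V bs" unfolding bs_def using cs by (rule someI)
  have "mat_coords m bs (0\<^sub>m m m) = 0\<^sub>v (length bs)"
  proof (rule mat_coords_unique[OF bs V])
    show "0\<^sub>m m m = lincomb m bs (0\<^sub>v (length bs))"
    proof (rule eq_matI)
      fix a b assume "a < dim_row (lincomb m bs (0\<^sub>v (length bs)))" "b < dim_col (lincomb m bs (0\<^sub>v (length bs)))"
      hence ab: "a < m" "b < m" by auto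
      have "lincomb m bs (0\<^sub>v (length bs)) $$ (a, b) = (\<Sum>i<length bs. 0\<^sub>v (length bs) $ i * bs ! i $$ (a, b))"
        by (rule smult_sum_index[OF mat_basis_carrier(2)[OF bs] ab])
      also have "\<dots> = 0" by simp
      finally show "0\<^sub>m m m $$ (a, b) = lincomb m bs (0\<^sub>v (length bs)) $$ (a, b)" using ab by (simp del: mat_sum_index)
    qed auto
  qed simp
  hence "mat_coords m bs (f (bs ! i)) $ i = 0" if "i < length bs" for i
    using f[OF mat_basis_carrier(1)[OF bs that]] that by simp
  thus ?thesis unfolding trace_on_def bs_def[symmetric] Let_def by simp
qed

context classical_type begin

text \<open>The free entries of an element of the Lie algebra: one position of each mirror pair,
  together with the antidiagonal in type C.\<close>

definition half_pairs :: "(nat \<times> nat) set" where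
  "half_pairs = {(i, j). i < m \<and> j < m \<and> (i + j + 1 < m \<or> isC \<and> i + j + 1 = m)}"

lemma finite_half_pairs: "finite half_pairs"
  by (rule finite_subset[of _ "{..<m} \<times> {..<m}"]) (auto simp: half_pairs_def)

definition pair_list :: "(nat \<times> nat) list" where
  "pair_list = (SOME l. distinct l \<and> set l = half_pairs)"

lemma pair_list: "distinct pair_list" "set pair_list = half_pairs"
proof -
  have "\<exists>l. distinct l \<and> set l = half_pairs"
    using finite_distinct_list[OF finite_half_pairs] by metis
  hence *: "distinct pair_list \<and> set pair_list = half_pairs"
    unfolding pair_list_def by (rule someI_ex)
  show "distinct pair_list" using * ..
  show "set pair_list = half_pairs" using * ..
qed

definition lie_basis :: "'k mat list" where "lie_basis = map (\<lambda>(i, j). rvec i j) pair_list"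

lemma rvec_index:
  "p < m \<Longrightarrow> q < m \<Longrightarrow> rvec i j $$ (p, q) = (if p = i \<and> q = j then 1 else 0) - (if p = opp j \<and> q = opp i then sg i * sg j else 0)"
  by (simp add: rvec_def)

lemma sg_antidiag: "j < m \<Longrightarrow> isC \<Longrightarrow> sg (opp j) * sg j = - 1"
  by (simp add: sg_opp)

text \<open>Up to the factors 1 and 2, the vectors \<open>rvec\<close> at the free positions are
  dual to the free entries, so coordinates in the basis can be read off.\<close>

lemma rvec_half_pairs:
  assumes "(i, j) \<in> half_pairs" "(p, q) \<in> half_pairs"
  shows "rvec i j $$ (p, q) = (if (p, q) = (i, j) then rvec i j $$ (i, j) else 0)" "rvec i j $$ (i, j) \<noteq> 0"
proof -
  have lt: "i < m" "j < m" "p < m" "q < m" and s: "i + j + 1 \<le> m" "p + q + 1 \<le> m" "isC \<or> i + j + 1 < m"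
    using assms by (auto simp: half_pairs_def)
  have o: "isC \<and> p = i \<and> q = j \<and> j = opp i" if "p = opp j" "q = opp i"
    using that lt s unfolding opp_def by linarith
  have o': "isC" if "i = opp j"
    using that lt s unfolding opp_def by linarith
  show "rvec i j $$ (p, q) = (if (p, q) = (i, j) then rvec i j $$ (i, j) else 0)"
  proof (cases "(p, q) = (i, j)")
    case False
    hence F: "\<not> (p = opp j \<and> q = opp i)" "\<not> (p = i \<and> q = j)" using o by blast+
    show ?thesis
      unfolding rvec_index[OF lt(3,4)] if_not_P[OF False] if_not_P[OF F(1)] if_not_P[OF F(2)] by (rule diff_zero)
  next
    case True
    show ?thesis unfolding True by (rule if_P[OF refl, symmetric])
  qed
  show "rvec i j $$ (i, j) \<noteq> 0"
  proof (cases "i = opp j")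
    case True
    have "sg i * sg j = - 1" using sg_antidiag[OF lt(2) o'[OF True]] True by metis
    moreover have c: "i = opp j \<and> j = opp i" using True lt opp_opp by metis
    have "rvec i j $$ (i, j) = 1 - sg i * sg j"
      unfolding rvec_index[OF lt(1,2)] if_P[OF c] by (simp only: simp_thms if_True)
    ultimately have "rvec i j $$ (i, j) = 1 - (- 1)" by (simp only:)
    thus ?thesis by simp
  next
    case False
    hence c: "\<not> (i = opp j \<and> j = opp i)" by blast
    have "rvec i j $$ (i, j) = 1"
      unfolding rvec_index[OF lt(1,2)] if_not_P[OF c] by (simp only: simp_thms if_True diff_zero)
    thus ?thesis by simp
  qed
qed

lemma lie_basis_index:
  assumes "p < length pair_list" "q < length pair_list"
  shows "lie_basis ! p $$ (pair_list ! q) = (if p = q then rvec (fst (pair_list ! p)) (snd (pair_list ! p)) $$ (pair_list ! p) else 0)"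
    "rvec (fst (pair_list ! p)) (snd (pair_list ! p)) $$ (pair_list ! p) \<noteq> 0"
proof -
  obtain i j where ij: "pair_list ! p = (i, j)" by fastforce
  obtain a b where ab: "pair_list ! q = (a, b)" by fastforce
  have h: "(i, j) \<in> half_pairs" "(a, b) \<in> half_pairs" using assms ij ab pair_list(2) nth_mem by metis+
  have "(a, b) = (i, j) \<longleftrightarrow> p = q" using pair_list(1) assms ij ab by (metis nth_eq_iff_index_eq)
  thus "lie_basis ! p $$ (pair_list ! q) = (if p = q then rvec (fst (pair_list ! p)) (snd (pair_list ! p)) $$ (pair_list ! p) else 0)"
    using rvec_half_pairs(1)[OF h] assms(1) unfolding lie_basis_def by (simp add: ij ab split: if_splits)
  show "rvec (fst (pair_list ! p)) (snd (pair_list ! p)) $$ (pair_list ! p) \<noteq> 0"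
    using rvec_half_pairs(2)[OF h] ij by simp
qed

lemma lie_basis_in: "p < length lie_basis \<Longrightarrow> lie_basis ! p \<in> classical_lie t n"
proof -
  assume p: "p < length lie_basis"
  obtain i j where ij: "pair_list ! p = (i, j)" by fastforce
  have "(i, j) \<in> half_pairs" using p ij pair_list(2) nth_mem unfolding lie_basis_def by (metis length_map)
  hence "rvec i j \<in> classical_lie t n" using rvec_lie by (auto simp: half_pairs_def)
  thus ?thesis using p ij by (simp add: lie_basis_def)
qed

lemma length_lie_basis [simp]: "length lie_basis = length pair_list" by (simp add: lie_basis_def)

lemma lie_sum_closed:
  assumes "\<And>k. k \<in> I \<Longrightarrow> (f k :: 'k mat) \<in> classical_lie t n"
  shows "mat_sum m f I \<in> classical_lie t n"
  unfolding lie_iff using assms by (auto simp: lie_opp sum_negf sum_distrib_left)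

lemma lie_eqI:
  fixes x y :: "'k mat"
  assumes x: "x \<in> classical_lie t n" and y: "y \<in> classical_lie t n"
    and eq: "\<And>p. p \<in> half_pairs \<Longrightarrow> x $$ p = y $$ p"
  shows "x = y"
proof (rule eq_matI)
  fix i j assume "i < dim_row y" "j < dim_col y"
  hence ij: "i < m" "j < m" using lie_carrier[OF y] by auto
  consider "(i, j) \<in> half_pairs" | "(opp j, opp i) \<in> half_pairs" | "\<not> isC" "j = opp i"
    using ij unfolding half_pairs_def opp_def by fastforce
  thus "x $$ (i, j) = y $$ (i, j)"
  proof cases
    case 2
    have "- (sg i * sg j * x $$ (i, j)) = - (sg i * sg j * y $$ (i, j))"
      using eq[OF 2] lie_opp[OF x ij] lie_opp[OF y ij] by simp
    thus ?thesis by simp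
  next
    case 3
    thus ?thesis using lie_antidiag x y ij by metis
  qed (rule eq)
qed (use lie_carrier[OF x] lie_carrier[OF y] in auto)

lemma lie_basis: "mat_basis m (classical_lie t n) lie_basis"
  unfolding mat_basis_def
proof (intro conjI ballI)
  show "set lie_basis \<subseteq> classical_lie t n" using lie_basis_in by (metis in_set_conv_nth subsetI)
  fix x :: "'k mat" assume x: "x \<in> classical_lie t n"
  define \<gamma> where "\<gamma> p = rvec (fst (pair_list ! p)) (snd (pair_list ! p)) $$ (pair_list ! p)" for p
  have g: "\<gamma> p \<noteq> 0" if "p < length pair_list" for p using lie_basis_index(2)[OF that that] by (simp add: \<gamma>_def)
  have ent: "lincomb m lie_basis c $$ (pair_list ! q) = c $ q * \<gamma> q" if q: "q < length pair_list" for c q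
  proof -
    obtain a b where ab: "pair_list ! q = (a, b)" by fastforce
    have "(a, b) \<in> half_pairs" using q ab pair_list(2) nth_mem by metis
    hence lt: "a < m" "b < m" by (auto simp: half_pairs_def)
    have "lincomb m lie_basis c $$ (a, b) = (\<Sum>p<length pair_list. c $ p * lie_basis ! p $$ (a, b))"
      by (subst smult_sum_index[OF lie_carrier[OF lie_basis_in] lt]) simp_all
    also have "\<dots> = (\<Sum>p<length pair_list. if p = q then c $ q * \<gamma> q else 0)"
      using lie_basis_index(1)[OF _ q] by (intro sum.cong refl) (auto simp: ab \<gamma>_def)
    finally show ?thesis using q ab by simp
  qed
  show "\<exists>!c. c \<in> carrier_vec (length lie_basis) \<and> x = lincomb m lie_basis c"
  proof (rule ex1I[of _ "vec (length pair_list) (\<lambda>p. x $$ (pair_list ! p) / \<gamma> p)"])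
    let ?c = "vec (length pair_list) (\<lambda>p. x $$ (pair_list ! p) / \<gamma> p)"
    have "x = lincomb m lie_basis ?c"
    proof (rule lie_eqI[OF x])
      show "lincomb m lie_basis ?c \<in> classical_lie t n"
        by (intro lie_sum_closed lie_smult lie_basis_in) simp
      fix p assume "p \<in> half_pairs"
      then obtain q where "q < length pair_list" "p = pair_list ! q"
        using pair_list(2) by (metis in_set_conv_nth)
      thus "x $$ p = lincomb m lie_basis ?c $$ p" using ent[of q ?c] g by simp
    qed
    thus "?c \<in> carrier_vec (length lie_basis) \<and> x = lincomb m lie_basis ?c" by simp
  next
    fix c assume c: "c \<in> carrier_vec (length lie_basis) \<and> x = lincomb m lie_basis c"
    show "c = vec (length pair_list) (\<lambda>p. x $$ (pair_list ! p) / \<gamma> p)"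
    proof (rule eq_vecI)
      fix q assume "q < dim_vec (vec (length pair_list) (\<lambda>p. x $$ (pair_list ! p) / \<gamma> p))"
      hence q: "q < length pair_list" by simp
      have "x $$ (pair_list ! q) = c $ q * \<gamma> q" using ent[OF q, of c] c by simp
      thus "c $ q = vec (length pair_list) (\<lambda>p. x $$ (pair_list ! p) / \<gamma> p) $ q" using g[OF q] q by simp
    qed (use c in simp)
  qed
qed

text \<open>Together with the normalization K(e_a, e_-a) = 1 this shows that the given root vectors
  do not vanish.\<close>

lemma killing_zero:
  assumes "y \<in> carrier_mat m m"
  shows "killing_form t n (0\<^sub>m m m) y = (0 :: 'k)"
  unfolding killing_form_def
proof (rule trace_on_zero[OF lie_basis lie_zero])
  fix z :: "'k mat" assume "z \<in> classical_lie t n"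
  hence "z \<in> carrier_mat m m" by (rule lie_carrier)
  thus "lie_bracket (0\<^sub>m m m) (lie_bracket y z) = 0\<^sub>m m m" using assms by (auto simp: lie_bracket_def)
qed

end

section \<open>Matrix inverses and the classical groups\<close>

lemma mat_mult_index:
  assumes "A \<in> carrier_mat m m" "B \<in> carrier_mat m m" "i < m" "j < m"
  shows "(A * B) $$ (i, j) = (\<Sum>k<m. A $$ (i, k) * (B $$ (k, j) :: 'k::field))"
  using assms by (simp add: scalar_prod_def atLeast0LessThan)

lemma mat_inv:
  assumes "Q \<in> carrier_mat m m" "det Q \<noteq> (0 :: 'k::field)"
  shows "mat_inv Q \<in> carrier_mat m m" "Q * mat_inv Q = 1\<^sub>m m" "mat_inv Q * Q = 1\<^sub>m m"
proof -
  have "Q \<in> Units (ring_mat TYPE('k) m ())" by (rule det_non_zero_imp_unit[OF assms])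
  then obtain Y where "mat_inverse Q = Some Y" using mat_inverse(1)[OF assms(1)] by fastforce
  with mat_inverse(2)[OF assms(1) this]
  show "mat_inv Q \<in> carrier_mat m m" "Q * mat_inv Q = 1\<^sub>m m" "mat_inv Q * Q = 1\<^sub>m m"
    by (simp_all add: mat_inv_def)
qed

lemma mat_inv_unique:
  assumes "Q \<in> carrier_mat m m" "Y \<in> carrier_mat m m" "Q * Y = 1\<^sub>m m"
  shows "mat_inv Q = (Y :: 'k::field mat)"
proof -
  have "det Q * det Y = 1" using det_mult[OF assms(1,2)] assms(3) by simp
  hence "det Q \<noteq> 0" by auto
  note i = mat_inv[OF assms(1) this]
  have "mat_inv Q = mat_inv Q * (Q * Y)" using assms(3) i(1) by simp
  also have "\<dots> = mat_inv Q * Q * Y" by (rule assoc_mult_mat[OF i(1) assms(1,2), symmetric])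
  also have "\<dots> = Y" using i(3) assms(2) by simp
  finally show ?thesis .
qed

lemma form_mat_carrier': "form_mat t n \<in> carrier_mat (std_dim t n) (std_dim t n)"
  by (simp add: form_mat_def)

lemma group_carrier: "Q \<in> classical_group t n \<Longrightarrow> Q \<in> carrier_mat (std_dim t n) (std_dim t n)"
  and group_det: "Q \<in> classical_group t n \<Longrightarrow> det Q = 1"
  and group_form: "Q \<in> classical_group t n \<Longrightarrow> Q * form_mat t n * transpose_mat Q = form_mat t n"
  by (auto simp: classical_group_def)

lemma group_inv:
  assumes "Q \<in> classical_group t n"
  shows "mat_inv Q \<in> carrier_mat (std_dim t n) (std_dim t n)"
    "Q * mat_inv Q = 1\<^sub>m (std_dim t n)" "mat_inv Q * Q = 1\<^sub>m (std_dim t n)"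
  using mat_inv[OF group_carrier[OF assms]] group_det[OF assms] by simp_all

lemma group_mult:
  assumes "Q \<in> classical_group t n" "(Y :: 'k::field mat) \<in> classical_group t n"
  shows "Q * Y \<in> classical_group t n"
proof -
  let ?m = "std_dim t n" and ?B = "form_mat t n :: 'k mat"
  note Q = group_carrier[OF assms(1)] and Y = group_carrier[OF assms(2)] 
  have B: "?B \<in> carrier_mat ?m ?m" by (rule form_mat_carrier')
  have XT: "transpose_mat Q \<in> carrier_mat ?m ?m" and YT: "transpose_mat Y \<in> carrier_mat ?m ?m" using Q Y by auto
  have YB: "Y * ?B \<in> carrier_mat ?m ?m" by (rule mult_carrier_mat[OF Y B])
  have "Q * Y * ?B * transpose_mat (Q * Y) = Q * (Y * ?B) * (transpose_mat Y * transpose_mat Q)"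
    using assoc_mult_mat[OF Q Y B] transpose_mult[OF Q Y] by simp
  also have "\<dots> = Q * (Y * ?B * (transpose_mat Y * transpose_mat Q))"
    by (rule assoc_mult_mat[OF Q YB mult_carrier_mat[OF YT XT]])
  also have "Y * ?B * (transpose_mat Y * transpose_mat Q) = Y * ?B * transpose_mat Y * transpose_mat Q"
    by (rule assoc_mult_mat[OF YB YT XT, symmetric])
  also have "\<dots> = ?B * transpose_mat Q" using group_form[OF assms(2)] by simp
  also have "Q * (?B * transpose_mat Q) = Q * ?B * transpose_mat Q"
    by (rule assoc_mult_mat[OF Q B XT, symmetric])
  also have "\<dots> = ?B" by (rule group_form[OF assms(1)])
  finally have "Q * Y * ?B * transpose_mat (Q * Y) = ?B" .
  moreover have "det (Q * Y) = 1" using det_mult[OF Q Y] group_det[OF assms(1)] group_det[OF assms(2)] by simp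
  ultimately show ?thesis using Q Y by (simp add: classical_group_def)
qed

lemma group_mat_inv:
  assumes "(Q :: 'k::field mat) \<in> classical_group t n"
  shows "mat_inv Q \<in> classical_group t n"
proof -
  let ?m = "std_dim t n" and ?B = "form_mat t n :: 'k mat" and ?Y = "mat_inv Q"
  note Q = group_carrier[OF assms] and Y = group_inv[OF assms]
  have B: "?B \<in> carrier_mat ?m ?m" by (rule form_mat_carrier')
  have XT: "transpose_mat Q \<in> carrier_mat ?m ?m" and YT: "transpose_mat ?Y \<in> carrier_mat ?m ?m" using Q Y by auto
  have T: "transpose_mat Q * transpose_mat ?Y = 1\<^sub>m ?m"
    using transpose_mult[OF Y(1) Q] Y(3) by simp
  have "?Y * ?B * transpose_mat ?Y = ?Y * (Q * ?B * transpose_mat Q) * transpose_mat ?Y"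
    by (simp only: group_form[OF assms])
  also have "?Y * (Q * ?B * transpose_mat Q) = ?Y * (Q * (?B * transpose_mat Q))"
    by (simp only: assoc_mult_mat[OF Q B XT])
  also have "\<dots> = ?Y * Q * (?B * transpose_mat Q)"
    by (rule assoc_mult_mat[OF Y(1) Q mult_carrier_mat[OF B XT], symmetric])
  also have "\<dots> = ?B * transpose_mat Q" unfolding Y(3) by (rule left_mult_one_mat[OF mult_carrier_mat[OF B XT]])
  also have "?B * transpose_mat Q * transpose_mat ?Y = ?B * (transpose_mat Q * transpose_mat ?Y)"
    by (rule assoc_mult_mat[OF B XT YT])
  also have "\<dots> = ?B" unfolding T by (rule right_mult_one_mat[OF B])
  finally have "?Y * ?B * transpose_mat ?Y = ?B" .
  moreover have "det ?Y = 1"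
    using det_mult[OF Q Y(1)] Y(2) group_det[OF assms] by simp
  ultimately show ?thesis using Y(1) by (simp add: classical_group_def)
qed

section \<open>Tensor coefficients\<close>

lemma pair_index:
  assumes "i < m" "k < (m :: nat)"
  shows "i * m + k < m * m" "(i * m + k) div m = i" "(i * m + k) mod m = k"
proof -
  have "i * m + k < Suc i * m" using assms by simp
  also have "\<dots> \<le> m * m" using assms by (intro mult_le_mono1) simp
  finally show "i * m + k < m * m" .
qed (use assms in auto)

lemma tensor_coeff_kron:
  assumes "A \<in> carrier_mat m m" "B \<in> carrier_mat m m" "i < m" "j < m" "k < m" "l < m"
  shows "tensor_coeff m (kron A B) i j k l = A $$ (i, j) * B $$ (k, l)"
  using assms pair_index[of i m k] pair_index[of j m l] by (auto simp: tensor_coeff_def kron_def)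

lemma kron_carrier: "A \<in> carrier_mat m m \<Longrightarrow> B \<in> carrier_mat m m \<Longrightarrow> kron A B \<in> carrier_mat (m * m) (m * m)"
  by (auto simp: kron_def)

lemma tensor_coeff_sum:
  assumes "i < m" "j < m" "k < m" "l < m"
  shows "tensor_coeff m (mat_sum (m * m) f I) i j k l = (\<Sum>x\<in>I. tensor_coeff m (f x) i j k l)"
  using pair_index(1)[of i m k] pair_index(1)[of j m l] assms by (simp add: tensor_coeff_def)

lemma tensor_coeff_add:
  assumes "T \<in> carrier_mat (m * m) (m * m)" "T' \<in> carrier_mat (m * m) (m * m)" "i < m" "j < m" "k < m" "l < m"
  shows "tensor_coeff m (T + T') i j k l = tensor_coeff m T i j k l + tensor_coeff m T' i j k l"
    "tensor_coeff m (T - T') i j k l = tensor_coeff m T i j k l - tensor_coeff m T' i j k l"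
  using pair_index(1)[of i m k] pair_index(1)[of j m l] assms by (auto simp: tensor_coeff_def)

lemma tensor_eqI:
  assumes "T \<in> carrier_mat (m * m) (m * m)" "T' \<in> carrier_mat (m * m) (m * m)"
    "\<And>i j k l. i < m \<Longrightarrow> j < m \<Longrightarrow> k < m \<Longrightarrow> l < m \<Longrightarrow> tensor_coeff m T i j k l = tensor_coeff m T' i j k l"
  shows "T = T'"
proof (rule eq_matI)
  fix a b assume "a < dim_row T'" "b < dim_col T'"
  hence ab: "a < m * m" "b < m * m" using assms(2) by auto
  hence "0 < m" by (cases m) auto
  hence l: "a div m < m" "b div m < m" "a mod m < m" "b mod m < m" using ab by (auto simp: less_mult_imp_div_less)
  from assms(3)[OF l(1,2,3,4)] show "T $$ (a, b) = T' $$ (a, b)" by (simp add: tensor_coeff_def)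
qed (use assms in auto)

lemma mult_unit_index:
  assumes "Q \<in> carrier_mat m m" "Y \<in> carrier_mat m m" "a < m" "b < m" "i < m" "j < m"
  shows "(Q * mat_unit m a b * Y) $$ (i, j) = Q $$ (i, a) * (Y $$ (b, j) :: 'k::field)"
proof -
  have U: "(mat_unit m a b :: 'k mat) \<in> carrier_mat m m" by (simp add: mat_unit_def)
  have QU: "(Q * mat_unit m a b) $$ (i, k) = (if k = b then Q $$ (i, a) else 0)" if k: "k < m" for k
  proof -
    have "(Q * mat_unit m a b) $$ (i, k) = (\<Sum>p<m. Q $$ (i, p) * mat_unit m a b $$ (p, k))"
      by (rule mat_mult_index[OF assms(1) U assms(5) k])
    also have "\<dots> = (\<Sum>p<m. if p = a then (if k = b then Q $$ (i, a) else 0) else 0)"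
      using k by (intro sum.cong refl) (auto simp: mat_unit_def)
    finally show ?thesis using assms by simp
  qed
  have "(Q * mat_unit m a b * Y) $$ (i, j) = (\<Sum>k<m. (Q * mat_unit m a b) $$ (i, k) * Y $$ (k, j))"
    by (rule mat_mult_index[OF mult_carrier_mat[OF assms(1) U] assms(2) assms(5,6)])
  also have "\<dots> = (\<Sum>k<m. if k = b then Q $$ (i, a) * Y $$ (b, j) else 0)"
    by (intro sum.cong refl) (simp add: QU)
  finally show ?thesis using assms by simp
qed

abbreviation quads :: "nat \<Rightarrow> (nat \<times> nat \<times> nat \<times> nat) set" where
  "quads m \<equiv> {..<m} \<times> {..<m} \<times> {..<m} \<times> {..<m}"

lemma tensor_coeff_Ad:
  fixes Q :: "'k::field mat"
  assumes Q: "Q \<in> carrier_mat m m" "mat_inv Q \<in> carrier_mat m m" and l: "i < m" "j < m" "k < m" "l < m"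
  shows "tensor_coeff m (tensor_map m (Ad Q) (Ad Q) T) i j k l =
    (\<Sum>(a, b, c, d)\<in>quads m. tensor_coeff m T a b c d *
       (Q $$ (i, a) * mat_inv Q $$ (b, j) * (Q $$ (k, c) * mat_inv Q $$ (d, l))))"
  unfolding tensor_map_def tensor_coeff_sum[OF l]
proof (intro sum.cong refl, clarsimp)
  fix a b c d assume q: "a < m" "b < m" "c < m" "d < m"
  have U: "(mat_unit m p q :: 'k mat) \<in> carrier_mat m m" for p q by (simp add: mat_unit_def)
  have A: "Ad Q (mat_unit m p q) \<in> carrier_mat m m" for p q
    unfolding Ad_def by (rule mult_carrier_mat[OF mult_carrier_mat[OF Q(1) U] Q(2)])
  have "tensor_coeff m (tensor_coeff m T a b c d \<cdot>\<^sub>m kron (Ad Q (mat_unit m a b)) (Ad Q (mat_unit m c d))) i j k l =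
     tensor_coeff m T a b c d * tensor_coeff m (kron (Ad Q (mat_unit m a b)) (Ad Q (mat_unit m c d))) i j k l"
    using pair_index(1)[OF l(1,3)] pair_index(1)[OF l(2,4)] kron_carrier[OF A A, of a b c d]
    by (simp add: tensor_coeff_def)
  also have "\<dots> = tensor_coeff m T a b c d * (Ad Q (mat_unit m a b) $$ (i, j) * Ad Q (mat_unit m c d) $$ (k, l))"
    by (simp only: tensor_coeff_kron[OF A A l])
  also have "\<dots> = tensor_coeff m T a b c d * (Q $$ (i, a) * mat_inv Q $$ (b, j) * (Q $$ (k, c) * mat_inv Q $$ (d, l)))"
    unfolding Ad_def using mult_unit_index[OF Q] q l by simp
  finally show "tensor_coeff m (tensor_coeff m T a b c d \<cdot>\<^sub>m kron (Ad Q (mat_unit m a b)) (Ad Q (mat_unit m c d))) i j k l = \<dots>" .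
qed

text \<open>The operator \<open>x \<mapsto> (tr(x \<cdot> -) \<otimes> id) r\<close> for a tensor with coefficients \<open>\<rho>\<close>.\<close>

definition tensor_op :: "nat \<Rightarrow> (nat \<Rightarrow> nat \<Rightarrow> nat \<Rightarrow> nat \<Rightarrow> 'k) \<Rightarrow> 'k::field mat \<Rightarrow> 'k mat" where
  "tensor_op m \<rho> x = mat m m (\<lambda>(k, l). \<Sum>(i, j)\<in>{..<m} \<times> {..<m}. \<rho> i j k l * x $$ (j, i))"

text \<open>Invariance under conjugation by \<open>Q\<close> with inverse \<open>Y\<close>, stated
  for a coefficient function so that exchanging the two tensor factors becomes a permutation of
  arguments.\<close>

definition invariant_coeffs :: "nat \<Rightarrow> (nat \<Rightarrow> nat \<Rightarrow> nat \<Rightarrow> nat \<Rightarrow> 'k) \<Rightarrow> 'k::field mat \<Rightarrow> 'k mat \<Rightarrow> bool" where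
  "invariant_coeffs m \<rho> Q Y \<longleftrightarrow> (\<forall>i<m. \<forall>j<m. \<forall>k<m. \<forall>l<m. \<rho> i j k l =
     (\<Sum>(a, b, c, d)\<in>quads m. \<rho> a b c d * (Q $$ (i, a) * Y $$ (b, j) * (Q $$ (k, c) * Y $$ (d, l)))))"

lemma tensor_op_carrier [simp]: "tensor_op m \<rho> x \<in> carrier_mat m m"
  and tensor_op_dim [simp]: "dim_row (tensor_op m \<rho> x) = m" "dim_col (tensor_op m \<rho> x) = m"
  by (simp_all add: tensor_op_def)

lemma tensor_op_index:
  "k < m \<Longrightarrow> l < m \<Longrightarrow> tensor_op m \<rho> x $$ (k, l) = (\<Sum>(i, j)\<in>{..<m} \<times> {..<m}. \<rho> i j k l * x $$ (j, i))"
  by (simp add: tensor_op_def)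

lemma mult3_index:
  assumes "Q \<in> carrier_mat m m" "z \<in> carrier_mat m m" "Y \<in> carrier_mat m m" "i < m" "j < m"
  shows "(Q * z * Y) $$ (i, j) = (\<Sum>(a, b)\<in>{..<m} \<times> {..<m}. Q $$ (i, a) * z $$ (a, b) * (Y $$ (b, j) :: 'k::field))"
proof -
  have "(Q * z * Y) $$ (i, j) = (\<Sum>b<m. (\<Sum>a<m. Q $$ (i, a) * z $$ (a, b)) * Y $$ (b, j))"
    using mat_mult_index[OF mult_carrier_mat[OF assms(1,2)] assms(3-5)] mat_mult_index[OF assms(1,2,4)] by simp
  also have "\<dots> = (\<Sum>b<m. \<Sum>a<m. Q $$ (i, a) * z $$ (a, b) * Y $$ (b, j))"
    by (simp add: sum_distrib_right)
  also have "\<dots> = (\<Sum>a<m. \<Sum>b<m. Q $$ (i, a) * z $$ (a, b) * Y $$ (b, j))" by (rule sum.swap)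
  finally show ?thesis by (simp add: sum.cartesian_product)
qed

text \<open>Once invariance is inserted into the coefficient sum, the conjugating factors of the
  first leg move through the trace onto the argument and turn it back into \<open>z\<close>; those
  of the second leg remain outside as the conjugation of the value.\<close>

lemma tensor_op_conj:
  assumes invt: "invariant_coeffs m \<rho> Q Y" and Q: "Q \<in> carrier_mat m m" and Y: "Y \<in> carrier_mat m m"
    and YX: "Y * Q = 1\<^sub>m m" and z: "z \<in> carrier_mat m m"
  shows "tensor_op m \<rho> (Q * z * Y) = Q * tensor_op m \<rho> z * (Y :: 'k::field mat)"
proof (rule eq_matI)
  fix k l assume "k < dim_row (Q * tensor_op m \<rho> z * Y)" "l < dim_col (Q * tensor_op m \<rho> z * Y)"
  hence kl: "k < m" "l < m" using Q Y by auto
  let ?P = "{..<m} \<times> {..<m}"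
  define w where "w = Q * z * Y"
  have w: "w \<in> carrier_mat m m" unfolding w_def using Q Y z by simp
  have recover: "Y * w * Q = z"
  proof -
    have Yz: "Q * z \<in> carrier_mat m m" using Q z by simp
    have "Y * w = Y * (Q * z) * Y" unfolding w_def by (rule assoc_mult_mat[OF Y Yz Y, symmetric])
    also have "Y * (Q * z) = Y * Q * z" by (rule assoc_mult_mat[OF Y Q z, symmetric])
    also have "\<dots> = z" using YX z by simp
    finally have "Y * w * Q = z * Y * Q" by simp
    also have "\<dots> = z * (Y * Q)" by (rule assoc_mult_mat[OF z Y Q])
    finally show ?thesis using YX z by simp
  qed
  have "tensor_op m \<rho> w $$ (k, l) = (\<Sum>(i, j)\<in>?P. \<rho> i j k l * w $$ (j, i))"
    using kl by (simp add: tensor_op_def)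
  also have "\<dots> = (\<Sum>(i, j)\<in>?P. \<Sum>(a, b, c, d)\<in>quads m.
      \<rho> a b c d * (Q $$ (k, c) * Y $$ (d, l)) * (Y $$ (b, j) * w $$ (j, i) * Q $$ (i, a)))"
  proof (intro sum.cong refl, clarify)
    fix i j assume "i < m" "j < m"
    hence "\<rho> i j k l = (\<Sum>(a, b, c, d)\<in>quads m. \<rho> a b c d * (Q $$ (i, a) * Y $$ (b, j) * (Q $$ (k, c) * Y $$ (d, l))))"
      using invt kl unfolding invariant_coeffs_def by blast
    thus "\<rho> i j k l * w $$ (j, i) = (\<Sum>(a, b, c, d)\<in>quads m.
        \<rho> a b c d * (Q $$ (k, c) * Y $$ (d, l)) * (Y $$ (b, j) * w $$ (j, i) * Q $$ (i, a)))"
      by (simp only: sum_distrib_right) (intro sum.cong refl, simp add: case_prod_beta mult_ac)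
  qed
  also have "\<dots> = (\<Sum>(a, b, c, d)\<in>quads m. \<Sum>(i, j)\<in>?P.
      \<rho> a b c d * (Q $$ (k, c) * Y $$ (d, l)) * (Y $$ (b, j) * w $$ (j, i) * Q $$ (i, a)))"
    by (simp only: case_prod_unfold) (rule sum.swap)
  also have "\<dots> = (\<Sum>(a, b, c, d)\<in>quads m. \<rho> a b c d * (Q $$ (k, c) * Y $$ (d, l)) * z $$ (b, a))"
  proof (intro sum.cong refl, clarify)
    fix a b c d assume q: "a < m" "b < m"
    have "(\<Sum>(i, j)\<in>?P. Y $$ (b, j) * w $$ (j, i) * Q $$ (i, a)) = (\<Sum>(j, i)\<in>?P. Y $$ (b, j) * w $$ (j, i) * Q $$ (i, a))"
      by (rule sum.reindex_bij_witness[of _ prod.swap prod.swap]) auto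
    also have "\<dots> = z $$ (b, a)" using mult3_index[OF Y w Q q(2,1)] recover by simp
    finally show "(\<Sum>(i, j)\<in>?P. \<rho> a b c d * (Q $$ (k, c) * Y $$ (d, l)) * (Y $$ (b, j) * w $$ (j, i) * Q $$ (i, a)))
        = \<rho> a b c d * (Q $$ (k, c) * Y $$ (d, l)) * z $$ (b, a)"
      by (simp only: case_prod_unfold sum_distrib_left[symmetric])
  qed
  also have "\<dots> = (\<Sum>((a, b), (c, d))\<in>?P \<times> ?P. \<rho> a b c d * (Q $$ (k, c) * Y $$ (d, l)) * z $$ (b, a))"
    by (rule sum.reindex_bij_witness[of _ "\<lambda>((a, b), (c, d)). (a, b, c, d)" "\<lambda>(a, b, c, d). ((a, b), (c, d))"]) auto
  also have "\<dots> = (\<Sum>(a, b)\<in>?P. \<Sum>(c, d)\<in>?P. \<rho> a b c d * (Q $$ (k, c) * Y $$ (d, l)) * z $$ (b, a))"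
    by (simp only: sum.cartesian_product case_prod_unfold)
  also have "\<dots> = (\<Sum>(c, d)\<in>?P. \<Sum>(a, b)\<in>?P. \<rho> a b c d * (Q $$ (k, c) * Y $$ (d, l)) * z $$ (b, a))"
    by (simp only: case_prod_unfold) (rule sum.swap)
  also have "\<dots> = (\<Sum>(c, d)\<in>?P. Q $$ (k, c) * tensor_op m \<rho> z $$ (c, d) * Y $$ (d, l))"
    by (intro sum.cong refl) (auto simp: tensor_op_def sum_distrib_left sum_distrib_right case_prod_beta mult_ac intro!: sum.cong)
  also have "\<dots> = (Q * tensor_op m \<rho> z * Y) $$ (k, l)"
    by (rule mult3_index[OF Q _ Y kl, symmetric]) simp
  finally show "tensor_op m \<rho> (Q * z * Y) $$ (k, l) = (Q * tensor_op m \<rho> z * Y) $$ (k, l)" unfolding w_def .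
qed (use Q Y in auto)

text \<open>This makes the operator that contracts the other tensor factor available as
  well.\<close>

lemma invariant_coeffs_flip:
  assumes "invariant_coeffs m \<rho> Q Y"
  shows "invariant_coeffs m (\<lambda>i j k l. \<rho> k l i j) Q Y"
  unfolding invariant_coeffs_def
proof (intro allI impI)
  fix i j k l assume "i < m" "j < m" "k < m" "l < m"
  hence "\<rho> k l i j = (\<Sum>(a, b, c, d)\<in>quads m. \<rho> a b c d * (Q $$ (k, a) * Y $$ (b, l) * (Q $$ (i, c) * Y $$ (d, j))))"
    using assms unfolding invariant_coeffs_def by blast
  also have "\<dots> = (\<Sum>(a, b, c, d)\<in>quads m. \<rho> c d a b * (Q $$ (i, a) * Y $$ (b, j) * (Q $$ (k, c) * Y $$ (d, l))))"
    by (rule sum.reindex_bij_witness[of _ "\<lambda>(a, b, c, d). (c, d, a, b)" "\<lambda>(a, b, c, d). (c, d, a, b)"]) (auto simp: mult_ac)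
  finally show "\<rho> k l i j = (\<Sum>(a, b, c, d)\<in>quads m. \<rho> c d a b * (Q $$ (i, a) * Y $$ (b, j) * (Q $$ (k, c) * Y $$ (d, l))))" .
qed

text \<open>\<open>abv\<close> stands for either side of the diagonal, so that upper and lower
  triangular matrices share one argument.\<close>

lemma det_triangular:
  assumes A: "A \<in> carrier_mat m m" and abv: "abv = (<) \<or> abv = (\<lambda>i j :: nat. j < i)"
    and tri: "\<And>i j. i < m \<Longrightarrow> j < m \<Longrightarrow> abv i j \<Longrightarrow> A $$ (i, j) = 0"
  shows "det A = (\<Prod>i<m. A $$ (i, i) :: 'k::field)"
  using abv
proof
  assume u: "abv = (<)"
  have "det A = prod_list (diag_mat A)" by (rule det_lower_triangular[OF _ A]) (use tri u in auto)
  thus ?thesis using A by (simp add: prod_list_diag_prod atLeast0LessThan)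
next
  assume u: "abv = (\<lambda>i j. j < i)"
  have "det A = prod_list (diag_mat A)"
    by (rule det_upper_triangular[OF _ A]) (use tri u A in \<open>auto intro!: upper_triangularI\<close>)
  thus ?thesis using A by (simp add: prod_list_diag_prod atLeast0LessThan)
qed

text \<open>The operator of \<open>r\<close> raises weights and has an invertible leading term on the part of \<open>V\<close> spanned
  by one half of the roots. Its generalised kernel therefore is triangular and contains every strictly
  triangular element of the other half; these are the nilpotent elements of the generalised kernel, so a
  conjugation that fixes \<open>r\<close> preserves them.\<close>

lemma invariant_tensor_preserves_triangular:
  fixes \<rho> :: "nat \<Rightarrow> nat \<Rightarrow> nat \<Rightarrow> nat \<Rightarrow> 'k::field" and wt :: "nat \<Rightarrow> nat \<Rightarrow> int"
  assumes abv: "abv = (<) \<or> abv = (\<lambda>i j :: nat. j < i)"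
    and V: "\<And>x. x \<in> V \<Longrightarrow> x \<in> carrier_mat m m" "\<And>x. x \<in> V \<Longrightarrow> tensor_op m \<rho> x \<in> V"
    and supp: "\<And>i j k l. i < m \<Longrightarrow> j < m \<Longrightarrow> k < m \<Longrightarrow> l < m \<Longrightarrow> \<rho> i j k l \<noteq> 0 \<Longrightarrow>
       i = j \<or> abv j i \<or> abv i j \<and> abv l k \<and> wt j i < wt k l"
    and lead: "\<And>x k l. x \<in> V \<Longrightarrow> k < m \<Longrightarrow> l < m \<Longrightarrow> abv k l \<Longrightarrow>
       (\<And>i j. i < m \<Longrightarrow> j < m \<Longrightarrow> abv j i \<Longrightarrow> wt j i < wt k l \<Longrightarrow> x $$ (j, i) = 0) \<Longrightarrow>
       tensor_op m \<rho> x $$ (k, l) = 0 \<Longrightarrow> x $$ (k, l) = 0"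
    and invt: "invariant_coeffs m \<rho> Q Y"
    and Q: "Q \<in> carrier_mat m m" "Y \<in> carrier_mat m m" "Q * Y = 1\<^sub>m m" "Y * Q = 1\<^sub>m m"
    and z: "z \<in> V" "Q * z * Y \<in> V" "\<And>i j. i < m \<Longrightarrow> j < m \<Longrightarrow> z $$ (i, j) \<noteq> 0 \<Longrightarrow> abv j i"
    and ij: "i < m" "j < m" "(Q * z * Y) $$ (i, j) \<noteq> 0"
  shows "abv j i"
proof -
  let ?R = "tensor_op m \<rho>" and ?Z = "0\<^sub>m m m :: 'k mat"
  have asym: "\<not> (abv a b \<and> abv b a)" "\<not> abv a a" "a = b \<or> abv a b \<or> abv b a" for a b
    using abv by auto
  \<comment> \<open>Among the nonzero entries on the side \<open>abv\<close> one of least weight is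
    chosen: there nothing of lower weight interferes, and the leading term of the operator becomes
    visible.\<close>
  have inj: "x $$ (k, l) = 0" if x: "x \<in> V" and R0: "\<And>k l. k < m \<Longrightarrow> l < m \<Longrightarrow> abv k l \<Longrightarrow> ?R x $$ (k, l) = 0"
    and kl: "k < m" "l < m" "abv k l" for x k l
  proof (rule ccontr)
    assume ne: "x $$ (k, l) \<noteq> 0"
    define S where "S = {(k, l). k < m \<and> l < m \<and> abv k l \<and> x $$ (k, l) \<noteq> 0}"
    have "finite S" by (rule finite_subset[of _ "{..<m} \<times> {..<m}"]) (auto simp: S_def)
    moreover have "S \<noteq> {}" using ne kl by (auto simp: S_def)
    ultimately obtain s where s: "is_arg_min (\<lambda>s. wt (fst s) (snd s)) (\<lambda>s. s \<in> S) s"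
      using ex_is_arg_min_if_finite by metis
    obtain p q where pq: "s = (p, q)" by fastforce
    have S: "p < m" "q < m" "abv p q" "x $$ (p, q) \<noteq> 0" using s unfolding is_arg_min_def pq S_def by auto
    have "x $$ (b, a) = 0" if "a < m" "b < m" "abv b a" "wt b a < wt p q" for a b
    proof (rule ccontr)
      assume "x $$ (b, a) \<noteq> 0"
      hence "(b, a) \<in> S" using that by (simp add: S_def)
      thus False using s that(4) unfolding is_arg_min_def pq by force
    qed
    from lead[OF x S(1-3) this R0[OF S(1-3)]] show False using S(4) by blast
  qed
  have RV: "(?R ^^ N) x \<in> V" if "x \<in> V" for N x using that V(2) by (induction N) auto
  have inj_pow: "x $$ (k, l) = 0" if "x \<in> V" "(?R ^^ N) x = ?Z" "k < m" "l < m" "abv k l" for N x k l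
    using that
  proof (induction N arbitrary: x k l)
    case (Suc N)
    have "(?R ^^ N) (?R x) = ?Z" using Suc.prems(2) by (simp only: funpow_Suc_right o_apply)
    from Suc.IH[OF V(2)[OF Suc.prems(1)] this] show ?case by (intro inj[OF Suc.prems(1)] Suc.prems)
  qed simp
  obtain W where W: "\<And>a b. a < m \<Longrightarrow> b < m \<Longrightarrow> \<bar>wt a b\<bar> \<le> W"
  proof -
    have "\<bar>wt a b\<bar> \<le> (\<Sum>(a, b)\<in>{..<m} \<times> {..<m}. \<bar>wt a b\<bar>)" if "a < m" "b < m" for a b
    proof -
      have "(case (a, b) of (a, b) \<Rightarrow> \<bar>wt a b\<bar>) \<le> (\<Sum>p\<in>{..<m} \<times> {..<m}. case p of (a, b) \<Rightarrow> \<bar>wt a b\<bar>)"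
        using that by (intro member_le_sum) auto
      thus ?thesis by simp
    qed
    from that[OF this] show ?thesis .
  qed
  \<comment> \<open>On an element supported strictly on the opposite side, every application of the
    operator stays on that side and raises the weight by at least 1.\<close>
  have low: "abv b a \<and> int N - W \<le> wt a b" if "a < m" "b < m" "(?R ^^ N) z $$ (a, b) \<noteq> 0" for a b N
    using that
  proof (induction N arbitrary: a b)
    case 0
    thus ?case using z(3) W[of a b] by force
  next
    case (Suc N)
    have "(\<Sum>(i, j)\<in>{..<m} \<times> {..<m}. \<rho> i j a b * (?R ^^ N) z $$ (j, i)) \<noteq> 0"
      using Suc.prems(3) unfolding funpow.simps o_apply tensor_op_index[OF Suc.prems(1,2)] .
    then obtain s where s: "s \<in> {..<m} \<times> {..<m}" "(case s of (i, j) \<Rightarrow> \<rho> i j a b * (?R ^^ N) z $$ (j, i)) \<noteq> 0"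
      by (rule sum.not_neutral_contains_not_neutral)
    obtain i j where ij: "s = (i, j)" by fastforce
    have h: "i < m" "j < m" "\<rho> i j a b \<noteq> 0" "(?R ^^ N) z $$ (j, i) \<noteq> 0" using s unfolding ij by auto
    have u: "abv i j" "int N - W \<le> wt j i" using Suc.IH[OF h(2,1,4)] by auto
    have "i = j \<or> abv j i \<or> abv i j \<and> abv b a \<and> wt j i < wt a b" by (rule supp[OF h(1,2) Suc.prems(1,2) h(3)])
    hence "abv b a \<and> wt j i < wt a b" using u(1) asym(1)[of i j] asym(2)[of i] by blast
    thus ?case using u(2) by auto
  qed
  \<comment> \<open>All weights lie between -W and W, so a rise by 2 W + 1 leaves no possible
    position.\<close>
  define N where "N = nat (2 * W + 1)"
  have W0: "0 \<le> W" using W[of i j] ij by force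
  have "(?R ^^ N) z = ?Z"
  proof (rule eq_matI)
    fix a b assume "a < dim_row ?Z" "b < dim_col ?Z"
    hence ab: "a < m" "b < m" by auto
    have "(?R ^^ N) z $$ (a, b) = 0"
    proof (rule ccontr)
      assume "(?R ^^ N) z $$ (a, b) \<noteq> 0"
      hence "int N - W \<le> wt a b" using low[OF ab] by blast
      thus False using W[OF ab] W0 unfolding N_def by simp
    qed
    thus "(?R ^^ N) z $$ (a, b) = ?Z $$ (a, b)" using ab by simp
  qed (use V(1)[OF RV[OF z(1), of N]] in auto)
  moreover have conj: "(?R ^^ N) (Q * z * Y) = Q * (?R ^^ N) z * Y" for N
  proof (induction N)
    case (Suc N)
    thus ?case using tensor_op_conj[OF invt Q(1,2,4) V(1)[OF RV[OF z(1)]]] by simp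
  qed simp
  ultimately have "(?R ^^ N) (Q * z * Y) = Q * ?Z * Y" by simp
  also have "\<dots> = ?Z" using Q by simp
  finally have tri: "(Q * z * Y) $$ (k, l) = 0" if "k < m" "l < m" "abv k l" for k l
    using inj_pow[OF z(2)] that by blast
  \<comment> \<open>The conjugate is already triangular. A nonzero diagonal entry c would be an
    eigenvalue of it, whereas z - c has determinant (-c)^m because z is strictly triangular.\<close>
  have "(Q * z * Y) $$ (k, k) = 0" if k: "k < m" for k
  proof (rule ccontr)
    define c where "c = (Q * z * Y) $$ (k, k)"
    assume "(Q * z * Y) $$ (k, k) \<noteq> 0"
    hence c: "c \<noteq> 0" by (simp add: c_def)
    let ?C = "c \<cdot>\<^sub>m 1\<^sub>m m :: 'k mat"
    note zc = V(1)[OF z(1)]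
    have Cc: "?C \<in> carrier_mat m m" by simp
    have zC: "z - ?C \<in> carrier_mat m m" by (rule minus_carrier_mat[OF Cc])
    have WC: "Q * z * Y - ?C \<in> carrier_mat m m" by (rule minus_carrier_mat[OF Cc])
    have "det (z - ?C) = (\<Prod>i<m. (z - ?C) $$ (i, i))"
    proof (rule det_triangular[OF zC abv])
      fix i j assume h: "i < m" "j < m" "abv i j"
      hence "z $$ (i, j) = 0" using z(3)[of i j] asym(1)[of i j] by blast
      moreover have "i \<noteq> j" using h asym(2) by metis
      ultimately show "(z - ?C) $$ (i, j) = 0" using h zc by simp
    qed
    also have "\<dots> = (\<Prod>i<m. - c)"
    proof (rule prod.cong[OF refl])
      fix i assume i: "i \<in> {..<m}"
      hence "z $$ (i, i) = 0" using z(3)[of i i] asym(2)[of i] by blast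
      thus "(z - ?C) $$ (i, i) = - c" using i zc by simp
    qed
    finally have d1: "det (z - ?C) \<noteq> 0" using c by simp
    have eq: "Q * (z - ?C) * Y = Q * z * Y - ?C"
    proof -
      have "Q * (z - ?C) = Q * z - Q * ?C" by (rule mult_minus_distrib_mat[OF Q(1) zc Cc])
      also have "Q * ?C = c \<cdot>\<^sub>m Q" using Q(1) mult_smult_distrib[OF Q(1), of "1\<^sub>m m" m c] by simp
      finally have "Q * (z - ?C) * Y = (Q * z - c \<cdot>\<^sub>m Q) * Y" by simp
      also have "\<dots> = Q * z * Y - c \<cdot>\<^sub>m Q * Y" using Q zc by (intro minus_mult_distrib_mat) auto
      also have "c \<cdot>\<^sub>m Q * Y = c \<cdot>\<^sub>m (Q * Y)" by (rule mult_smult_assoc_mat[OF Q(1,2)])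
      finally show ?thesis using Q(3) by simp
    qed
    have W: "Q * z * Y \<in> carrier_mat m m" using Q zc by simp
    have "det (Q * z * Y - ?C) = (\<Prod>i<m. (Q * z * Y - ?C) $$ (i, i))"
    proof (rule det_triangular[OF WC abv])
      fix i j assume h: "i < m" "j < m" "abv i j"
      moreover have "i \<noteq> j" using h asym(2) by metis
      ultimately show "(Q * z * Y - ?C) $$ (i, j) = 0" using tri[OF h] W by simp
    qed
    also have "\<dots> = 0"
    proof (rule prod_zero[OF _ bexI[of _ k]])
      show "(Q * z * Y - ?C) $$ (k, k) = 0" using W k unfolding c_def by simp
    qed (use k in auto)
    finally have "det (Q * (z - ?C) * Y) = 0" unfolding eq .
    moreover have "det (Q * (z - ?C) * Y) = det Q * det (z - ?C) * det Y"
      using det_mult[OF mult_carrier_mat[OF Q(1) zC] Q(2)] det_mult[OF Q(1) zC] by metis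
    moreover have "det Q * det Y = 1" using det_mult[OF Q(1,2)] Q(3) by simp
    hence "det Q \<noteq> 0" "det Y \<noteq> 0" by auto
    ultimately show False using d1 by simp
  qed
  thus "abv j i" using asym(3)[of i j] tri[of i j] ij by metis
qed

section \<open>Conjugations that preserve both triangular parts\<close>

context classical_type begin

text \<open>The part of \<open>Q\<close> below the diagonal is cleared column by column from the
  right. Comparing the entries (p, j) in the conjugation of a root vector at (q, j) turns a nonzero
  entry (p, q) into a nonzero entry (k, j) with k > p in a later column, which the induction
  hypothesis restricts. In type D the gap at (n - 1, n), which is not a root position, leaves one
  entry uncontrolled.\<close>

lemma conj_upper_triangular:
  assumes Q: "Q \<in> carrier_mat m m"
    and conj: "\<And>y. y \<in> classical_lie t n \<Longrightarrow> \<forall>i<m. \<forall>j<m. y $$ (i, j) \<noteq> 0 \<longrightarrow> i < j \<Longrightarrow>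
      \<exists>y' \<in> classical_lie t n. (\<forall>i<m. \<forall>j<m. y' $$ (i, j) \<noteq> 0 \<longrightarrow> i < j) \<and> Q * y = y' * (Q :: 'k mat)"
    and pq: "p < m" "q < m" "q < p" "Q $$ (p, q) \<noteq> 0"
  shows "isD \<and> p = n \<and> q = n - 1"
  using pq
proof (induction "m - q" arbitrary: p q rule: less_induct)
  case less
  \<comment> \<open>The nearest index to the right of q for which (q, j) is a root position; it
    skips the antidiagonal position (n - 1, n) of type D.\<close>
  define j where "j = (if isD \<and> q = n - 1 then n + 1 else q + 1)"
  have j: "j < m" "q < j"
    using less.prems m_D rank_D' by (auto simp: j_def)
  have "j \<noteq> opp q \<or> isC"
  proof (cases isB)
    case True
    have "\<not> isD" using True type_cases by metis
    hence "j = q + 1" by (simp add: j_def)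
    moreover have "opp q = 2 * n - q" using m_B[OF True] by (simp add: opp_def)
    moreover have "q + 1 \<noteq> 2 * n - q"
    proof
      assume "q + 1 = 2 * n - q"
      hence "2 * q + 1 = 2 * n" by linarith
      thus False by (metis even_Suc even_mult_iff even_numeral Suc_eq_plus1)
    qed
    ultimately show ?thesis by metis
  next
    case nB: False
    show ?thesis
    proof (cases isC)
      case False
      hence D: isD using nB type_exhaust by blast
      hence o: "opp q = 2 * n - 1 - q" using m_D by (simp add: opp_def)
      show ?thesis
      proof (cases "q = n - 1")
        case True
        hence "opp q = n" "j = n + 1" using o D rank_D' by (simp_all add: j_def)
        thus ?thesis by simp
      next
        case False
        have "q + 1 \<noteq> 2 * n - 1 - q"
        proof
          assume "q + 1 = 2 * n - 1 - q"
          hence "q = n - 1" by linarith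
          thus False using False by simp
        qed
        moreover have "j = q + 1" using False by (simp add: j_def)
        ultimately show ?thesis using o by metis
      qed
    qed simp
  qed
  hence rp: "root_pair q j" using j less.prems by (auto simp: root_pair_def)
  have up: "\<forall>a<m. \<forall>b<m. rvec q j $$ (a, b) \<noteq> 0 \<longrightarrow> a < b"
  proof (intro allI impI)
    fix a b assume ab: "a < m" "b < m" "rvec q j $$ (a, b) \<noteq> 0"
    have "a = q \<and> b = j \<or> a = opp j \<and> b = opp q"
    proof (rule ccontr)
      assume "\<not> (a = q \<and> b = j \<or> a = opp j \<and> b = opp q)"
      hence c: "\<not> (a = q \<and> b = j)" "\<not> (a = opp j \<and> b = opp q)" unfolding de_Morgan_disj by (rule conjunct1, rule conjunct2)
      have "rvec q j $$ (a, b) = 0"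
        unfolding rvec_index[OF ab(1,2)] if_not_P[OF c(1)] if_not_P[OF c(2)] by (rule diff_zero)
      thus False using ab(3) by contradiction
    qed
    thus "a < b"
    proof
      assume "a = q \<and> b = j"
      thus "a < b" using j(2) by simp
    next
      assume ab': "a = opp j \<and> b = opp q"
      have "opp j < opp q" using opp_less_iff[OF j(1) less.prems(2)] j(2) by simp
      thus "a < b" using ab' by simp
    qed
  qed
  from conj[OF rvec_lie[OF less.prems(2) j(1)] up]
  obtain y' where y'l: "y' \<in> classical_lie t n" and y'u: "\<forall>i<m. \<forall>j<m. y' $$ (i, j) \<noteq> 0 \<longrightarrow> i < j"
    and y'e: "Q * rvec q j = y' * Q" by (elim bexE conjE)
  note y' = y'l y'u[rule_format] y'e
  have rc: "rvec q j \<in> carrier_mat m m" by (rule lie_carrier[OF rvec_lie[OF less.prems(2) j(1)]])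
  have col: "rvec q j $$ (k, j) = 0" if "k < m" "k \<noteq> q" for k
  proof -
    have c1: "\<not> (k = q \<and> j = j)" using that by simp
    have c2: "\<not> (k = opp j \<and> j = opp q)" using that(2) opp_opp[OF less.prems(2)] by metis
    show ?thesis unfolding rvec_index[OF that(1) j(1)] if_not_P[OF c1] if_not_P[OF c2] by (rule diff_zero)
  qed
  have "(Q * rvec q j) $$ (p, j) = (\<Sum>k<m. Q $$ (p, k) * rvec q j $$ (k, j))"
    by (rule mat_mult_index[OF Q rc less.prems(1) j(1)])
  also have "\<dots> = (\<Sum>k<m. if k = q then Q $$ (p, q) * rvec q j $$ (q, j) else 0)"
    by (intro sum.cong refl) (simp add: col)
  also have "\<dots> = Q $$ (p, q) * rvec q j $$ (q, j)" using less.prems by simp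
  finally have "(y' * Q) $$ (p, j) \<noteq> 0" using less.prems rvec_nonzero[OF rp] y'(3) by simp
  hence "(\<Sum>k<m. y' $$ (p, k) * Q $$ (k, j)) \<noteq> 0"
    using mat_mult_index[OF lie_carrier[OF y'(1)] Q less.prems(1) j(1)] by simp
  then obtain k where "k \<in> {..<m}" "y' $$ (p, k) * Q $$ (k, j) \<noteq> 0"
    by (rule sum.not_neutral_contains_not_neutral)
  hence k: "k < m" "y' $$ (p, k) \<noteq> 0" "Q $$ (k, j) \<noteq> 0" by auto
  have pk: "p < k" using y'(2) k less.prems by blast
  have anti: "\<not> (p = n - 1 \<and> k = n)" if isD
  proof -
    have "opp (n - 1) = n" using that m_D rank_D' by (simp add: opp_def)
    moreover have "\<not> isC" using that type_cases by metis
    ultimately show ?thesis using lie_antidiag[OF y'(1) _ less.prems(1)] k(2) by metis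
  qed
  have IH: "isD \<and> k = n \<and> j = n - 1" if "j < k"
    using less.hyps[of j k] that k j less.prems by simp
  show ?case
  proof (cases "isD \<and> q = n - 1")
    case True
    hence "j = n + 1" by (simp add: j_def)
    hence "k \<le> n + 1" using IH by force
    thus ?thesis using True pk less.prems by simp
  next
    case False
    hence j1: "j = q + 1" by (auto simp: j_def)
    show ?thesis
    proof (cases "j < k")
      case True
      hence "isD" "k = n" "j = n - 1" using IH by auto
      thus ?thesis using anti pk less.prems j1 by simp
    next
      case False
      thus ?thesis using pk less.prems j1 by simp
    qed
  qed
qed

text \<open>Conjugation by the antidiagonal permutation matrix. It preserves the Lie algebra and
  exchanges upper and lower triangular matrices, which reduces the lower case to the upper
  one.\<close>

definition rev_mat :: "'k mat \<Rightarrow> 'k mat" where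
  "rev_mat x = mat m m (\<lambda>(i, j). x $$ (opp i, opp j))"

lemma rev_mat_index [simp]: "i < m \<Longrightarrow> j < m \<Longrightarrow> rev_mat x $$ (i, j) = x $$ (opp i, opp j)"
  and rev_mat_carrier [simp]: "rev_mat x \<in> carrier_mat m m"
  by (simp_all add: rev_mat_def)

lemma rev_mat_mult:
  assumes "x \<in> carrier_mat m m" "y \<in> carrier_mat m m"
  shows "rev_mat (x * y) = rev_mat x * rev_mat y"
proof (rule eq_matI)
  fix i j assume "i < dim_row (rev_mat x * rev_mat y)" "j < dim_col (rev_mat x * rev_mat y)"
  hence ij: "i < m" "j < m" by (auto simp: rev_mat_def)
  have "rev_mat (x * y) $$ (i, j) = (\<Sum>k<m. x $$ (opp i, k) * y $$ (k, opp j))"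
    using ij by (simp add: mat_mult_index[OF assms])
  also have "\<dots> = (\<Sum>k<m. x $$ (opp i, opp k) * y $$ (opp k, opp j))"
    by (rule sum.reindex_bij_betw[OF opp_bij, symmetric])
  also have "\<dots> = (rev_mat x * rev_mat y) $$ (i, j)"
    unfolding mat_mult_index[OF rev_mat_carrier rev_mat_carrier ij] using ij by (intro sum.cong refl) simp
  finally show "rev_mat (x * y) $$ (i, j) = (rev_mat x * rev_mat y) $$ (i, j)" .
qed (auto simp: rev_mat_def)

lemma rev_mat_lie:
  assumes "x \<in> classical_lie t n"
  shows "rev_mat x \<in> classical_lie t n"
  unfolding lie_iff
proof (intro conjI allI impI)
  fix i j assume ij: "i < m" "j < m"
  have "x $$ (opp (opp j), opp (opp i)) = - (sg (opp i) * sg (opp j) * x $$ (opp i, opp j))"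
    using ij by (intro lie_opp[OF assms]) simp_all
  thus "rev_mat x $$ (opp j, opp i) = - (sg i * sg j * rev_mat x $$ (i, j))"
    using ij by (simp only: rev_mat_index opp_less sg_opp_mult)
qed simp

lemma rev_mat_rev: "x \<in> carrier_mat m m \<Longrightarrow> rev_mat (rev_mat x) = x"
  by (rule eq_matI) (auto simp: rev_mat_def)

lemma conj_lower_triangular:
  assumes Q: "Q \<in> carrier_mat m m"
    and conj: "\<And>y. y \<in> classical_lie t n \<Longrightarrow> \<forall>i<m. \<forall>j<m. y $$ (i, j) \<noteq> 0 \<longrightarrow> j < i \<Longrightarrow>
      \<exists>y' \<in> classical_lie t n. (\<forall>i<m. \<forall>j<m. y' $$ (i, j) \<noteq> 0 \<longrightarrow> j < i) \<and> Q * y = y' * (Q :: 'k mat)"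
    and pq: "p < m" "q < m" "p < q" "Q $$ (p, q) \<noteq> 0"
  shows "isD \<and> p = n - 1 \<and> q = n"
proof -
  have "isD \<and> opp p = n \<and> opp q = n - 1"
  proof (rule conj_upper_triangular[of "rev_mat Q"])
    fix y :: "'k mat" assume y: "y \<in> classical_lie t n" and u: "\<forall>i<m. \<forall>j<m. y $$ (i, j) \<noteq> 0 \<longrightarrow> i < j"
    have "\<forall>i<m. \<forall>j<m. rev_mat y $$ (i, j) \<noteq> 0 \<longrightarrow> j < i"
    proof (intro allI impI)
      fix i j assume "i < m" "j < m" "rev_mat y $$ (i, j) \<noteq> 0"
      thus "j < i" using u[rule_format, of "opp i" "opp j"] opp_less_iff[of i j] by simp
    qed
    from conj[OF rev_mat_lie[OF y] this] obtain y' where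
      y'l: "y' \<in> classical_lie t n" and y'u: "\<forall>i<m. \<forall>j<m. y' $$ (i, j) \<noteq> 0 \<longrightarrow> j < i" and y'e: "Q * rev_mat y = y' * Q"
      by (elim bexE conjE)
    note y' = y'l y'u[rule_format] y'e
    have "rev_mat Q * y = rev_mat (Q * rev_mat y)"
      using rev_mat_mult[OF Q rev_mat_carrier] rev_mat_rev[OF lie_carrier[OF y]] by simp
    also have "\<dots> = rev_mat y' * rev_mat Q" unfolding y'(3) by (rule rev_mat_mult[OF lie_carrier[OF y'(1)] Q])
    finally have "rev_mat Q * y = rev_mat y' * rev_mat Q" .
    moreover have "i < j" if "i < m" "j < m" "rev_mat y' $$ (i, j) \<noteq> 0" for i j
      using y'(2)[of "opp i" "opp j"] that opp_less_iff[of j i] by simp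
    ultimately show "\<exists>y' \<in> classical_lie t n. (\<forall>i<m. \<forall>j<m. y' $$ (i, j) \<noteq> 0 \<longrightarrow> i < j) \<and> rev_mat Q * y = y' * rev_mat Q"
      using rev_mat_lie[OF y'(1)] by blast
  qed (use pq opp_less_iff in auto)
  moreover have "opp n = n - 1" "opp (n - 1) = n" if isD using that m_D rank_D' by (auto simp: opp_def)
  ultimately show ?thesis using pq opp_opp by metis
qed

lemma group_iff:
  fixes Q :: "'k mat"
  assumes "Q \<in> carrier_mat m m"
  shows "Q * form_mat t n * transpose_mat Q = form_mat t n \<longleftrightarrow>
    (\<forall>i<m. \<forall>j<m. (\<Sum>k<m. sg k * Q $$ (i, k) * Q $$ (j, opp k)) = (if j = opp i then sg i else 0))"
proof -
  have QT: "transpose_mat Q \<in> carrier_mat m m" using assms by simp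
  have "(Q * form_mat t n * transpose_mat Q) $$ (i, j) = (\<Sum>k<m. sg k * Q $$ (i, k) * Q $$ (j, opp k))"
    if ij: "i < m" "j < m" for i j
  proof -
    have "(Q * form_mat t n * transpose_mat Q) $$ (i, j) = (\<Sum>k<m. (Q * form_mat t n) $$ (i, k) * transpose_mat Q $$ (k, j))"
      by (rule mat_mult_index[OF mult_carrier_mat[OF assms form_mat_carrier] QT ij])
    also have "\<dots> = (\<Sum>k<m. sg (opp k) * Q $$ (i, opp k) * Q $$ (j, opp (opp k)))"
    proof (intro sum.cong refl)
      fix k assume "k \<in> {..<m}"
      hence k: "k < m" by simp
      show "(Q * form_mat t n) $$ (i, k) * transpose_mat Q $$ (k, j) = sg (opp k) * Q $$ (i, opp k) * Q $$ (j, opp (opp k))"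
        unfolding mult_form_mat[OF assms ij(1) k] using assms ij k by simp
    qed
    also have "\<dots> = (\<Sum>k<m. sg k * Q $$ (i, k) * Q $$ (j, opp k))"
      by (rule sum.reindex_bij_betw[OF opp_bij])
    finally show ?thesis .
  qed
  thus ?thesis using assms by (auto simp: mat_eq_iff form_mat_index)
qed

text \<open>Opposite factors cancel in pairs; the middle index of type B is the one left
  over.\<close>

lemma prod_opp:
  assumes "\<And>i. i < m \<Longrightarrow> opp i \<noteq> i \<Longrightarrow> x i * x (opp i) = (1 :: 'k)"
  shows "(\<Prod>i<m. x i) = (if isB then x n else 1)"
proof -
  let ?U = "if isB then {n + 1..<m} else {n..<m}"
  have 1: "(\<Prod>i\<in>?U. x i) = (\<Prod>i<n. x (opp i))"
    by (rule prod.reindex_bij_witness[of _ opp opp]) (use m_cases m_B m_C m_D type_exhaust in \<open>auto simp: opp_def split: if_splits\<close>)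
  have 2: "(\<Prod>i<n. x i) * (\<Prod>i<n. x (opp i)) = 1"
  proof -
    have "x i * x (opp i) = 1" if "i < n" for i using assms[of i] that opp_less_n(1)[of i] n_le_m by force
    thus ?thesis by (simp add: prod.distrib[symmetric])
  qed
  have "{..<m} = {..<n} \<union> (if isB then {n} else {}) \<union> ?U"
    using m_B m_C m_D type_exhaust by auto
  moreover have "({..<n} \<union> (if isB then {n} else {})) \<inter> ?U = {}" "{..<n} \<inter> (if isB then {n} else {}) = {}"
    by auto
  moreover have "finite ({..<n} \<union> (if isB then {n} else {}))" "finite ?U" "finite (if isB then {n} else {})" by auto
  ultimately have "(\<Prod>i<m. x i) = (\<Prod>i<n. x i) * (\<Prod>i\<in>(if isB then {n} else {}). x i) * (\<Prod>i\<in>?U. x i)"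
    by (metis prod.union_disjoint finite_lessThan)
  thus ?thesis using 1 2 by (auto simp: algebra_simps)
qed

text \<open>Only the middle 2 x 2 block of type D can fail to be diagonal. The form on it is a
  hyperbolic plane, whose isometries are diagonal or antidiagonal. In the antidiagonal case,
  exchanging the two middle columns gives a triangular matrix of determinant 1, so \<open>Q\<close>
  would have determinant -1.\<close>

lemma group_block_diagonal:
  assumes Q: "(Q :: 'k mat) \<in> classical_group t n"
    and off: "\<And>p q. p < m \<Longrightarrow> q < m \<Longrightarrow> p \<noteq> q \<Longrightarrow> Q $$ (p, q) \<noteq> 0 \<Longrightarrow>
       isD \<and> (p = n \<and> q = n - 1 \<or> p = n - 1 \<and> q = n)"
  shows "diagonal_mat Q"
proof (rule ccontr)
  note Qc = group_carrier[OF Q]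
  assume "\<not> diagonal_mat Q"
  then obtain p q where pq: "p < m" "q < m" "p \<noteq> q" "Q $$ (p, q) \<noteq> 0"
    using Qc unfolding diagonal_mat_def by auto
  have D: isD using off[OF pq] by blast
  have m: "m = 2 * n" "3 \<le> n" using D m_D rank_D' by auto
  have sg1: "sg k = 1" for k using D type_cases(3) by (auto simp: sg_def)
  have nn: "opp (n - 1) = n" "opp n = n - 1" "n - 1 < m" "n < m" "n - 1 \<noteq> n" using m by (auto simp: opp_def)
  have form: "(\<Sum>k<m. Q $$ (i, k) * Q $$ (j, opp k)) = (if j = opp i then 1 else 0)" if "i < m" "j < m" for i j
    using group_form[OF Q] that unfolding group_iff[OF Qc] by (simp add: sg1)
  have mid: "(\<Sum>k<m. Q $$ (i, k) * Q $$ (j, opp k)) = Q $$ (i, n - 1) * Q $$ (j, n) + Q $$ (i, n) * Q $$ (j, n - 1)"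
    if i: "i = n - 1 \<or> i = n" for i j
  proof -
    have "(\<Sum>k<m. Q $$ (i, k) * Q $$ (j, opp k)) = (\<Sum>k\<in>{n - 1, n}. Q $$ (i, k) * Q $$ (j, opp k))"
    proof (rule sum.mono_neutral_right)
      show "\<forall>k\<in>{..<m} - {n - 1, n}. Q $$ (i, k) * Q $$ (j, opp k) = 0"
      proof
        fix k assume k: "k \<in> {..<m} - {n - 1, n}"
        have "Q $$ (i, k) = 0" using off[of i k] i k nn by blast
        thus "Q $$ (i, k) * Q $$ (j, opp k) = 0" by simp
      qed
    qed (use nn in auto)
    also have "\<dots> = Q $$ (i, n - 1) * Q $$ (j, n) + Q $$ (i, n) * Q $$ (j, n - 1)" using nn by simp
    finally show ?thesis .
  qed
  define a where "a = Q $$ (n - 1, n - 1)"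
  define b where "b = Q $$ (n - 1, n)"
  define c where "c = Q $$ (n, n - 1)"
  define d where "d = Q $$ (n, n)"
  have "a * b + b * a = 0" "c * d + d * c = 0" "a * d + b * c = 1"
    using form[OF nn(3) nn(3)] form[OF nn(4) nn(4)] form[OF nn(3) nn(4)] nn(1,2,5)
      mid[of "n - 1" "n - 1"] mid[of n n] mid[of "n - 1" n] unfolding a_def b_def c_def d_def by metis+
  hence "2 * (a * b) = 0" "2 * (c * d) = 0" "a * d + b * c = 1" by (simp_all add: mult.commute)
  hence eqs: "a * b = 0" "c * d = 0" "a * d + b * c = 1" by auto
  have "b \<noteq> 0 \<or> c \<noteq> 0" using off[OF pq] pq by (auto simp: b_def c_def)
  hence bc: "a = 0" "d = 0" "b * c = 1" using eqs by auto
  define S where "S = swapcols (n - 1) n Q"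
  have S: "S \<in> carrier_mat m m" using Qc by (auto simp: S_def)
  have Si: "S $$ (i, j) = Q $$ (i, if j = n - 1 then n else if j = n then n - 1 else j)" if "i < m" "j < m" for i j
    using that Qc nn by (auto simp: S_def)
  have "det S = (\<Prod>i<m. S $$ (i, i))"
  proof (rule det_triangular[OF S])
    show "(<) = (<) \<or> (<) = (\<lambda>i j :: nat. j < i)" by simp
    fix i j :: nat assume ij: "i < m" "j < m" "i < j"
    show "S $$ (i, j) = 0"
    proof (cases "j = n - 1 \<or> j = n")
      case True
      thus ?thesis
      proof
        assume j: "j = n - 1"
        hence "S $$ (i, j) = Q $$ (i, n)" using Si[OF ij(1,2)] by simp
        moreover have "Q $$ (i, n) = 0"
        proof (rule ccontr)
          assume "Q $$ (i, n) \<noteq> 0"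
          moreover have "i \<noteq> n" using ij j by simp
          ultimately show False using off[OF ij(1) nn(4)] ij j by auto
        qed
        ultimately show ?thesis by simp
      next
        assume j: "j = n"
        hence S: "S $$ (i, j) = Q $$ (i, n - 1)" using Si[OF ij(1,2)] nn(5) by simp
        show ?thesis
        proof (cases "i = n - 1")
          case True
          thus ?thesis using S bc(1) by (simp add: a_def)
        next
          case False
          have "Q $$ (i, n - 1) = 0"
          proof (rule ccontr)
            assume "Q $$ (i, n - 1) \<noteq> 0"
            from off[OF ij(1) nn(3) False this] False ij j show False by auto
          qed
          thus ?thesis using S by simp
        qed
      qed
    next
      case False
      thus ?thesis using Si[OF ij(1,2)] off[of i j] ij by force
    qed
  qed
  also have "\<dots> = (if isB then S $$ (n, n) else 1)"
  proof (rule prod_opp)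
    fix i assume i: "i < m" "opp i \<noteq> i"
    show "S $$ (i, i) * S $$ (opp i, opp i) = 1"
    proof (cases "i = n - 1 \<or> i = n")
      case True
      thus ?thesis
      proof
        assume "i = n - 1"
        thus ?thesis using Si nn bc(3) by (simp add: b_def c_def)
      next
        assume "i = n"
        thus ?thesis using Si nn bc(3) by (simp add: b_def c_def mult.commute)
      qed
    next
      case False
      hence o: "opp i \<noteq> n - 1" "opp i \<noteq> n" using i nn opp_opp by metis+
      have "(\<Sum>k<m. Q $$ (i, k) * Q $$ (opp i, opp k)) = (\<Sum>k<m. if k = i then Q $$ (i, i) * Q $$ (opp i, opp i) else 0)"
      proof (rule sum.cong[OF refl])
        fix k assume "k \<in> {..<m}"
        thus "Q $$ (i, k) * Q $$ (opp i, opp k) = (if k = i then Q $$ (i, i) * Q $$ (opp i, opp i) else 0)"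
          using off[of i k] i False by auto
      qed
      hence "Q $$ (i, i) * Q $$ (opp i, opp i) = 1" using form[of i "opp i"] i by simp
      thus ?thesis using Si i False o by simp
    qed
  qed
  also have "\<dots> = 1" using D type_cases(2) by auto
  finally have "det S = 1" .
  moreover have "det S = - det Q" unfolding S_def by (rule det_swapcols[OF nn(3,4,5) Qc])
  ultimately show False using group_det[OF Q] by simp
qed

lemma group_conj_lie:
  assumes Q: "(Q :: 'k mat) \<in> classical_group t n" and x: "x \<in> classical_lie t n"
  shows "Q * x * mat_inv Q \<in> classical_lie t n"
proof -
  let ?B = "form_mat t n :: 'k mat" and ?Y = "mat_inv Q" and ?Z = "0\<^sub>m m m :: 'k mat"
  note Qc = group_carrier[OF Q] and Y = group_inv[OF Q] and xc = lie_carrier[OF x]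
  have B: "?B \<in> carrier_mat m m" by simp
  have T: "transpose_mat Q \<in> carrier_mat m m" "transpose_mat ?Y \<in> carrier_mat m m" "transpose_mat x \<in> carrier_mat m m"
    using Qc Y xc by auto
  note c = mult_carrier_mat
  have YB: "?Y * ?B = ?B * transpose_mat Q"
  proof -
    have "?Y * ?B = ?Y * (Q * (?B * transpose_mat Q))"
      using group_form[OF Q] assoc_mult_mat[OF Qc B T(1)] by simp
    also have "\<dots> = ?Y * Q * (?B * transpose_mat Q)" by (rule assoc_mult_mat[OF Y(1) Qc c[OF B T(1)], symmetric])
    also have "\<dots> = ?B * transpose_mat Q" unfolding Y(3) by (rule left_mult_one_mat[OF c[OF B T(1)]])
    finally show ?thesis .
  qed
  have BY: "?B * transpose_mat ?Y = Q * ?B"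
  proof -
    have "?B * transpose_mat ?Y = Q * ?B * transpose_mat Q * transpose_mat ?Y"
      using group_form[OF Q] by simp
    also have "\<dots> = Q * ?B * (transpose_mat Q * transpose_mat ?Y)"
      by (rule assoc_mult_mat[OF c[OF Qc B] T(1,2)])
    also have "transpose_mat Q * transpose_mat ?Y = 1\<^sub>m m"
      using transpose_mult[OF Y(1) Qc] Y(3) by simp
    also have "Q * ?B * 1\<^sub>m m = Q * ?B" by (rule right_mult_one_mat[OF c[OF Qc B]])
    finally show ?thesis .
  qed
  have W: "Q * x * ?Y \<in> carrier_mat m m" by (rule c[OF c[OF Qc xc] Y(1)])
  have 1: "Q * x * ?Y * ?B = Q * (x * ?B) * transpose_mat Q"
  proof -
    have "Q * x * ?Y * ?B = Q * x * (?Y * ?B)" by (rule assoc_mult_mat[OF c[OF Qc xc] Y(1) B])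
    also have "\<dots> = Q * x * ?B * transpose_mat Q" unfolding YB by (rule assoc_mult_mat[OF c[OF Qc xc] B T(1), symmetric])
    also have "Q * x * ?B = Q * (x * ?B)" by (rule assoc_mult_mat[OF Qc xc B])
    finally show ?thesis .
  qed
  have 2: "?B * transpose_mat (Q * x * ?Y) = Q * (?B * transpose_mat x) * transpose_mat Q"
  proof -
    have "transpose_mat (Q * x * ?Y) = transpose_mat ?Y * (transpose_mat x * transpose_mat Q)"
      using transpose_mult[OF c[OF Qc xc] Y(1)] transpose_mult[OF Qc xc] by simp
    hence "?B * transpose_mat (Q * x * ?Y) = ?B * transpose_mat ?Y * (transpose_mat x * transpose_mat Q)"
      using assoc_mult_mat[OF B T(2) c[OF T(3,1)]] by simp
    also have "\<dots> = Q * ?B * transpose_mat x * transpose_mat Q"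
      unfolding BY by (rule assoc_mult_mat[OF c[OF Qc B] T(3,1), symmetric])
    also have "Q * ?B * transpose_mat x = Q * (?B * transpose_mat x)" by (rule assoc_mult_mat[OF Qc B T(3)])
    finally show ?thesis .
  qed
  have "Q * x * ?Y * ?B + ?B * transpose_mat (Q * x * ?Y) =
      (Q * (x * ?B) + Q * (?B * transpose_mat x)) * transpose_mat Q"
    unfolding 1 2 by (rule add_mult_distrib_mat[OF c[OF Qc c[OF xc B]] c[OF Qc c[OF B T(3)]] T(1), symmetric])
  also have "Q * (x * ?B) + Q * (?B * transpose_mat x) = Q * (x * ?B + ?B * transpose_mat x)"
    by (rule mult_add_distrib_mat[OF Qc c[OF xc B] c[OF B T(3)], symmetric])
  also have "x * ?B + ?B * transpose_mat x = ?Z" using x by (simp add: classical_lie_def)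
  also have "Q * ?Z * transpose_mat Q = ?Z" using Qc T(1) by simp
  finally show ?thesis using W by (simp add: classical_lie_def)
qed

end

section \<open>Admissible triples and their root vectors\<close>

lemma tau_graph_iff: "(i, j) \<in> tau_graph G \<tau> \<longleftrightarrow> i \<in> G \<and> j = \<tau> i"
  by (auto simp: tau_graph_def)

lemma tau_lin_graph_iff: "(a, b) \<in> tau_lin_graph G \<tau> \<longleftrightarrow> supp a \<subseteq> G \<and> b = tau_lin G \<tau> a"
  by (auto simp: tau_lin_graph_def)

locale bd_data = classical_type K t n
  for K :: "'k::field_char_0 itself" and t :: cartan_type and n :: nat +
  fixes G1 G2 :: "nat set" and \<tau> :: "nat \<Rightarrow> nat" and e :: "lattice_vec \<Rightarrow> 'k mat" and r0 r :: "'k mat"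
  assumes triple: "admissible_triple K t n G1 G2 \<tau>"
    and vectors: "root_vectors t n G1 G2 \<tau> e"
    and cartan: "cartan_part t n G1 \<tau> r0"
    and r_eq: "r = r0 + mat_sum (std_dim t n * std_dim t n) (\<lambda>a. kron (e (neg_root a)) (e a)) (pos_roots K t n)
         + mat_sum (std_dim t n * std_dim t n) (\<lambda>(a, k, b). wedge (e (neg_root a)) (e b))
             {(a, k, b). a \<in> pos_roots K t n \<and> supp a \<subseteq> G1 \<and> 1 \<le> k \<and> (a, b) \<in> tau_lin_graph G1 \<tau> ^^ k}"
begin

abbreviation "T \<equiv> tau_graph G1 \<tau>"
abbreviation "PR \<equiv> pos_roots K t n"

lemma G1_sub: "G1 \<subseteq> {1..n}" and G2_sub: "G2 \<subseteq> {1..n}" and tau_bij: "bij_betw \<tau> G1 G2"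
  and nilpotent: "i \<in> G1 \<Longrightarrow> \<exists>k\<ge>1. \<exists>j. (i, j) \<in> T ^^ k \<and> j \<notin> G1"
  using triple unfolding admissible_triple_def by blast+

lemma finite_G1: "finite G1"
  using G1_sub finite_subset by blast

lemma tau_in: "i \<in> G1 \<Longrightarrow> \<tau> i \<in> G2"
  using tau_bij by (rule bij_betwE[rule_format])

lemma tau_range: "i \<in> G1 \<Longrightarrow> \<tau> i \<in> {1..n}"
  using tau_in G2_sub by blast

lemma tau_inj: "i \<in> G1 \<Longrightarrow> j \<in> G1 \<Longrightarrow> \<tau> i = \<tau> j \<Longrightarrow> i = j"
  using tau_bij unfolding bij_betw_def inj_on_def by blast

text \<open>A partial map never leaves a cycle, whereas admissibility provides a power of \<tau>
  that leads out of \<open>G1\<close>.\<close>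

lemma no_cycle: "(i, i) \<notin> T\<^sup>+"
proof
  assume c: "(i, i) \<in> T\<^sup>+"
  have "\<exists>z. (i, z) \<in> T \<and> (z, i) \<in> T\<^sup>*" by (rule tranclD[OF c])
  hence "i \<in> G1" unfolding tau_graph_iff by blast
  then obtain k j where kj: "(i, j) \<in> T ^^ k" "j \<notin> G1" using nilpotent by blast
  have "(j, i) \<in> T\<^sup>+" if "(i, j) \<in> T ^^ k" for k j
    using that
  proof (induction k arbitrary: j)
    case 0
    thus ?case using c by simp
  next
    case (Suc k)
    then obtain y where y: "(i, y) \<in> T ^^ k" "(y, j) \<in> T" by auto
    from tranclD[OF Suc.IH[OF y(1)]] obtain z where z: "(y, z) \<in> T" "(z, i) \<in> T\<^sup>*" by blast
    have "z = j" using y(2) z(1) unfolding tau_graph_iff by simp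
    hence ji: "(j, i) \<in> T\<^sup>*" using z(2) by simp
    show ?case
    proof (cases "j = i")
      case True
      thus ?thesis using c by simp
    next
      case False
      thus ?thesis using ji by (simp add: rtrancl_eq_or_trancl)
    qed
  qed
  from tranclD[OF this[OF kj(1)]] kj(2) show False unfolding tau_graph_iff by blast
qed

lemma T_sub: "T \<subseteq> {1..n} \<times> {1..n}"
  using G1_sub tau_range by (auto simp: tau_graph_def)

lemma finite_T_plus: "finite (T\<^sup>+)"
  using finite_subset[OF T_sub] by (simp add: finite_trancl)

text \<open>A positive weight that increases along \<open>\<tau>\<close>, i.e. a dominant coweight for which all
  tail terms of \<open>r\<close> have positive degree.\<close>

definition level :: "nat \<Rightarrow> nat" where "level i = Suc (card {j. (j, i) \<in> T\<^sup>+})"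

lemma level_less: "i \<in> G1 \<Longrightarrow> level i < level (\<tau> i)"
proof -
  assume i: "i \<in> G1"
  have s: "(i, \<tau> i) \<in> T" using i by (simp add: tau_graph_iff)
  have fin: "finite {j. (j, \<tau> i) \<in> T\<^sup>+}"
    by (rule finite_subset[of _ "fst ` T\<^sup>+"]) (use finite_T_plus in force)+
  have "{j. (j, i) \<in> T\<^sup>+} \<subset> {j. (j, \<tau> i) \<in> T\<^sup>+}"
  proof
    show "{j. (j, i) \<in> T\<^sup>+} \<subseteq> {j. (j, \<tau> i) \<in> T\<^sup>+}"
      using s by (auto intro: trancl_into_trancl)
    have "i \<in> {j. (j, \<tau> i) \<in> T\<^sup>+}" "i \<notin> {j. (j, i) \<in> T\<^sup>+}" using s no_cycle by auto
    thus "{j. (j, i) \<in> T\<^sup>+} \<noteq> {j. (j, \<tau> i) \<in> T\<^sup>+}" by metis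
  qed
  from psubset_card_mono[OF fin this] show ?thesis by (simp add: level_def)
qed

text \<open>The pairing of a root with the coweight that takes the value \<open>level k\<close> at
  the simple root k.\<close>

definition ht :: "lattice_vec \<Rightarrow> int" where "ht a = (\<Sum>k\<in>{1..n}. int (level k) * a k)"

lemma ht_neg: "ht (neg_root a) = - ht a"
  by (simp add: ht_def neg_root_def sum_negf)

lemma ht_supp: "supp a \<subseteq> G1 \<Longrightarrow> ht a = (\<Sum>k\<in>G1. int (level k) * a k)"
  unfolding ht_def using G1_sub by (intro sum.mono_neutral_right) (auto simp: supp_def)

lemma ht_tau_lin: "ht (tau_lin G1 \<tau> a) = (\<Sum>i\<in>G1. int (level (\<tau> i)) * a i)"
proof -
  have "ht (tau_lin G1 \<tau> a) = (\<Sum>k\<in>{1..n}. \<Sum>i\<in>G1. int (level k) * (a i * simple_root (\<tau> i) k))"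
    by (simp add: ht_def tau_lin_def sum_distrib_left)
  also have "\<dots> = (\<Sum>i\<in>G1. \<Sum>k\<in>{1..n}. int (level k) * (a i * simple_root (\<tau> i) k))" by (rule sum.swap)
  also have "\<dots> = (\<Sum>i\<in>G1. int (level (\<tau> i)) * a i)"
  proof (rule sum.cong[OF refl])
    fix i assume i: "i \<in> G1"
    have "(\<Sum>k\<in>{1..n}. int (level k) * (a i * simple_root (\<tau> i) k)) =
       (\<Sum>k\<in>{1..n}. if k = \<tau> i then int (level (\<tau> i)) * a i else 0)"
      by (intro sum.cong) (auto simp: simple_root_def)
    thus "(\<Sum>k\<in>{1..n}. int (level k) * (a i * simple_root (\<tau> i) k)) = int (level (\<tau> i)) * a i"
      using tau_range[OF i] by simp
  qed
  finally show ?thesis .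
qed

lemma ht_tau_less:
  assumes "supp a \<subseteq> G1" "\<And>k. 0 \<le> a k" "supp a \<noteq> {}"
  shows "ht a < ht (tau_lin G1 \<tau> a)"
proof -
  obtain k where k: "a k \<noteq> 0" using assms(3) by (auto simp: supp_def)
  hence kG: "k \<in> G1" using assms(1) by (auto simp: supp_def)
  have "(\<Sum>i\<in>G1. int (level i) * a i) < (\<Sum>i\<in>G1. int (level (\<tau> i)) * a i)"
  proof (rule sum_strict_mono_ex1[OF finite_G1])
    show "\<forall>i\<in>G1. int (level i) * a i \<le> int (level (\<tau> i)) * a i"
    proof
      fix i assume "i \<in> G1"
      from level_less[OF this] assms(2)[of i]
      show "int (level i) * a i \<le> int (level (\<tau> i)) * a i" by (intro mult_right_mono) auto
    qed
    have "0 < a k" using k assms(2)[of k] by simp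
    thus "\<exists>i\<in>G1. int (level i) * a i < int (level (\<tau> i)) * a i"
      using level_less[OF kG] kG by (intro bexI[of _ k] mult_strict_right_mono) auto
  qed
  thus ?thesis unfolding ht_tau_lin ht_supp[OF assms(1)] .
qed

subsection \<open>Root vectors\<close>

lemma root_multiple:
  assumes ij: "root_pair i j" and x: "x \<in> root_space t n (rt i j)" and y: "y \<in> root_space t n (rt i j)" and ne: "y \<noteq> 0\<^sub>m m m"
  shows "y $$ (i, j) \<noteq> 0" "x = (x $$ (i, j) / y $$ (i, j)) \<cdot>\<^sub>m (y :: 'k mat)"
proof -
  let ?v = "rvec i j $$ (i, j)"
  have v: "?v \<noteq> 0" by (rule rvec_nonzero[OF ij])
  have rc: "rvec i j \<in> carrier_mat m m" by (simp add: rvec_def)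
  note ym = root_space_multiple[OF y ij] and xm = root_space_multiple[OF x ij]
  show y0: "y $$ (i, j) \<noteq> 0"
  proof
    assume z: "y $$ (i, j) = 0"
    have "y = (0 / ?v) \<cdot>\<^sub>m rvec i j" using ym unfolding z .
    also have "\<dots> = 0\<^sub>m m m" using rc by (intro eq_matI) auto
    finally show False using ne by contradiction
  qed
  have "(x $$ (i, j) / y $$ (i, j)) \<cdot>\<^sub>m y = (x $$ (i, j) / y $$ (i, j)) \<cdot>\<^sub>m ((y $$ (i, j) / ?v) \<cdot>\<^sub>m rvec i j)"
    by (rule arg_cong[OF ym])
  also have "\<dots> = (x $$ (i, j) / ?v) \<cdot>\<^sub>m rvec i j" using y0 v rc by (intro eq_matI) auto
  also have "\<dots> = x" by (rule xm[symmetric])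
  finally show "x = (x $$ (i, j) / y $$ (i, j)) \<cdot>\<^sub>m y" by (rule sym)
qed

lemma e_space: "a \<in> roots K t n \<Longrightarrow> e a \<in> root_space t n a"
  and e_killing: "a \<in> roots K t n \<Longrightarrow> killing_form t n (e a) (e (neg_root a)) = 1"
proof -
  have h: "\<forall>a\<in>roots TYPE('k) t n. e a \<in> root_space t n a \<and> killing_form t n (e a) (e (neg_root a)) = 1"
    using vectors unfolding root_vectors_def by (rule conjunct1)
  have K: "roots TYPE('k) t n = roots K t n" by (simp add: roots_def)
  show "a \<in> roots K t n \<Longrightarrow> e a \<in> root_space t n a"
    "a \<in> roots K t n \<Longrightarrow> killing_form t n (e a) (e (neg_root a)) = 1"
    using h unfolding K by simp_all
qed

lemma e_nonzero:
  assumes "a \<in> roots K t n"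
  shows "e a \<noteq> 0\<^sub>m m m"
proof
  assume z: "e a = 0\<^sub>m m m"
  have c: "e (neg_root a) \<in> carrier_mat m m"
    by (rule root_space_carrier[OF e_space[OF neg_root_in[OF assms]]])
  have "killing_form t n (0\<^sub>m m m) (e (neg_root a)) = (1 :: 'k)" using e_killing[OF assms] unfolding z .
  thus False unfolding killing_zero[OF c] by simp
qed

lemma PR_roots: "a \<in> PR \<Longrightarrow> a \<in> roots K t n"
  and PR_nonneg: "a \<in> PR \<Longrightarrow> 0 \<le> a k"
  and PR_supp: "a \<in> PR \<Longrightarrow> supp a \<subseteq> {1..n}" "a \<in> PR \<Longrightarrow> supp a \<noteq> {}"
  by (auto simp: pos_roots_def roots_def)

lemma supp_neg: "supp (neg_root a) = supp a"
  by (simp add: supp_def neg_root_def)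

lemma neg_neg: "neg_root (neg_root a) = a"
  by (simp add: neg_root_def)

lemma pos_root_order:
  assumes "root_pair i j" "rt i j \<in> PR"
  shows "i < j"
proof (rule ccontr)
  assume "\<not> i < j"
  hence "j < i" using assms(1) by (auto simp: root_pair_def)
  hence n: "0 \<le> rt j i k" for k by (rule rt_nonneg[OF root_pair_sym[OF assms(1)]])
  have "rt i j k = 0" for k
    using n[of k] PR_nonneg[OF assms(2), of k] rt_swap[OF assms(1)] by (simp add: neg_root_def)
  hence "supp (rt i j) = {}" by (simp add: supp_def)
  thus False using PR_supp(2)[OF assms(2)] by contradiction
qed

text \<open>A nonzero entry reveals the root by its position; this is how sums over roots and chains
  are evaluated one position at a time.\<close>

lemma e_pos_index:
  assumes "a \<in> PR" "i < m" "j < m" "e a $$ (i, j) \<noteq> 0"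
  shows "root_pair i j" "a = rt i j" "i < j"
  using root_space_pair_pos[OF e_space[OF PR_roots[OF assms(1)]] assms] by blast+

lemma e_neg_index:
  assumes "a \<in> PR" "i < m" "j < m" "e (neg_root a) $$ (i, j) \<noteq> 0"
  shows "root_pair j i" "a = rt j i" "j < i"
proof -
  have "supp (neg_root a) \<subseteq> {1..n}" "supp (neg_root a) \<noteq> {}" unfolding supp_neg using PR_supp[OF assms(1)] .
  note p = root_space_pair[OF e_space[OF neg_root_in[OF PR_roots[OF assms(1)]]] this assms(2,3,4)]
  show rp: "root_pair j i" by (rule root_pair_sym[OF p(1)])
  have "rt j i = neg_root (neg_root a)" unfolding p(2) by (rule rt_swap[OF p(1)])
  thus a: "a = rt j i" unfolding neg_neg by (rule sym)
  show "j < i" using pos_root_order[OF rp] assms(1) unfolding a[symmetric] by blast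
qed

lemma tau_lin_add: "tau_lin G1 \<tau> (\<lambda>k. a k + b k) = (\<lambda>k. tau_lin G1 \<tau> a k + tau_lin G1 \<tau> b k)"
  by (rule ext) (simp add: tau_lin_def distrib_right sum.distrib)

lemma tau_lin_simple: "i \<in> G1 \<Longrightarrow> tau_lin G1 \<tau> (simple_root i) = simple_root (\<tau> i)"
proof
  fix j assume i: "i \<in> G1"
  have "tau_lin G1 \<tau> (simple_root i) j = (\<Sum>k\<in>G1. if k = i then simple_root (\<tau> i) j else 0)"
    unfolding tau_lin_def by (intro sum.cong refl) (simp add: simple_root_def)
  thus "tau_lin G1 \<tau> (simple_root i) j = simple_root (\<tau> i) j" using i finite_G1 by simp
qed

lemma supp_tau_lin: "supp (tau_lin G1 \<tau> a) \<subseteq> {1..n}"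
proof
  fix j assume "j \<in> supp (tau_lin G1 \<tau> a)"
  hence "(\<Sum>i\<in>G1. a i * simple_root (\<tau> i) j) \<noteq> 0" by (simp add: supp_def tau_lin_def)
  then obtain i where "i \<in> G1" "a i * simple_root (\<tau> i) j \<noteq> 0" by (rule sum.not_neutral_contains_not_neutral)
  thus "j \<in> {1..n}" using tau_range[of i] by (auto simp: simple_root_def split: if_splits)
qed

lemma root_space_smult: "x \<in> root_space t n a \<Longrightarrow> supp a \<subseteq> {1..n} \<Longrightarrow> c \<cdot>\<^sub>m (x :: 'k mat) \<in> root_space t n a"
  unfolding root_space_iff using lie_smult lie_carrier by fastforce

text \<open>The given isomorphism maps the root vector of \<open>a\<close>, which is an iterated bracket of simple root
  vectors, into the root space of \<open>\<tau>(a)\<close>; so \<open>\<tau>(a)\<close> is again a root.\<close>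

lemma tau_lin_pos_roots:
  assumes a: "a \<in> PR" and aG: "supp a \<subseteq> G1"
  shows "tau_lin G1 \<tau> a \<in> PR"
proof -
  define gens where "gens \<Gamma> = e ` (simple_root ` \<Gamma> \<union> (neg_root \<circ> simple_root) ` \<Gamma>)" for \<Gamma>
  let ?L1 = "lie_generated m (gens G1)" and ?L2 = "lie_generated m (gens G2)"
  obtain \<phi> where iso: "lie_iso ?L1 ?L2 \<phi>" and simp: "\<forall>i\<in>G1. \<phi> (e (simple_root i)) = e (simple_root (\<tau> i))"
    using vectors unfolding root_vectors_def Let_def gens_def by blast
  have ph: "\<And>c x. x \<in> ?L1 \<Longrightarrow> \<phi> (c \<cdot>\<^sub>m x) = c \<cdot>\<^sub>m \<phi> x"
    "\<And>x y. x \<in> ?L1 \<Longrightarrow> y \<in> ?L1 \<Longrightarrow> \<phi> (lie_bracket x y) = lie_bracket (\<phi> x) (\<phi> y)"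
    "inj_on \<phi> ?L1"
    using iso unfolding lie_iso_def bij_betw_def by blast+
  \<comment> \<open>The claim covers the whole root space and not just \<open>e a\<close>, so that
    in the inductive step it applies to the vectors \<open>rvec\<close>, whose bracket is known to
    be nonzero.\<close>
  have key: "supp (rt i j) \<subseteq> G1 \<longrightarrow> (\<forall>x \<in> root_space t n (rt i j). x \<in> ?L1 \<and> \<phi> x \<in> root_space t n (tau_lin G1 \<tau> (rt i j)))"
    if "root_pair i j" "i < j" for i j
    using that
  proof (induction rule: pos_pair_induct)
    case (simple k)
    show ?case unfolding rt_simple[OF simple]
    proof (intro impI ballI)
      fix x :: "'k mat" assume s: "supp (simple_root k) \<subseteq> G1" and x: "x \<in> root_space t n (simple_root k)"
      have "k \<in> supp (simple_root k)" by (simp add: supp_def simple_root_def)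
      hence k: "k \<in> G1" using s by blast
      have rk: "simple_root k \<in> roots K t n" by (rule PR_roots[OF simple_root_in[OF simple]])
      have eL: "e (simple_root k) \<in> ?L1" by (rule lie_generated.gen) (use k in \<open>simp add: gens_def\<close>)
      obtain c where c: "x = c \<cdot>\<^sub>m e (simple_root k)"
        using root_multiple(2)[OF simple_pair(1)[OF simple], unfolded rt_simple[OF simple], OF x e_space[OF rk] e_nonzero[OF rk]] by blast
      have tr: "simple_root (\<tau> k) \<in> roots K t n" by (rule PR_roots[OF simple_root_in[OF tau_range[OF k]]])
      have "\<phi> x = c \<cdot>\<^sub>m e (simple_root (\<tau> k))" unfolding c ph(1)[OF eL] using simp k by simp
      also have "\<dots> \<in> root_space t n (simple_root (\<tau> k))"
        by (rule root_space_smult[OF e_space[OF tr] PR_supp(1)[OF simple_root_in[OF tau_range[OF k]]]])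
      finally show "x \<in> ?L1 \<and> \<phi> x \<in> root_space t n (tau_lin G1 \<tau> (simple_root k))"
        unfolding tau_lin_simple[OF k] using lie_generated.smult[OF eL, of c] c by simp
    qed
  next
    case (opp i j)
    thus ?case unfolding rt_opp[OF opp(1)] by simp
  next
    case (add i p j)
    show ?case
    proof (intro impI ballI)
      fix x :: "'k mat" assume s: "supp (rt i j) \<subseteq> G1" and x: "x \<in> root_space t n (rt i j)"
      note sum_eq = rt_add[OF add(1,2)]
      have nn: "0 \<le> rt i p k" "0 \<le> rt p j k" for k using rt_nonneg add by blast+
      have sp: "supp (rt i p) \<subseteq> G1" "supp (rt p j) \<subseteq> G1"
      proof -
        have "k \<in> supp (rt i j)" if "k \<in> supp (rt i p) \<or> k \<in> supp (rt p j)" for k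
          using that nn[of k] by (auto simp: supp_def sum_eq)
        thus "supp (rt i p) \<subseteq> G1" "supp (rt p j) \<subseteq> G1" using s by blast+
      qed
      note y = rvec_root_space[OF add(1)] and z = rvec_root_space[OF add(2)]
      have yL: "rvec i p \<in> ?L1" "\<phi> (rvec i p) \<in> root_space t n (tau_lin G1 \<tau> (rt i p))"
        using add.IH(1) sp(1) y by blast+
      have zL: "rvec p j \<in> ?L1" "\<phi> (rvec p j) \<in> root_space t n (tau_lin G1 \<tau> (rt p j))"
        using add.IH(2) sp(2) z by blast+
      define w where "w = lie_bracket (rvec i p) (rvec p j)"
      have G1n: "supp (rt i p) \<subseteq> {1..n}" "supp (rt p j) \<subseteq> {1..n}" using sp G1_sub by blast+
      have w: "w \<in> root_space t n (rt i j)" unfolding w_def sum_eq by (rule root_space_bracket[OF y z G1n])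
      have ij: "i < m" "j < m" using add(3) by (auto simp: root_pair_def)
      have "w \<noteq> 0\<^sub>m m m" using rvec_bracket_nonzero[OF add(1-5)] ij unfolding w_def by auto
      then obtain c where c: "x = c \<cdot>\<^sub>m w" using root_multiple(2)[OF add(3) x w] by blast
      have wL: "w \<in> ?L1" unfolding w_def by (rule lie_generated.bracket[OF yL(1) zL(1)])
      have "\<phi> x = c \<cdot>\<^sub>m lie_bracket (\<phi> (rvec i p)) (\<phi> (rvec p j))"
        unfolding c ph(1)[OF wL] unfolding w_def ph(2)[OF yL(1) zL(1)] ..
      also have "\<dots> \<in> root_space t n (tau_lin G1 \<tau> (rt i j))"
        unfolding sum_eq tau_lin_add
        by (rule root_space_smult[OF root_space_bracket[OF yL(2) zL(2) supp_tau_lin supp_tau_lin] supp_add[OF supp_tau_lin supp_tau_lin]])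
      finally show "x \<in> ?L1 \<and> \<phi> x \<in> root_space t n (tau_lin G1 \<tau> (rt i j))"
        using lie_generated.smult[OF wL, of c] c by simp
    qed
  qed
  obtain i j where ij: "root_pair i j" "i < j" "a = rt i j" using a pos_roots_iff by blast
  have ea: "e a \<in> ?L1" "\<phi> (e a) \<in> root_space t n (tau_lin G1 \<tau> a)"
    using key[OF ij(1,2)] aG e_space[OF PR_roots[OF a]] unfolding ij(3) by blast+
  have zL: "0\<^sub>m m m \<in> ?L1" by (rule lie_generated.zero)
  \<comment> \<open>Compatibility with scalars gives the image of 0 as 0 times the image of
    \<open>e a\<close>; injectivity then would make \<open>e a\<close> vanish.\<close>
  have "\<phi> (e a) \<noteq> 0\<^sub>m m m"
  proof
    assume z: "\<phi> (e a) = 0\<^sub>m m m"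
    have c: "\<phi> (e a) \<in> carrier_mat m m" by (rule root_space_carrier[OF ea(2)])
    have "\<phi> (0 \<cdot>\<^sub>m e a) = 0 \<cdot>\<^sub>m \<phi> (e a)" by (rule ph(1)[OF ea(1)])
    also have "\<dots> = \<phi> (e a)" unfolding z by (intro eq_matI) auto
    finally have "0 \<cdot>\<^sub>m e a = e a" by (rule inj_onD[OF ph(3) _ lie_generated.smult[OF ea(1)] ea(1)])
    moreover have "0 \<cdot>\<^sub>m e a = 0\<^sub>m m m"
      using root_space_carrier[OF e_space[OF PR_roots[OF a]]] by (intro eq_matI) auto
    ultimately show False using e_nonzero[OF PR_roots[OF a]] by simp
  qed
  \<comment> \<open>The height of the image exceeds that of \<open>a\<close>, which is not negative,
    so the image is not the zero vector of the lattice.\<close>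
  moreover have "supp (tau_lin G1 \<tau> a) \<noteq> {}"
  proof
    assume "supp (tau_lin G1 \<tau> a) = {}"
    hence "ht (tau_lin G1 \<tau> a) = 0" by (simp add: ht_def supp_def)
    moreover have "0 \<le> ht a" unfolding ht_def by (intro sum_nonneg mult_nonneg_nonneg PR_nonneg[OF a]) simp
    ultimately show False using ht_tau_less[OF aG PR_nonneg[OF a] PR_supp(2)[OF a]] by simp
  qed
  ultimately have "tau_lin G1 \<tau> a \<in> roots K t n"
    using ea(2) supp_tau_lin unfolding roots_def by blast
  moreover have "0 \<le> tau_lin G1 \<tau> a k" for k
    unfolding tau_lin_def by (intro sum_nonneg mult_nonneg_nonneg PR_nonneg[OF a]) (simp add: simple_root_def)
  ultimately show ?thesis unfolding pos_roots_def by simp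
qed

definition chains :: "(lattice_vec \<times> nat \<times> lattice_vec) set" where
  "chains = {(a, k, b). a \<in> PR \<and> supp a \<subseteq> G1 \<and> 1 \<le> k \<and> (a, b) \<in> tau_lin_graph G1 \<tau> ^^ k}"

lemma chain_pos:
  assumes "a \<in> PR" "(a, b) \<in> tau_lin_graph G1 \<tau> ^^ k"
  shows "b \<in> PR \<and> ht a + int k \<le> ht b"
  using assms(2)
proof (induction k arbitrary: b)
  case 0
  thus ?case using assms(1) by simp
next
  case (Suc k)
  then obtain c where c: "(a, c) \<in> tau_lin_graph G1 \<tau> ^^ k" "(c, b) \<in> tau_lin_graph G1 \<tau>" by auto
  from Suc.IH[OF c(1)] have h: "c \<in> PR" "ht a + int k \<le> ht c" by auto
  from c(2) have b: "supp c \<subseteq> G1" "b = tau_lin G1 \<tau> c" unfolding tau_lin_graph_iff by auto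
  show ?case using tau_lin_pos_roots[OF h(1) b(1)] ht_tau_less[OF b(1) PR_nonneg[OF h(1)] PR_supp(2)[OF h(1)]] h(2)
    unfolding b(2) by simp
qed

lemma chainsD:
  assumes "(a, k, b) \<in> chains"
  shows "a \<in> PR" "b \<in> PR" "ht a < ht b"
  using assms chain_pos[of a b k] unfolding chains_def by auto

text \<open>Each step of \<tau> raises the height by at least 1, and the heights of positive roots
  are bounded. Finiteness matters because sums over infinite sets are 0 by convention.\<close>

lemma finite_chains: "finite chains"
proof -
  define H where "H = (\<Sum>a\<in>PR. \<bar>ht a\<bar>)"
  have H: "\<bar>ht a\<bar> \<le> H" if "a \<in> PR" for a
    unfolding H_def using that by (intro member_le_sum[where f = "\<lambda>a. \<bar>ht a\<bar>"] finite_pos_roots) auto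
  have "chains \<subseteq> PR \<times> {..nat (2 * H)} \<times> PR"
  proof
    fix s assume s: "s \<in> chains"
    obtain a k b where abk: "s = (a, k, b)" by (cases s)
    have "ht a + int k \<le> ht b" "a \<in> PR" "b \<in> PR"
      using s chain_pos[of a b k] unfolding abk chains_def by auto
    thus "s \<in> PR \<times> {..nat (2 * H)} \<times> PR" using H[of a] H[of b] unfolding abk by auto
  qed
  thus ?thesis by (rule finite_subset) (intro finite_cartesian_product finite_pos_roots finite_atMost)
qed

subsection \<open>The coefficients of the r-matrix\<close>

definition \<rho>0 :: "nat \<Rightarrow> nat \<Rightarrow> nat \<Rightarrow> nat \<Rightarrow> 'k" where "\<rho>0 = tensor_coeff m r0"
definition \<rho> :: "nat \<Rightarrow> nat \<Rightarrow> nat \<Rightarrow> nat \<Rightarrow> 'k" where "\<rho> = tensor_coeff m r"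

lemma e_carrier: "a \<in> PR \<Longrightarrow> e a \<in> carrier_mat m m" "a \<in> PR \<Longrightarrow> e (neg_root a) \<in> carrier_mat m m"
  and e_lie: "a \<in> PR \<Longrightarrow> e a \<in> classical_lie t n" "a \<in> PR \<Longrightarrow> e (neg_root a) \<in> classical_lie t n"
  using root_space_lie[OF e_space] PR_roots neg_root_in lie_carrier by blast+

lemma r0_decomp:
  obtains N :: nat and u v where "\<And>p. p < N \<Longrightarrow> u p \<in> cartan_subalg t n" "\<And>p. p < N \<Longrightarrow> v p \<in> cartan_subalg t n"
    "r0 = mat_sum (m * m) (\<lambda>p. kron (u p) (v p)) {..<N}"
proof -
  have "r0 \<in> tensor_space m (cartan_subalg t n) (cartan_subalg t n)"
    using cartan unfolding cartan_part_def Let_def by (rule conjunct1)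
  thus ?thesis using that unfolding tensor_space_def by blast
qed

lemma r0_carrier: "r0 \<in> carrier_mat (m * m) (m * m)"
  by (rule r0_decomp) simp

lemma \<rho>0_sum:
  obtains N :: nat and u v where "\<And>p. p < N \<Longrightarrow> u p \<in> cartan_subalg t n" "\<And>p. p < N \<Longrightarrow> v p \<in> cartan_subalg t n"
    "\<And>i j k l. i < m \<Longrightarrow> j < m \<Longrightarrow> k < m \<Longrightarrow> l < m \<Longrightarrow> \<rho>0 i j k l = (\<Sum>p<N. u p $$ (i, j) * v p $$ (k, l))"
proof -
  obtain N :: nat and u v where d: "\<And>p. p < N \<Longrightarrow> u p \<in> cartan_subalg t n" "\<And>p. p < N \<Longrightarrow> v p \<in> cartan_subalg t n"
    "r0 = mat_sum (m * m) (\<lambda>p. kron (u p) (v p)) {..<N}" by (rule r0_decomp) blast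
  have c: "u p \<in> carrier_mat m m" "v p \<in> carrier_mat m m" if "p < N" for p
    using d(1,2)[OF that] by (simp_all add: cartan_iff)
  have "\<rho>0 i j k l = (\<Sum>p<N. u p $$ (i, j) * v p $$ (k, l))" if l: "i < m" "j < m" "k < m" "l < m" for i j k l
    unfolding \<rho>0_def unfolding d(3) tensor_coeff_sum[OF l] by (intro sum.cong refl tensor_coeff_kron c l) auto
  thus ?thesis using that d(1,2) by blast
qed

lemma \<rho>0_diag:
  assumes l: "i < m" "j < m" "k < m" "l < m" and ne: "i \<noteq> j \<or> k \<noteq> l"
  shows "\<rho>0 i j k l = 0"
proof -
  obtain N :: nat and u v where u: "\<And>p. p < N \<Longrightarrow> u p \<in> cartan_subalg t n" and v: "\<And>p. p < N \<Longrightarrow> v p \<in> cartan_subalg t n"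
    and s: "\<And>i j k l. i < m \<Longrightarrow> j < m \<Longrightarrow> k < m \<Longrightarrow> l < m \<Longrightarrow> \<rho>0 i j k l = (\<Sum>p<N. u p $$ (i, j) * v p $$ (k, l))"
    by (rule \<rho>0_sum) blast
  have z: "D $$ (a, b) = 0" if "D \<in> cartan_subalg t n" "a < m" "b < m" "a \<noteq> b" for D :: "'k mat" and a b
  proof -
    have "D \<in> carrier_mat m m \<and> diagonal_mat D" using that(1) unfolding cartan_iff by simp
    thus ?thesis using that(2-4) unfolding diagonal_mat_def by auto
  qed
  have "u p $$ (i, j) * v p $$ (k, l) = 0" if p: "p \<in> {..<N}" for p
    using ne z[OF u l(1,2)] z[OF v l(3,4)] p by auto
  thus "\<rho>0 i j k l = 0" unfolding s[OF l] by (intro sum.neutral) blast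
qed

lemma \<rho>_eq:
  assumes l: "i < m" "j < m" "k < m" "l < m"
  shows "\<rho> i j k l = \<rho>0 i j k l + (\<Sum>a\<in>PR. e (neg_root a) $$ (i, j) * e a $$ (k, l)) +
    (\<Sum>(a, q, b)\<in>chains. e (neg_root a) $$ (i, j) * e b $$ (k, l) - e b $$ (i, j) * e (neg_root a) $$ (k, l))"
proof -
  have 1: "tensor_coeff m (mat_sum (m * m) (\<lambda>a. kron (e (neg_root a)) (e a)) PR) i j k l =
      (\<Sum>a\<in>PR. e (neg_root a) $$ (i, j) * e a $$ (k, l))"
    unfolding tensor_coeff_sum[OF l] by (intro sum.cong refl tensor_coeff_kron e_carrier l)
  have 2: "tensor_coeff m (mat_sum (m * m) (\<lambda>(a, k, b). wedge (e (neg_root a)) (e b)) chains) i j k l =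
      (\<Sum>(a, q, b)\<in>chains. e (neg_root a) $$ (i, j) * e b $$ (k, l) - e b $$ (i, j) * e (neg_root a) $$ (k, l))"
    unfolding tensor_coeff_sum[OF l]
  proof (rule sum.cong[OF refl])
    fix s assume s: "s \<in> chains"
    obtain a q b where abq: "s = (a, q, b)" by (cases s)
    have ab: "a \<in> PR" "b \<in> PR" using chainsD s unfolding abq by blast+
    have "tensor_coeff m (wedge (e (neg_root a)) (e b)) i j k l =
        tensor_coeff m (kron (e (neg_root a)) (e b)) i j k l - tensor_coeff m (kron (e b) (e (neg_root a))) i j k l"
      unfolding wedge_def by (intro tensor_coeff_add(2) kron_carrier e_carrier ab l)
    also have "\<dots> = e (neg_root a) $$ (i, j) * e b $$ (k, l) - e b $$ (i, j) * e (neg_root a) $$ (k, l)"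
      using tensor_coeff_kron[OF e_carrier(2)[OF ab(1)] e_carrier(1)[OF ab(2)] l]
        tensor_coeff_kron[OF e_carrier(1)[OF ab(2)] e_carrier(2)[OF ab(1)] l] by simp
    finally show "tensor_coeff m (case s of (a, k, b) \<Rightarrow> wedge (e (neg_root a)) (e b)) i j k l =
       (case s of (a, q, b) \<Rightarrow> e (neg_root a) $$ (i, j) * e b $$ (k, l) - e b $$ (i, j) * e (neg_root a) $$ (k, l))"
      unfolding abq by simp
  qed
  show ?thesis
    unfolding \<rho>_def \<rho>0_def unfolding r_eq chains_def[symmetric]
    by (subst tensor_coeff_add(1)[OF _ _ l]; (subst tensor_coeff_add(1)[OF r0_carrier _ l])?) (simp_all add: 1 2 r0_carrier)
qed

text \<open>The possible sources of a coefficient: the Cartan part, the standard part and the two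
  halves of a wedge.\<close>

lemma \<rho>_cases:
  assumes l: "i < m" "j < m" "k < m" "l < m" and ne: "\<rho> i j k l \<noteq> 0"
  obtains "i = j" "k = l"
  | a where "a \<in> PR" "e (neg_root a) $$ (i, j) \<noteq> 0" "e a $$ (k, l) \<noteq> 0"
  | a q b where "(a, q, b) \<in> chains" "e (neg_root a) $$ (i, j) \<noteq> 0" "e b $$ (k, l) \<noteq> 0"
  | a q b where "(a, q, b) \<in> chains" "e b $$ (i, j) \<noteq> 0" "e (neg_root a) $$ (k, l) \<noteq> 0"
proof -
  let ?f = "\<lambda>s. case s of (a, q, b) \<Rightarrow> e (neg_root a) $$ (i, j) * e b $$ (k, l) - e b $$ (i, j) * e (neg_root a) $$ (k, l)"
  consider "\<rho>0 i j k l \<noteq> 0" | "(\<Sum>a\<in>PR. e (neg_root a) $$ (i, j) * e a $$ (k, l)) \<noteq> 0" | "(\<Sum>s\<in>chains. ?f s) \<noteq> 0"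
    using ne unfolding \<rho>_eq[OF l] by fastforce
  thus thesis
  proof cases
    case 1
    hence "i = j \<and> k = l" using \<rho>0_diag[OF l] by blast
    thus thesis using that(1) by blast
  next
    case 2
    then obtain a where "a \<in> PR" "e (neg_root a) $$ (i, j) * e a $$ (k, l) \<noteq> 0"
      by (rule sum.not_neutral_contains_not_neutral)
    thus thesis using that(2)[of a] by simp
  next
    case 3
    then obtain s where s: "s \<in> chains" "?f s \<noteq> 0" by (rule sum.not_neutral_contains_not_neutral)
    obtain a q b where abq: "s = (a, q, b)" by (cases s)
    have "e (neg_root a) $$ (i, j) * e b $$ (k, l) \<noteq> 0 \<or> e b $$ (i, j) * e (neg_root a) $$ (k, l) \<noteq> 0"
      using s(2) unfolding abq by auto
    thus thesis using that(3)[of a q b] that(4)[of a q b] s(1) unfolding abq by fastforce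
  qed
qed

end

section \<open>Triangularity of the operators attached to the r-matrix\<close>

context bd_data begin

definition wt :: "nat \<Rightarrow> nat \<Rightarrow> int" where "wt i j = ht (rt i j)"

lemma wt_swap: "root_pair i j \<Longrightarrow> wt j i = - wt i j"
  unfolding wt_def rt_swap by (rule ht_neg)

text \<open>Every summand of r has its second leg in the Lie algebra. The mirror relation in this
  leg is what makes the operator of r take values in the Lie algebra.\<close>

lemma \<rho>_opp_snd:
  assumes l: "i < m" "j < m" "k < m" "l < m"
  shows "\<rho> i j (opp l) (opp k) = - (sg k * sg l * \<rho> i j k l)"
proof -
  have o: "opp l < m" "opp k < m" using l by auto
  obtain N :: nat and u v where v: "\<And>p. p < N \<Longrightarrow> v p \<in> cartan_subalg t n"
    and s: "\<And>i j k l. i < m \<Longrightarrow> j < m \<Longrightarrow> k < m \<Longrightarrow> l < m \<Longrightarrow> \<rho>0 i j k l = (\<Sum>p<N. u p $$ (i, j) * v p $$ (k, l))"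
    by (rule \<rho>0_sum) blast
  have 0: "\<rho>0 i j (opp l) (opp k) = - (sg k * sg l * \<rho>0 i j k l)"
    unfolding s[OF l(1,2) o] s[OF l] sum_distrib_left sum_negf[symmetric]
  proof (rule sum.cong[OF refl])
    fix p assume "p \<in> {..<N}"
    hence "v p \<in> classical_lie t n" using v by (simp add: cartan_subalg_def)
    from lie_opp[OF this l(3,4)] show "u p $$ (i, j) * v p $$ (opp l, opp k) = - (sg k * sg l * (u p $$ (i, j) * v p $$ (k, l)))"
      by (simp add: mult.left_commute)
  qed
  have 1: "(\<Sum>a\<in>PR. e (neg_root a) $$ (i, j) * e a $$ (opp l, opp k)) = - (sg k * sg l * (\<Sum>a\<in>PR. e (neg_root a) $$ (i, j) * e a $$ (k, l)))"
    unfolding sum_distrib_left sum_negf[symmetric]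
  proof (rule sum.cong[OF refl])
    fix a assume "a \<in> PR"
    from lie_opp[OF e_lie(1)[OF this] l(3,4)]
    show "e (neg_root a) $$ (i, j) * e a $$ (opp l, opp k) = - (sg k * sg l * (e (neg_root a) $$ (i, j) * e a $$ (k, l)))"
      by (simp add: mult.left_commute)
  qed
  let ?f = "\<lambda>k l s. case s of (a, q, b) \<Rightarrow> e (neg_root a) $$ (i, j) * e b $$ (k, l) - e b $$ (i, j) * e (neg_root a) $$ (k, l)"
  have 2: "(\<Sum>s\<in>chains. ?f (opp l) (opp k) s) = - (sg k * sg l * (\<Sum>s\<in>chains. ?f k l s))"
    unfolding sum_distrib_left sum_negf[symmetric]
  proof (rule sum.cong[OF refl])
    fix s assume s: "s \<in> chains"
    obtain a q b where abq: "s = (a, q, b)" by (cases s)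
    have ab: "a \<in> PR" "b \<in> PR" using chainsD s unfolding abq by blast+
    show "?f (opp l) (opp k) s = - (sg k * sg l * ?f k l s)"
      unfolding abq prod.case lie_opp[OF e_lie(1)[OF ab(2)] l(3,4)] lie_opp[OF e_lie(2)[OF ab(1)] l(3,4)]
      by (simp add: algebra_simps)
  qed
  show ?thesis unfolding \<rho>_eq[OF l(1,2) o] \<rho>_eq[OF l] 0 1 2 by (simp add: algebra_simps)
qed

lemma \<rho>_opp_fst:
  assumes l: "i < m" "j < m" "k < m" "l < m"
  shows "\<rho> (opp j) (opp i) k l = - (sg i * sg j * \<rho> i j k l)"
proof -
  have o: "opp j < m" "opp i < m" using l by auto
  obtain N :: nat and u v where u: "\<And>p. p < N \<Longrightarrow> u p \<in> cartan_subalg t n"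
    and s: "\<And>i j k l. i < m \<Longrightarrow> j < m \<Longrightarrow> k < m \<Longrightarrow> l < m \<Longrightarrow> \<rho>0 i j k l = (\<Sum>p<N. u p $$ (i, j) * v p $$ (k, l))"
    by (rule \<rho>0_sum) blast
  have 0: "\<rho>0 (opp j) (opp i) k l = - (sg i * sg j * \<rho>0 i j k l)"
    unfolding s[OF o l(3,4)] s[OF l] sum_distrib_left sum_negf[symmetric]
  proof (rule sum.cong[OF refl])
    fix p assume "p \<in> {..<N}"
    hence "u p \<in> classical_lie t n" using u by (simp add: cartan_subalg_def)
    from lie_opp[OF this l(1,2)] show "u p $$ (opp j, opp i) * v p $$ (k, l) = - (sg i * sg j * (u p $$ (i, j) * v p $$ (k, l)))"
      by (simp add: mult.assoc)
  qed
  have 1: "(\<Sum>a\<in>PR. e (neg_root a) $$ (opp j, opp i) * e a $$ (k, l)) = - (sg i * sg j * (\<Sum>a\<in>PR. e (neg_root a) $$ (i, j) * e a $$ (k, l)))"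
    unfolding sum_distrib_left sum_negf[symmetric]
  proof (rule sum.cong[OF refl])
    fix a assume "a \<in> PR"
    from lie_opp[OF e_lie(2)[OF this] l(1,2)]
    show "e (neg_root a) $$ (opp j, opp i) * e a $$ (k, l) = - (sg i * sg j * (e (neg_root a) $$ (i, j) * e a $$ (k, l)))"
      by (simp add: mult.assoc)
  qed
  let ?f = "\<lambda>i j s. case s of (a, q, b) \<Rightarrow> e (neg_root a) $$ (i, j) * e b $$ (k, l) - e b $$ (i, j) * e (neg_root a) $$ (k, l)"
  have 2: "(\<Sum>s\<in>chains. ?f (opp j) (opp i) s) = - (sg i * sg j * (\<Sum>s\<in>chains. ?f i j s))"
    unfolding sum_distrib_left sum_negf[symmetric]
  proof (rule sum.cong[OF refl])
    fix s assume s: "s \<in> chains"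
    obtain a q b where abq: "s = (a, q, b)" by (cases s)
    have ab: "a \<in> PR" "b \<in> PR" using chainsD s unfolding abq by blast+
    show "?f (opp j) (opp i) s = - (sg i * sg j * ?f i j s)"
      unfolding abq prod.case lie_opp[OF e_lie(1)[OF ab(2)] l(1,2)] lie_opp[OF e_lie(2)[OF ab(1)] l(1,2)]
      by (simp add: algebra_simps)
  qed
  show ?thesis unfolding \<rho>_eq[OF o l(3,4)] \<rho>_eq[OF l] 0 1 2 by (simp add: algebra_simps)
qed

definition \<rho>' :: "nat \<Rightarrow> nat \<Rightarrow> nat \<Rightarrow> nat \<Rightarrow> 'k" where "\<rho>' = (\<lambda>i j k l. \<rho> k l i j)"

lemma tensor_op_lie:
  assumes o: "\<And>i j k l. i < m \<Longrightarrow> j < m \<Longrightarrow> k < m \<Longrightarrow> l < m \<Longrightarrow> \<sigma> i j (opp l) (opp k) = - (sg k * sg l * \<sigma> i j k l)"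
  shows "tensor_op m \<sigma> x \<in> classical_lie t n"
  unfolding lie_iff
proof (intro conjI allI impI)
  fix k l assume kl: "k < m" "l < m"
  hence ol: "opp l < m" "opp k < m" by auto
  show "tensor_op m \<sigma> x $$ (opp l, opp k) = - (sg k * sg l * tensor_op m \<sigma> x $$ (k, l))"
    unfolding tensor_op_index[OF ol] tensor_op_index[OF kl] sum_distrib_left sum_negf[symmetric]
  proof (rule sum.cong[OF refl])
    fix s assume s: "s \<in> {..<m} \<times> {..<m}"
    obtain i j where ij: "s = (i, j)" by (cases s)
    have l: "i < m" "j < m" using s unfolding ij by auto
    show "(case s of (i, j) \<Rightarrow> \<sigma> i j (opp l) (opp k) * x $$ (j, i)) = - (sg k * sg l * (case s of (i, j) \<Rightarrow> \<sigma> i j k l * x $$ (j, i)))"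
      unfolding ij prod.case o[OF l kl] by (simp add: mult.assoc)
  qed
qed simp

text \<open>The two terms of \<open>rvec l k\<close> pick the entry (k, l) and its mirror entry, and
  by the signs in the mirror relation both contribute the same.\<close>

lemma trace_rvec:
  assumes x: "x \<in> classical_lie t n" and kl: "k < m" "l < m"
  shows "(\<Sum>(i, j)\<in>{..<m} \<times> {..<m}. rvec l k $$ (i, j) * x $$ (j, i)) = 2 * x $$ (k, l)"
proof -
  have o: "opp k < m" "opp l < m" using kl by auto
  have "(\<Sum>(i, j)\<in>{..<m} \<times> {..<m}. rvec l k $$ (i, j) * x $$ (j, i)) =
    (\<Sum>s\<in>{..<m} \<times> {..<m}. (if s = (l, k) then x $$ (k, l) else 0) - (if s = (opp k, opp l) then sg l * sg k * x $$ (opp l, opp k) else 0))"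
  proof (rule sum.cong[OF refl])
    fix s assume s: "s \<in> {..<m} \<times> {..<m}"
    obtain i j where ij: "s = (i, j)" by (cases s)
    have lt: "i < m" "j < m" using s unfolding ij by auto
    show "(case s of (i, j) \<Rightarrow> rvec l k $$ (i, j) * x $$ (j, i)) = (if s = (l, k) then x $$ (k, l) else 0) - (if s = (opp k, opp l) then sg l * sg k * x $$ (opp l, opp k) else 0)"
      unfolding ij prod.case rvec_index[OF lt] prod.inject left_diff_distrib if_distrib[of "\<lambda>c. c * _"]
      by (rule arg_cong2[of _ _ _ _ "(-)"]; rule if_cong; simp)
  qed
  also have "\<dots> = x $$ (k, l) - sg l * sg k * x $$ (opp l, opp k)"
    unfolding sum_subtractf using kl o by simp
  also have "\<dots> = x $$ (k, l) - sg l * sg k * (- (sg k * sg l * x $$ (k, l)))" unfolding lie_opp[OF x kl] ..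
  also have "\<dots> = 2 * x $$ (k, l)" by (simp add: mult.assoc)
  finally show ?thesis .
qed

text \<open>Opposite root spaces are in duality under the trace form, and the factor 2 is
  invertible.\<close>

lemma trace_root_vector:
  assumes x: "x \<in> classical_lie t n" and y: "y \<in> root_space t n (rt l k)" "y \<noteq> 0\<^sub>m m m" and lk: "root_pair l k"
    and tr: "(\<Sum>(i, j)\<in>{..<m} \<times> {..<m}. y $$ (i, j) * x $$ (j, i)) = 0"
  shows "x $$ (k, l) = (0 :: 'k)"
proof -
  have l: "l < m" "k < m" using lk by (auto simp: root_pair_def)
  define \<eta> where "\<eta> = y $$ (l, k) / rvec l k $$ (l, k)"
  have ye: "y = \<eta> \<cdot>\<^sub>m rvec l k" unfolding \<eta>_def by (rule root_space_multiple[OF y(1) lk])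
  have \<eta>: "\<eta> \<noteq> 0" using root_multiple(1)[OF lk y(1) y] rvec_nonzero[OF lk] by (simp add: \<eta>_def)
  have rc: "rvec l k \<in> carrier_mat m m" by (simp add: rvec_def)
  have "(\<Sum>(i, j)\<in>{..<m} \<times> {..<m}. y $$ (i, j) * x $$ (j, i)) = (\<Sum>(i, j)\<in>{..<m} \<times> {..<m}. \<eta> * (rvec l k $$ (i, j) * x $$ (j, i)))"
    by (rule sum.cong[OF refl]) (use rc in \<open>auto simp: ye mult.assoc\<close>)
  also have "\<dots> = \<eta> * (2 * x $$ (k, l))"
    unfolding trace_rvec[OF x l(2,1), symmetric] sum_distrib_left by (simp add: case_prod_unfold)
  finally show ?thesis using tr \<eta> by simp
qed

text \<open>The standard part and the first half of each wedge have a negative root in the first leg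
  and a positive one in the second. The other half contracts the root vector of b and returns that
  of -a, hence maps weight -b to weight -a; as a has smaller height than b, the weight
  rises.\<close>

lemma \<rho>_order:
  assumes l: "i < m" "j < m" "k < m" "l < m" and ne: "\<rho> i j k l \<noteq> 0"
  shows "i = j \<and> k = l \<or> j < i \<and> k < l \<or> i < j \<and> l < k \<and> wt j i < wt k l"
  using l ne
proof (rule \<rho>_cases)
  fix a assume "a \<in> PR" "e (neg_root a) $$ (i, j) \<noteq> 0" "e a $$ (k, l) \<noteq> 0"
  thus ?thesis using e_neg_index(3) e_pos_index(3) l by blast
next
  fix a q b assume "(a, q, b) \<in> chains" "e (neg_root a) $$ (i, j) \<noteq> 0" "e b $$ (k, l) \<noteq> 0"
  thus ?thesis using e_neg_index(3) e_pos_index(3) l chainsD by blast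
next
  fix a q b assume c: "(a, q, b) \<in> chains" and b: "e b $$ (i, j) \<noteq> 0" and a: "e (neg_root a) $$ (k, l) \<noteq> 0"
  note d = chainsD[OF c]
  note bi = e_pos_index[OF d(2) l(1,2) b] and ai = e_neg_index[OF d(1) l(3,4) a]
  have "wt i j = ht b" "wt l k = ht a" unfolding wt_def bi(2)[symmetric] ai(2)[symmetric] by (rule refl)+
  hence "wt j i < wt k l" using d(3) wt_swap[OF bi(1)] wt_swap[OF ai(1)] by simp
  thus ?thesis using bi(3) ai(3) by blast
qed simp

text \<open>At the position of a positive root a the standard part contributes tr(e_-a x) e_a. The
  wedge terms that end at a start at roots of smaller height, where x vanishes by assumption, and
  the Cartan part does not reach positions off the diagonal.\<close>

lemma \<rho>_lead:
  assumes x: "x \<in> classical_lie t n" and kl: "k < m" "l < m" "k < l"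
    and low: "\<And>i j. i < m \<Longrightarrow> j < m \<Longrightarrow> j < i \<Longrightarrow> wt j i < wt k l \<Longrightarrow> x $$ (j, i) = 0"
    and z: "tensor_op m \<rho> x $$ (k, l) = 0"
  shows "x $$ (k, l) = 0"
proof (cases "root_pair k l")
  case False
  hence "l = opp k" "\<not> isC" using kl by (auto simp: root_pair_def)
  thus ?thesis using lie_antidiag[OF x _ kl(1)] by blast
next
  case rp: True
  let ?P = "{..<m} \<times> {..<m}" and ?a = "rt k l"
  have aP: "?a \<in> PR" using pos_roots_iff rp kl(3) by blast
  have val: "\<rho> i j k l * x $$ (j, i) = e (neg_root ?a) $$ (i, j) * x $$ (j, i) * e ?a $$ (k, l)" if ij: "i < m" "j < m" for i j
  proof -
    have 0: "\<rho>0 i j k l = 0" using \<rho>0_diag[OF ij kl(1,2)] kl(3) by simp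
    have 1: "(\<Sum>a\<in>PR. e (neg_root a) $$ (i, j) * e a $$ (k, l)) = e (neg_root ?a) $$ (i, j) * e ?a $$ (k, l)"
    proof -
      have "e (neg_root a) $$ (i, j) * e a $$ (k, l) = (if a = ?a then e (neg_root ?a) $$ (i, j) * e ?a $$ (k, l) else 0)" if "a \<in> PR" for a
        using e_pos_index(2)[OF that kl(1,2)] by (cases "a = ?a") auto
      hence "(\<Sum>a\<in>PR. e (neg_root a) $$ (i, j) * e a $$ (k, l)) = (\<Sum>a\<in>PR. if a = ?a then e (neg_root ?a) $$ (i, j) * e ?a $$ (k, l) else 0)"
        by (intro sum.cong refl)
      thus ?thesis using aP finite_pos_roots by simp
    qed
    have 2: "(\<Sum>(a, q, b)\<in>chains. e (neg_root a) $$ (i, j) * e b $$ (k, l) - e b $$ (i, j) * e (neg_root a) $$ (k, l)) * x $$ (j, i) = 0"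
      unfolding sum_distrib_right
    proof (rule sum.neutral, rule ballI)
      fix s assume s: "s \<in> chains"
      obtain a q b where abq: "s = (a, q, b)" by (cases s)
      note d = chainsD[OF s[unfolded abq]]
      have t2: "e (neg_root a) $$ (k, l) = 0" using e_neg_index(3)[OF d(1) kl(1,2)] kl(3) by fastforce
      have t1: "e (neg_root a) $$ (i, j) * e b $$ (k, l) * x $$ (j, i) = 0"
      proof (rule ccontr)
        assume "e (neg_root a) $$ (i, j) * e b $$ (k, l) * x $$ (j, i) \<noteq> 0"
        hence h: "e (neg_root a) $$ (i, j) \<noteq> 0" "e b $$ (k, l) \<noteq> 0" "x $$ (j, i) \<noteq> 0" by auto
        note ai = e_neg_index[OF d(1) ij h(1)] and bi = e_pos_index[OF d(2) kl(1,2) h(2)]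
        have "wt j i < wt k l" using d(3) unfolding wt_def ai(2)[symmetric] bi(2)[symmetric] .
        thus False using low[OF ij ai(3)] h(3) by blast
      qed
      show "(case s of (a, q, b) \<Rightarrow> e (neg_root a) $$ (i, j) * e b $$ (k, l) - e b $$ (i, j) * e (neg_root a) $$ (k, l)) * x $$ (j, i) = 0"
        unfolding abq prod.case t2 using t1 by simp
    qed
    show ?thesis unfolding \<rho>_eq[OF ij kl(1,2)] 0 1 distrib_right 2 by (simp add: mult_ac)
  qed
  have "tensor_op m \<rho> x $$ (k, l) = (\<Sum>(i, j)\<in>?P. e (neg_root ?a) $$ (i, j) * x $$ (j, i) * e ?a $$ (k, l))"
    unfolding tensor_op_index[OF kl(1,2)] by (rule sum.cong[OF refl]) (auto simp: val)
  also have "\<dots> = (\<Sum>(i, j)\<in>?P. e (neg_root ?a) $$ (i, j) * x $$ (j, i)) * e ?a $$ (k, l)"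
    by (simp add: sum_distrib_right case_prod_unfold)
  finally have pr: "(\<Sum>(i, j)\<in>?P. e (neg_root ?a) $$ (i, j) * x $$ (j, i)) * e ?a $$ (k, l) = 0" using z by simp
  have aR: "?a \<in> roots K t n" by (rule PR_roots[OF aP])
  have "e ?a $$ (k, l) \<noteq> 0" by (rule root_multiple(1)[OF rp e_space[OF aR] e_space[OF aR] e_nonzero[OF aR]])
  hence tr: "(\<Sum>(i, j)\<in>?P. e (neg_root ?a) $$ (i, j) * x $$ (j, i)) = 0" using pr by simp
  have "e (neg_root ?a) \<in> root_space t n (rt l k)"
    unfolding rt_swap[OF rp] by (rule e_space[OF neg_root_in[OF aR]])
  from trace_root_vector[OF x this e_nonzero[OF neg_root_in[OF aR]] root_pair_sym[OF rp] tr] show ?thesis .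
qed

text \<open>The counterpart for the other tensor factor and negative roots. Passing to negatives
  reverses the growth of height along \<tau>, and this compensates the exchange of the legs:
  interfering terms again have smaller weight.\<close>

lemma \<rho>'_lead:
  assumes x: "x \<in> classical_lie t n" and kl: "k < m" "l < m" "l < k"
    and low: "\<And>i j. i < m \<Longrightarrow> j < m \<Longrightarrow> i < j \<Longrightarrow> wt j i < wt k l \<Longrightarrow> x $$ (j, i) = 0"
    and z: "tensor_op m \<rho>' x $$ (k, l) = 0"
  shows "x $$ (k, l) = 0"
proof (cases "root_pair k l")
  case False
  hence "l = opp k" "\<not> isC" using kl by (auto simp: root_pair_def)
  thus ?thesis using lie_antidiag[OF x _ kl(1)] by blast
next
  case rp: True
  note rp' = root_pair_sym[OF rp]
  let ?P = "{..<m} \<times> {..<m}" and ?a = "rt l k"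
  have aP: "?a \<in> PR" using pos_roots_iff rp' kl(3) by blast
  have val: "\<rho>' i j k l * x $$ (j, i) = e ?a $$ (i, j) * x $$ (j, i) * e (neg_root ?a) $$ (k, l)" if ij: "i < m" "j < m" for i j
  proof -
    have 0: "\<rho>0 k l i j = 0" using \<rho>0_diag[OF kl(1,2) ij] kl(3) by simp
    have 1: "(\<Sum>a\<in>PR. e (neg_root a) $$ (k, l) * e a $$ (i, j)) = e (neg_root ?a) $$ (k, l) * e ?a $$ (i, j)"
    proof -
      have "e (neg_root a) $$ (k, l) * e a $$ (i, j) = (if a = ?a then e (neg_root ?a) $$ (k, l) * e ?a $$ (i, j) else 0)" if "a \<in> PR" for a
        using e_neg_index(2)[OF that kl(1,2)] by (cases "a = ?a") auto
      hence "(\<Sum>a\<in>PR. e (neg_root a) $$ (k, l) * e a $$ (i, j)) = (\<Sum>a\<in>PR. if a = ?a then e (neg_root ?a) $$ (k, l) * e ?a $$ (i, j) else 0)"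
        by (intro sum.cong refl)
      thus ?thesis using aP finite_pos_roots by simp
    qed
    have 2: "(\<Sum>(a, q, b)\<in>chains. e (neg_root a) $$ (k, l) * e b $$ (i, j) - e b $$ (k, l) * e (neg_root a) $$ (i, j)) * x $$ (j, i) = 0"
      unfolding sum_distrib_right
    proof (rule sum.neutral, rule ballI)
      fix s assume s: "s \<in> chains"
      obtain a q b where abq: "s = (a, q, b)" by (cases s)
      note d = chainsD[OF s[unfolded abq]]
      have t2: "e b $$ (k, l) = 0" using e_pos_index(3)[OF d(2) kl(1,2)] kl(3) by fastforce
      have t1: "e (neg_root a) $$ (k, l) * e b $$ (i, j) * x $$ (j, i) = 0"
      proof (rule ccontr)
        assume "e (neg_root a) $$ (k, l) * e b $$ (i, j) * x $$ (j, i) \<noteq> 0"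
        hence h: "e (neg_root a) $$ (k, l) \<noteq> 0" "e b $$ (i, j) \<noteq> 0" "x $$ (j, i) \<noteq> 0" by auto
        note ai = e_neg_index[OF d(1) kl(1,2) h(1)] and bi = e_pos_index[OF d(2) ij h(2)]
        have "wt l k < wt i j" using d(3) unfolding wt_def ai(2)[symmetric] bi(2)[symmetric] .
        hence "wt j i < wt k l" using wt_swap[OF ai(1)] wt_swap[OF bi(1)] by simp
        thus False using low[OF ij bi(3)] h(3) by blast
      qed
      show "(case s of (a, q, b) \<Rightarrow> e (neg_root a) $$ (k, l) * e b $$ (i, j) - e b $$ (k, l) * e (neg_root a) $$ (i, j)) * x $$ (j, i) = 0"
        unfolding abq prod.case t2 using t1 by simp
    qed
    show ?thesis unfolding \<rho>'_def \<rho>_eq[OF kl(1,2) ij] 0 1 distrib_right 2 by (simp add: mult_ac)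
  qed
  have "tensor_op m \<rho>' x $$ (k, l) = (\<Sum>(i, j)\<in>?P. e ?a $$ (i, j) * x $$ (j, i) * e (neg_root ?a) $$ (k, l))"
    unfolding tensor_op_index[OF kl(1,2)] by (rule sum.cong[OF refl]) (auto simp: val)
  also have "\<dots> = (\<Sum>(i, j)\<in>?P. e ?a $$ (i, j) * x $$ (j, i)) * e (neg_root ?a) $$ (k, l)"
    by (simp add: sum_distrib_right case_prod_unfold)
  finally have pr: "(\<Sum>(i, j)\<in>?P. e ?a $$ (i, j) * x $$ (j, i)) * e (neg_root ?a) $$ (k, l) = 0" using z by simp
  have aR: "?a \<in> roots K t n" "neg_root ?a \<in> roots K t n" using PR_roots[OF aP] neg_root_in by blast+
  have "e (neg_root ?a) \<in> root_space t n (rt k l)"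
    unfolding rt_swap[OF rp'] by (rule e_space[OF aR(2)])
  hence "e (neg_root ?a) $$ (k, l) \<noteq> 0" using root_multiple(1)[OF rp _ _ e_nonzero[OF aR(2)]] by blast
  hence tr: "(\<Sum>(i, j)\<in>?P. e ?a $$ (i, j) * x $$ (j, i)) = 0" using pr by simp
  from trace_root_vector[OF x e_space[OF aR(1)] e_nonzero[OF aR(1)] rp' tr] show ?thesis .
qed

subsection \<open>The centralizer\<close>

lemma r_carrier: "r \<in> carrier_mat (m * m) (m * m)"
  unfolding r_eq using r0_carrier by simp

lemma centralizer_coeffs:
  assumes "Q \<in> classical_group t n"
  shows "Q \<in> bd_centralizer t n r \<longleftrightarrow> invariant_coeffs m \<rho> Q (mat_inv Q)"
proof -
  note c = tensor_coeff_Ad[OF group_carrier[OF assms] group_inv(1)[OF assms]]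
  have tc: "tensor_map m (Ad Q) (Ad Q) r \<in> carrier_mat (m * m) (m * m)" by (simp add: tensor_map_def)
  have "tensor_map m (Ad Q) (Ad Q) r = r \<longleftrightarrow> (\<forall>i<m. \<forall>j<m. \<forall>k<m. \<forall>l<m.
     tensor_coeff m r i j k l = tensor_coeff m (tensor_map m (Ad Q) (Ad Q) r) i j k l)"
    using tensor_eqI[OF tc r_carrier] by metis
  also have "\<dots> \<longleftrightarrow> invariant_coeffs m \<rho> Q (mat_inv Q)"
    unfolding invariant_coeffs_def \<rho>_def by (simp add: c)
  finally show ?thesis using assms by (simp add: bd_centralizer_def)
qed

text \<open>The flipped tensor controls the upper nilpotent subalgebra, the tensor itself the lower
  one. Together they clear all entries off the diagonal except in the middle block of type
  D.\<close>

lemma centralizer_diagonal: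
  assumes Q: "Q \<in> bd_centralizer t n r"
  shows "diagonal_mat Q"
proof -
  have G: "Q \<in> classical_group t n" using Q by (simp add: bd_centralizer_def)
  let ?Y = "mat_inv Q"
  note Qc = group_carrier[OF G] and Y = group_inv[OF G]
  have ic: "invariant_coeffs m \<rho> Q ?Y" using Q centralizer_coeffs[OF G] by blast
  have ic': "invariant_coeffs m \<rho>' Q ?Y" unfolding \<rho>'_def by (rule invariant_coeffs_flip[OF ic])
  have tl: "tensor_op m \<rho> x \<in> classical_lie t n" "tensor_op m \<rho>' x \<in> classical_lie t n" for x
    by (rule tensor_op_lie, erule (3) \<rho>_opp_snd) (rule tensor_op_lie, unfold \<rho>'_def, rule \<rho>_opp_fst)
  have s1: "i = j \<or> j < i \<or> i < j \<and> l < k \<and> wt j i < wt k l"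
    if "i < m" "j < m" "k < m" "l < m" "\<rho> i j k l \<noteq> 0" for i j k l
    using \<rho>_order[OF that] by blast
  have s2: "i = j \<or> i < j \<or> j < i \<and> k < l \<and> wt j i < wt k l"
    if h: "i < m" "j < m" "k < m" "l < m" "\<rho>' i j k l \<noteq> 0" for i j k l
  proof (rule \<rho>_cases[OF h(3,4,1,2) h(5)[unfolded \<rho>'_def]])
    fix a q b assume c: "(a, q, b) \<in> chains" and b: "e b $$ (k, l) \<noteq> 0" and a: "e (neg_root a) $$ (i, j) \<noteq> 0"
    note d = chainsD[OF c]
    note bi = e_pos_index[OF d(2) h(3,4) b] and ai = e_neg_index[OF d(1) h(1,2) a]
    have "wt j i < wt k l" using d(3) unfolding wt_def ai(2)[symmetric] bi(2)[symmetric] .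
    thus ?thesis using ai(3) bi(3) by blast
  next
    fix a assume "a \<in> PR" "e (neg_root a) $$ (k, l) \<noteq> 0" "e a $$ (i, j) \<noteq> 0"
    thus ?thesis using e_pos_index(3) h by blast
  next
    fix a q b assume c: "(a, q, b) \<in> chains" and "e (neg_root a) $$ (k, l) \<noteq> 0" and b: "e b $$ (i, j) \<noteq> 0"
    thus ?thesis using e_pos_index(3)[OF chainsD(2)[OF c] h(1,2) b] by blast
  qed blast
  have conj: "\<exists>y' \<in> classical_lie t n. y' = Q * y * ?Y \<and> Q * y = y' * Q" if y: "y \<in> classical_lie t n" for y
  proof -
    have "Q * y * ?Y * Q = Q * y * (?Y * Q)" by (rule assoc_mult_mat[OF mult_carrier_mat[OF Qc lie_carrier[OF y]] Y(1) Qc])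
    also have "\<dots> = Q * y" unfolding Y(3) by (rule right_mult_one_mat[OF mult_carrier_mat[OF Qc lie_carrier[OF y]]])
    finally show ?thesis using group_conj_lie[OF G y] by metis
  qed
  have off: "isD \<and> (p = n \<and> q = n - 1 \<or> p = n - 1 \<and> q = n)" if pq: "p < m" "q < m" "p \<noteq> q" "Q $$ (p, q) \<noteq> 0" for p q
  proof (cases "q < p")
    case True
    have "isD \<and> p = n \<and> q = n - 1"
    proof (rule conj_upper_triangular[OF Qc _ pq(1,2) True pq(4)])
      fix y :: "'k mat" assume y: "y \<in> classical_lie t n" and u: "\<forall>i<m. \<forall>j<m. y $$ (i, j) \<noteq> 0 \<longrightarrow> i < j"
      from conj[OF y] obtain y' where y': "y' \<in> classical_lie t n" "y' = Q * y * ?Y" "Q * y = y' * Q" by blast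
      have "i < j" if ij: "i < m" "j < m" "y' $$ (i, j) \<noteq> 0" for i j
      proof (rule invariant_tensor_preserves_triangular[where abv = "\<lambda>i j. j < i" and V = "classical_lie t n" and wt = wt
            and \<rho> = \<rho>' and Q = Q and Y = ?Y and z = y and m = m and i = i and j = j])
        show "\<And>i j. i < m \<Longrightarrow> j < m \<Longrightarrow> y $$ (i, j) \<noteq> 0 \<Longrightarrow> i < j" using u by blast
        show "\<And>x k l. x \<in> classical_lie t n \<Longrightarrow> k < m \<Longrightarrow> l < m \<Longrightarrow> l < k \<Longrightarrow>
          (\<And>i j. i < m \<Longrightarrow> j < m \<Longrightarrow> i < j \<Longrightarrow> wt j i < wt k l \<Longrightarrow> x $$ (j, i) = 0) \<Longrightarrow>
          tensor_op m \<rho>' x $$ (k, l) = 0 \<Longrightarrow> x $$ (k, l) = 0" by (rule \<rho>'_lead)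
        show "Q * y * ?Y \<in> classical_lie t n" "(Q * y * ?Y) $$ (i, j) \<noteq> 0" using y'(1) ij(3) unfolding y'(2) .
        show "\<And>i j k l. i < m \<Longrightarrow> j < m \<Longrightarrow> k < m \<Longrightarrow> l < m \<Longrightarrow> \<rho>' i j k l \<noteq> 0 \<Longrightarrow>
          i = j \<or> i < j \<or> j < i \<and> k < l \<and> wt j i < wt k l" by (rule s2)
      qed (use tl ic' Qc Y y ij lie_carrier in auto)
      thus "\<exists>y' \<in> classical_lie t n. (\<forall>i<m. \<forall>j<m. y' $$ (i, j) \<noteq> 0 \<longrightarrow> i < j) \<and> Q * y = y' * Q"
        using y'(1,3) by blast
    qed
    thus ?thesis by blast
  next
    case False
    hence lt: "p < q" using pq(3) by simp
    have "isD \<and> p = n - 1 \<and> q = n"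
    proof (rule conj_lower_triangular[OF Qc _ pq(1,2) lt pq(4)])
      fix y :: "'k mat" assume y: "y \<in> classical_lie t n" and u: "\<forall>i<m. \<forall>j<m. y $$ (i, j) \<noteq> 0 \<longrightarrow> j < i"
      from conj[OF y] obtain y' where y': "y' \<in> classical_lie t n" "y' = Q * y * ?Y" "Q * y = y' * Q" by blast
      have "j < i" if ij: "i < m" "j < m" "y' $$ (i, j) \<noteq> 0" for i j
      proof (rule invariant_tensor_preserves_triangular[where abv = "(<)" and V = "classical_lie t n" and wt = wt
            and \<rho> = \<rho> and Q = Q and Y = ?Y and z = y and m = m and i = i and j = j])
        show "\<And>i j. i < m \<Longrightarrow> j < m \<Longrightarrow> y $$ (i, j) \<noteq> 0 \<Longrightarrow> j < i" using u by blast
        show "\<And>x k l. x \<in> classical_lie t n \<Longrightarrow> k < m \<Longrightarrow> l < m \<Longrightarrow> k < l \<Longrightarrow>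
          (\<And>i j. i < m \<Longrightarrow> j < m \<Longrightarrow> j < i \<Longrightarrow> wt j i < wt k l \<Longrightarrow> x $$ (j, i) = 0) \<Longrightarrow>
          tensor_op m \<rho> x $$ (k, l) = 0 \<Longrightarrow> x $$ (k, l) = 0" by (rule \<rho>_lead)
        show "Q * y * ?Y \<in> classical_lie t n" "(Q * y * ?Y) $$ (i, j) \<noteq> 0" using y'(1) ij(3) unfolding y'(2) .
        show "\<And>i j k l. i < m \<Longrightarrow> j < m \<Longrightarrow> k < m \<Longrightarrow> l < m \<Longrightarrow> \<rho> i j k l \<noteq> 0 \<Longrightarrow>
          i = j \<or> j < i \<or> i < j \<and> l < k \<and> wt j i < wt k l" by (rule s1)
      qed (use tl ic Qc Y y ij lie_carrier in auto)
      thus "\<exists>y' \<in> classical_lie t n. (\<forall>i<m. \<forall>j<m. y' $$ (i, j) \<noteq> 0 \<longrightarrow> j < i) \<and> Q * y = y' * Q"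
        using y'(1,3) by blast
    qed
    thus ?thesis by blast
  qed
  show ?thesis by (rule group_block_diagonal[OF G off])
qed

end

section \<open>The diagonal torus\<close>

context classical_type begin

text \<open>The value at \<open>D\<close> of the simple character of index k.\<close>

definition sc :: "'k mat \<Rightarrow> nat \<Rightarrow> 'k" where
  "sc D k = D $$ (simple_row k, simple_row k) / D $$ (k, k)"

text \<open>For diagonal matrices the form condition makes opposite entries inverse to each other;
  the determinant is then the middle entry in type B and 1 otherwise.\<close>

lemma torus_iff:
  assumes Dc: "(D :: 'k mat) \<in> carrier_mat m m" and diag: "diagonal_mat D"
  shows "D \<in> classical_group t n \<longleftrightarrow> (\<forall>i<m. D $$ (i, i) * D $$ (opp i, opp i) = 1) \<and> (isB \<longrightarrow> D $$ (n, n) = 1)"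
proof -
  have off: "D $$ (i, j) = 0" if "i < m" "j < m" "i \<noteq> j" for i j
    using diag Dc that unfolding diagonal_mat_def by auto
  have s: "(\<Sum>k<m. sg k * D $$ (i, k) * D $$ (j, opp k)) = sg i * (D $$ (i, i) * D $$ (j, opp i))" if i: "i < m" for i j
  proof -
    have "(\<Sum>k<m. sg k * D $$ (i, k) * D $$ (j, opp k)) = (\<Sum>k<m. if k = i then sg i * (D $$ (i, i) * D $$ (j, opp i)) else 0)"
      by (rule sum.cong[OF refl]) (use off[OF i] in auto)
    thus ?thesis using i by simp
  qed
  have form: "D * form_mat t n * transpose_mat D = form_mat t n \<longleftrightarrow> (\<forall>i<m. D $$ (i, i) * D $$ (opp i, opp i) = 1)"
    unfolding group_iff[OF Dc]
  proof (intro iffI allI impI)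
    fix i assume h: "\<forall>i<m. \<forall>j<m. (\<Sum>k<m. sg k * D $$ (i, k) * D $$ (j, opp k)) = (if j = opp i then sg i else 0)" and i: "i < m"
    from h[rule_format, OF i opp_less[OF i]] show "D $$ (i, i) * D $$ (opp i, opp i) = 1" unfolding s[OF i] by simp
  next
    fix i j assume h: "\<forall>i<m. D $$ (i, i) * D $$ (opp i, opp i) = 1" and ij: "i < m" "j < m"
    show "(\<Sum>k<m. sg k * D $$ (i, k) * D $$ (j, opp k)) = (if j = opp i then sg i else 0)"
    proof (cases "j = opp i")
      case True
      show ?thesis unfolding s[OF ij(1)] True using h[rule_format, OF ij(1)] by simp
    next
      case False
      show ?thesis unfolding s[OF ij(1)] off[OF ij(2) opp_less[OF ij(1)] False] if_not_P[OF False] by simp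
    qed
  qed
  have det: "det D = (if isB then D $$ (n, n) else 1)" if "\<forall>i<m. D $$ (i, i) * D $$ (opp i, opp i) = 1"
  proof -
    have "det D = (\<Prod>i<m. D $$ (i, i))" by (rule det_triangular[OF Dc, of "(<)"]) (use off in auto)
    also have "\<dots> = (if isB then D $$ (n, n) else 1)" by (rule prod_opp) (use that in blast)
    finally show ?thesis .
  qed
  show ?thesis unfolding classical_group_def mem_Collect_eq form using Dc det by (auto split: if_splits)
qed

lemma torus_mult:
  assumes "D \<in> classical_group t n" "diagonal_mat (D :: 'k mat)" "i < m"
  shows "D $$ (i, i) * D $$ (opp i, opp i) = 1" "D $$ (i, i) \<noteq> 0"
proof -
  show 1: "D $$ (i, i) * D $$ (opp i, opp i) = 1"
    using assms torus_iff[OF group_carrier[OF assms(1)] assms(2)] by blast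
  show "D $$ (i, i) \<noteq> 0" using 1 by auto
qed

definition dmat :: "(nat \<Rightarrow> 'k) \<Rightarrow> 'k mat" where
  "dmat d = mat m m (\<lambda>(i, j). if i = j then d i else 0)"

lemma dmat [simp]: "dmat d \<in> carrier_mat m m" "diagonal_mat (dmat d)" "i < m \<Longrightarrow> dmat d $$ (i, i) = d i"
  by (auto simp: dmat_def diagonal_mat_def)

lemma dmat_index: "i < m \<Longrightarrow> j < m \<Longrightarrow> dmat d $$ (i, j) = (if i = j then d i else 0)"
  by (simp add: dmat_def)

lemma dmat_group: "dmat d \<in> classical_group t n \<longleftrightarrow> (\<forall>i<m. d i * d (opp i) = 1) \<and> (isB \<longrightarrow> d n = 1)"
proof -
  have "isB \<Longrightarrow> n < m" using m_B by simp
  thus ?thesis unfolding torus_iff[OF dmat(1,2)] by auto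
qed

lemma diag_dmat:
  assumes "(D :: 'k mat) \<in> carrier_mat m m" "diagonal_mat D"
  shows "D = dmat (\<lambda>i. D $$ (i, i))"
  by (rule eq_matI) (use assms in \<open>auto simp: dmat_def diagonal_mat_def\<close>)

lemma mult_dmat_index:
  assumes "x \<in> carrier_mat m m" "i < m" "j < m"
  shows "(x * dmat d) $$ (i, j) = x $$ (i, j) * (d j :: 'k)"
  using mat_mult_diag_right[OF dmat(1) assms(1) dmat(2) assms(2,3), of d] assms by simp

lemma dmat_mult: "dmat c * dmat d = dmat (\<lambda>i. c i * d i)"
proof (rule eq_matI)
  fix i j assume "i < dim_row (dmat (\<lambda>i. c i * d i))" "j < dim_col (dmat (\<lambda>i. c i * d i))"
  hence l: "i < m" "j < m" by (simp_all add: dmat_def)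
  show "(dmat c * dmat d) $$ (i, j) = dmat (\<lambda>i. c i * d i) $$ (i, j)"
    unfolding mult_dmat_index[OF dmat(1) l] dmat_index[OF l] by simp
qed (simp_all add: dmat_def)

lemma dmat_inv:
  assumes "\<And>i. i < m \<Longrightarrow> d i \<noteq> 0"
  shows "mat_inv (dmat d) = dmat (\<lambda>i. inverse (d i))"
proof (rule mat_inv_unique[OF dmat(1) dmat(1)])
  show "dmat d * dmat (\<lambda>i. inverse (d i)) = 1\<^sub>m m"
    unfolding dmat_mult by (rule eq_matI) (use assms in \<open>auto simp: dmat_def\<close>)
qed

lemma simple_row_less: "k \<in> {1..n} \<Longrightarrow> simple_row k < m" "k \<in> {1..n} \<Longrightarrow> k < m"
  using simple_pair(1)[of k] by (auto simp: root_pair_def)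

lemma sc_dmat: "k \<in> {1..n} \<Longrightarrow> sc (dmat d) k = d (simple_row k) / d k"
  by (simp add: sc_def simple_row_less)

text \<open>Both sides are multiplicative when positions are joined and invariant under reflection,
  so the induction over positions reduces the formula to simple roots.\<close>

lemma torus_character:
  assumes D: "D \<in> classical_group t n" "diagonal_mat (D :: 'k mat)" and "root_pair i j" "i < j"
  shows "D $$ (i, i) / D $$ (j, j) = (\<Prod>k\<in>{1..n}. sc D k powi rt i j k)"
  using assms(3,4)
proof (induction rule: pos_pair_induct)
  case (simple k)
  have "(\<Prod>l\<in>{1..n}. sc D l powi simple_root k l) = (\<Prod>l\<in>{1..n}. if l = k then sc D k else 1)"
    by (rule prod.cong[OF refl]) (simp add: simple_root_def)
  thus ?case unfolding rt_simple[OF simple] using simple by (simp add: sc_def)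
next
  case (opp i j)
  hence l: "i < m" "j < m" by (auto simp: root_pair_def)
  have "D $$ (opp i, opp i) = inverse (D $$ (i, i))" "D $$ (opp j, opp j) = inverse (D $$ (j, j))"
    using torus_mult(1)[OF D l(1)] torus_mult(1)[OF D l(2)] by (simp_all add: inverse_unique)
  thus ?case using opp(3) unfolding rt_opp[OF opp(1)] by (simp add: field_simps)
next
  case (add i p j)
  hence l: "i < m" "p < m" "j < m" by (auto simp: root_pair_def)
  have nz: "sc D k \<noteq> 0" if "k \<in> {1..n}" for k
    using torus_mult(2)[OF D] simple_row_less[OF that] by (simp add: sc_def)
  have "D $$ (i, i) / D $$ (j, j) = (D $$ (i, i) / D $$ (p, p)) * (D $$ (p, p) / D $$ (j, j))"
    using torus_mult(2)[OF D l(2)] by simp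
  also have "\<dots> = (\<Prod>k\<in>{1..n}. sc D k powi rt i p k * sc D k powi rt p j k)"
    unfolding add.IH prod.distrib ..
  also have "\<dots> = (\<Prod>k\<in>{1..n}. sc D k powi rt i j k)"
    unfolding rt_add[OF add(1,2)] by (rule prod.cong[OF refl]) (simp add: power_int_add nz)
  finally show ?case .
qed

text \<open>Solves \<open>e\<^bsup>\<alpha>\<^sub>k\<^esup>(D) = v\<^sub>k\<close> with last coordinate \<open>s\<close>.\<close>

lemma torus_exists:
  fixes v :: "nat \<Rightarrow> 'k"
  assumes v: "\<And>k. k \<in> {1..n} \<Longrightarrow> v k \<noteq> 0" and s: "s \<noteq> 0"
    "isB \<Longrightarrow> s = v n" "isC \<Longrightarrow> s\<^sup>2 = v n" "isD \<Longrightarrow> s\<^sup>2 * v (n - 1) = v n"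
  obtains d where "dmat d \<in> classical_group t n" "\<And>k. k \<in> {1..n} \<Longrightarrow> sc (dmat d) k = v k" "d (n - 1) = s"
proof -
  \<comment> \<open>The coordinates are solved backwards from the last one: each is the next one
    times the value of the simple character between them.\<close>
  define h where "h i = s * (\<Prod>k\<in>{i<..<n}. v k)" for i
  define d where "d i = (if i < n then h i else if opp i < n then inverse (h (opp i)) else 1)" for i
  have h0: "h i \<noteq> 0" for i unfolding h_def using v s(1) by auto
  have hs: "h (k - 1) = v k * h k" if "1 \<le> k" "k < n" for k
  proof -
    have "{k - 1<..<n} = insert k {k<..<n}" using that by auto
    thus ?thesis by (simp add: h_def)
  qed
  have hl: "h (n - 1) = s"
  proof -
    have "{n - 1<..<n} = {}" by auto
    thus ?thesis by (simp add: h_def)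
  qed
  have dd: "d i * d (opp i) = 1" if i: "i < m" for i
  proof (cases "i < n")
    case True
    thus ?thesis using opp_less_n(1)[OF True] opp_opp[OF i] h0[of i] by (simp add: d_def)
  next
    case False
    thus ?thesis using opp_less_n(2)[OF i False] opp_opp[OF i] h0[of "opp i"] by (auto simp: d_def)
  qed
  have dB: "d n = 1" if isB
  proof -
    have "opp n = n" using m_B[OF that] by (simp add: opp_def)
    thus ?thesis by (simp add: d_def)
  qed
  have dCD: "d n = inverse s" if "\<not> isB"
  proof -
    have "opp n = n - 1" using that type_exhaust m_C m_D rank_pos by (auto simp: opp_def)
    thus ?thesis using rank_pos hl by (simp add: d_def)
  qed
  have "sc (dmat d) k = v k" if k: "k \<in> {1..n}" for k
  proof (cases "k < n")
    case True
    have "simple_row k = k - 1" "k - 1 < n" using True by (simp_all add: simple_row_def)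
    thus ?thesis unfolding sc_dmat[OF k] using True k hs[of k] h0[of k] by (simp add: d_def)
  next
    case False
    hence kn: "k = n" using k by simp
    have nn1: "n \<in> {1..n}" using k kn by simp
    have dl: "d (n - 1) = s" using hl rank_pos by (simp add: d_def)
    consider isB | isC | isD using type_exhaust by blast
    thus ?thesis
    proof cases
      case 1
      hence "\<not> isD" using type_cases by metis
      hence "simple_row n = n - 1" by (simp add: simple_row_def)
      thus ?thesis unfolding kn sc_dmat[OF nn1] using dB[OF 1] dl s(2)[OF 1] by simp
    next
      case 2
      hence nn: "\<not> isD" "\<not> isB" using type_cases by metis+
      hence "simple_row n = n - 1" by (simp add: simple_row_def)
      thus ?thesis unfolding kn sc_dmat[OF nn1] dCD[OF nn(2)] using dl s(3)[OF 2] by (simp add: power2_eq_square divide_inverse)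
    next
      case 3
      hence nn: "\<not> isB" using type_cases by metis
      have r: "simple_row n = n - 2" using 3 by (simp add: simple_row_def)
      have "h (n - 2) = v (n - 1) * s" using hs[of "n - 1"] hl rank_D'[OF 3] by (simp add: numeral_2_eq_2)
      hence "d (n - 2) = v (n - 1) * s" using rank_D'[OF 3] by (simp add: d_def)
      thus ?thesis unfolding kn sc_dmat[OF nn1] dCD[OF nn] r using s(4)[OF 3] by (simp add: power2_eq_square divide_inverse mult_ac)
    qed
  qed
  moreover have "dmat d \<in> classical_group t n" unfolding dmat_group using dd dB by blast
  moreover have "d (n - 1) = s" using hl rank_pos by (simp add: d_def)
  ultimately show ?thesis using that by blast
qed

end

section \<open>The equations of the centralizer inside the torus\<close>

context bd_data begin

text \<open>Conjugation by a diagonal matrix scales each coefficient separately, so the condition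
  depends on the support of the coefficients.\<close>

lemma invariant_coeffs_dmat:
  assumes d: "\<And>i. i < m \<Longrightarrow> d i \<noteq> 0"
  shows "invariant_coeffs m \<rho> (dmat d) (mat_inv (dmat d)) \<longleftrightarrow>
    (\<forall>i<m. \<forall>j<m. \<forall>k<m. \<forall>l<m. \<rho> i j k l \<noteq> 0 \<longrightarrow> d i / d j * (d k / d l) = 1)"
proof -
  have di: "mat_inv (dmat d) = dmat (\<lambda>i. inverse (d i))" by (rule dmat_inv) (rule d)
  have "(\<Sum>(a, b, c, e)\<in>quads m. \<rho> a b c e * (dmat d $$ (i, a) * mat_inv (dmat d) $$ (b, j) * (dmat d $$ (k, c) * mat_inv (dmat d) $$ (e, l))))
     = \<rho> i j k l * (d i / d j * (d k / d l))" if l: "i < m" "j < m" "k < m" "l < m" for i j k l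
  proof -
    have "(\<Sum>(a, b, c, e)\<in>quads m. \<rho> a b c e * (dmat d $$ (i, a) * mat_inv (dmat d) $$ (b, j) * (dmat d $$ (k, c) * mat_inv (dmat d) $$ (e, l))))
      = (\<Sum>s\<in>quads m. if s = (i, j, k, l) then \<rho> i j k l * (d i / d j * (d k / d l)) else 0)"
    proof (rule sum.cong[OF refl])
      fix s assume s: "s \<in> quads m"
      obtain a b c e where abc: "s = (a, b, c, e)" by (cases s)
      have q: "a < m" "b < m" "c < m" "e < m" using s unfolding abc by auto
      show "(case s of (a, b, c, e) \<Rightarrow> \<rho> a b c e * (dmat d $$ (i, a) * mat_inv (dmat d) $$ (b, j) * (dmat d $$ (k, c) * mat_inv (dmat d) $$ (e, l))))
         = (if s = (i, j, k, l) then \<rho> i j k l * (d i / d j * (d k / d l)) else 0)"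
      proof (cases "s = (i, j, k, l)")
        case True
        hence "a = i" "b = j" "c = k" "e = l" unfolding abc by simp_all
        thus ?thesis unfolding abc prod.case di using l by (simp add: dmat_index divide_inverse)
      next
        case False
        hence "i \<noteq> a \<or> b \<noteq> j \<or> k \<noteq> c \<or> e \<noteq> l" unfolding abc by auto
        thus ?thesis unfolding if_not_P[OF False] unfolding abc prod.case di using l q by (auto simp: dmat_index)
      qed
    qed
    thus ?thesis using l by simp
  qed
  hence "invariant_coeffs m \<rho> (dmat d) (mat_inv (dmat d)) \<longleftrightarrow>
     (\<forall>i<m. \<forall>j<m. \<forall>k<m. \<forall>l<m. \<rho> i j k l = \<rho> i j k l * (d i / d j * (d k / d l)))"
    unfolding invariant_coeffs_def by simp
  moreover have "x = x * y \<longleftrightarrow> (x \<noteq> 0 \<longrightarrow> y = 1)" for x y :: 'k by (cases "x = 0") simp_all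
  ultimately show ?thesis by (simp only:)
qed

text \<open>\<tau> is a bijection of \<open>G1\<close> onto \<open>G2\<close>, so the product for
  the image of \<open>a\<close> is a reindexing of the product for \<open>a\<close>.\<close>

lemma character_tau:
  assumes D: "D \<in> classical_group t n" "diagonal_mat D" and eq: "\<And>k. k \<in> G1 \<Longrightarrow> sc D k = sc D (\<tau> k)"
    and a: "supp a \<subseteq> G1"
  shows "(\<Prod>k\<in>{1..n}. sc D k powi tau_lin G1 \<tau> a k) = (\<Prod>k\<in>{1..n}. sc D k powi a k)"
proof -
  have val: "tau_lin G1 \<tau> a (\<tau> i) = a i" if i: "i \<in> G1" for i
  proof -
    have "tau_lin G1 \<tau> a (\<tau> i) = (\<Sum>j\<in>G1. if j = i then a i else 0)"
      unfolding tau_lin_def by (rule sum.cong[OF refl]) (use tau_inj i in \<open>auto simp: simple_root_def\<close>)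
    thus ?thesis using i finite_G1 by simp
  qed
  have zero: "tau_lin G1 \<tau> a k = 0" if "k \<notin> G2" for k
    unfolding tau_lin_def by (rule sum.neutral) (use that tau_in in \<open>auto simp: simple_root_def\<close>)
  have "(\<Prod>k\<in>{1..n}. sc D k powi tau_lin G1 \<tau> a k) = (\<Prod>k\<in>G2. sc D k powi tau_lin G1 \<tau> a k)"
    using G2_sub zero by (intro prod.mono_neutral_right) auto
  also have "\<dots> = (\<Prod>i\<in>G1. sc D (\<tau> i) powi tau_lin G1 \<tau> a (\<tau> i))"
    by (rule prod.reindex_bij_betw[OF tau_bij, symmetric])
  also have "\<dots> = (\<Prod>i\<in>G1. sc D i powi a i)"
    by (rule prod.cong[OF refl]) (simp add: val eq)
  also have "\<dots> = (\<Prod>k\<in>{1..n}. sc D k powi a k)"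
  proof (rule prod.mono_neutral_left[OF finite_atLeastAtMost G1_sub], rule ballI)
    fix i assume "i \<in> {1..n} - G1"
    hence "a i = 0" using a by (auto simp: supp_def)
    thus "sc D i powi a i = 1" by simp
  qed
  finally show ?thesis .
qed

text \<open>At this entry the Cartan part and the standard part vanish, and every chain between the
  two simple roots contributes the same nonzero product, whatever its length. The number of these
  chains is positive, so in characteristic zero the total is nonzero.\<close>

lemma simple_chain_coeff:
  assumes k: "k \<in> G1"
  shows "\<rho> k (simple_row k) (simple_row (\<tau> k)) (\<tau> k) \<noteq> 0"
proof -
  have kn: "k \<in> {1..n}" "\<tau> k \<in> {1..n}" using k G1_sub tau_range by blast+
  let ?a = "simple_root k" and ?b = "simple_root (\<tau> k)"
  let ?i = "k" and ?j = "simple_row k" and ?k = "simple_row (\<tau> k)" and ?l = "\<tau> k"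
  note pk = simple_pair[OF kn(1)] and pt = simple_pair[OF kn(2)] and lk = simple_row_less[OF kn(1)] and lt = simple_row_less[OF kn(2)]
  have aP: "?a \<in> PR" "?b \<in> PR" using simple_root_in kn by blast+
  have sa: "supp ?a \<subseteq> G1" using k by (auto simp: supp_def simple_root_def split: if_splits)
  have htl: "ht ?a < ht ?b"
    using ht_tau_less[OF sa PR_nonneg[OF aP(1)] PR_supp(2)[OF aP(1)]] unfolding tau_lin_simple[OF k] .
  define c where "c = e (neg_root ?a) $$ (?i, ?j) * e ?b $$ (?k, ?l)"
  have bR: "?b \<in> roots K t n" and nR: "neg_root ?a \<in> roots K t n" using PR_roots aP neg_root_in by blast+
  have "e ?b $$ (?k, ?l) \<noteq> 0"
    using root_multiple(1)[OF pt(1), unfolded rt_simple[OF kn(2)], OF e_space[OF bR] e_space[OF bR] e_nonzero[OF bR]] .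
  moreover have "e (neg_root ?a) $$ (?i, ?j) \<noteq> 0"
    using root_multiple(1)[OF root_pair_sym[OF pk(1)], unfolded rt_swap[OF pk(1)] rt_simple[OF kn(1)], OF e_space[OF nR] e_space[OF nR] e_nonzero[OF nR]] .
  ultimately have c: "c \<noteq> 0" by (simp add: c_def)
  have 0: "\<rho>0 ?i ?j ?k ?l = 0" using \<rho>0_diag[OF lk(2,1) lt] pk(2) by simp
  have 1: "(\<Sum>a\<in>PR. e (neg_root a) $$ (?i, ?j) * e a $$ (?k, ?l)) = 0"
  proof (rule sum.neutral, rule ballI, rule ccontr)
    fix a assume a: "a \<in> PR" and "e (neg_root a) $$ (?i, ?j) * e a $$ (?k, ?l) \<noteq> 0"
    hence h: "e (neg_root a) $$ (?i, ?j) \<noteq> 0" "e a $$ (?k, ?l) \<noteq> 0" by auto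
    have "a = ?a" using e_neg_index(2)[OF a lk(2,1) h(1)] unfolding rt_simple[OF kn(1)] .
    moreover have "a = ?b" using e_pos_index(2)[OF a lt h(2)] unfolding rt_simple[OF kn(2)] .
    ultimately show False using htl by simp
  qed
  define S where "S = {s \<in> chains. fst s = ?a \<and> snd (snd s) = ?b}"
  have 2: "(\<Sum>(a, q, b)\<in>chains. e (neg_root a) $$ (?i, ?j) * e b $$ (?k, ?l) - e b $$ (?i, ?j) * e (neg_root a) $$ (?k, ?l)) = of_nat (card S) * c"
  proof -
    have "(\<Sum>(a, q, b)\<in>chains. e (neg_root a) $$ (?i, ?j) * e b $$ (?k, ?l) - e b $$ (?i, ?j) * e (neg_root a) $$ (?k, ?l)) =
       (\<Sum>s\<in>chains. if s \<in> S then c else 0)"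
    proof (rule sum.cong[OF refl])
      fix s assume s: "s \<in> chains"
      obtain a q b where abq: "s = (a, q, b)" by (cases s)
      note d = chainsD[OF s[unfolded abq]]
      have t2: "e b $$ (?i, ?j) = 0" using e_pos_index(3)[OF d(2) lk(2,1)] pk(2) by fastforce
      have t1: "e (neg_root a) $$ (?i, ?j) * e b $$ (?k, ?l) = (if s \<in> S then c else 0)"
      proof (cases "s \<in> S")
        case True
        hence "a = ?a" "b = ?b" unfolding S_def abq by simp_all
        thus ?thesis using True by (simp add: c_def)
      next
        case False
        have "e (neg_root a) $$ (?i, ?j) * e b $$ (?k, ?l) = 0"
        proof (rule ccontr)
          assume "e (neg_root a) $$ (?i, ?j) * e b $$ (?k, ?l) \<noteq> 0"
          hence h: "e (neg_root a) $$ (?i, ?j) \<noteq> 0" "e b $$ (?k, ?l) \<noteq> 0" by auto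
          have "a = ?a" using e_neg_index(2)[OF d(1) lk(2,1) h(1)] unfolding rt_simple[OF kn(1)] .
          moreover have "b = ?b" using e_pos_index(2)[OF d(2) lt h(2)] unfolding rt_simple[OF kn(2)] .
          ultimately have "s \<in> S" using s unfolding S_def abq by simp
          thus False using False by contradiction
        qed
        thus ?thesis using False by simp
      qed
      show "(case s of (a, q, b) \<Rightarrow> e (neg_root a) $$ (?i, ?j) * e b $$ (?k, ?l) - e b $$ (?i, ?j) * e (neg_root a) $$ (?k, ?l)) = (if s \<in> S then c else 0)"
        unfolding abq prod.case t2 t1[unfolded abq] by simp
    qed
    also have "\<dots> = (\<Sum>s\<in>S. c)" using finite_chains by (simp add: sum.If_cases S_def Int_def)
    finally show ?thesis by simp
  qed
  have "(?a, 1, ?b) \<in> S"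
    unfolding S_def chains_def using aP sa tau_lin_simple[OF k] by (auto simp: tau_lin_graph_iff)
  moreover have "finite S" using finite_chains by (simp add: S_def)
  ultimately have "card S \<noteq> 0" by auto
  thus ?thesis unfolding \<rho>_eq[OF lk(2,1) lt] 0 1 2 using c by simp
qed

text \<open>The coefficients at pairs of simple roots force the equations. Conversely, the equations
  propagate multiplicatively to all roots and along all chains, which makes every scaling factor on
  the support of r equal to 1.\<close>

lemma centralizer_iff:
  "D \<in> bd_centralizer t n r \<longleftrightarrow> D \<in> classical_group t n \<and> diagonal_mat D \<and> (\<forall>k\<in>G1. sc D k = sc D (\<tau> k))"
proof (cases "D \<in> classical_group t n \<and> diagonal_mat D")
  case True
  hence G: "D \<in> classical_group t n" and diag: "diagonal_mat D" by auto
  note Dc = group_carrier[OF G] and tm = torus_mult[OF G diag]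
  define d where "d i = D $$ (i, i)" for i
  have Dd: "D = dmat d" unfolding d_def by (rule diag_dmat[OF Dc diag])
  have d0: "d i \<noteq> 0" if "i < m" for i unfolding d_def by (rule tm(2)[OF that])
  have "invariant_coeffs m \<rho> D (mat_inv D) \<longleftrightarrow> (\<forall>i<m. \<forall>j<m. \<forall>k<m. \<forall>l<m. \<rho> i j k l \<noteq> 0 \<longrightarrow> d i / d j * (d k / d l) = 1)"
    unfolding Dd by (rule invariant_coeffs_dmat[OF d0])
  also have "\<dots> \<longleftrightarrow> (\<forall>k\<in>G1. sc D k = sc D (\<tau> k))"
  proof
    assume h: "\<forall>i<m. \<forall>j<m. \<forall>k<m. \<forall>l<m. \<rho> i j k l \<noteq> 0 \<longrightarrow> d i / d j * (d k / d l) = 1"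
    show "\<forall>k\<in>G1. sc D k = sc D (\<tau> k)"
    proof
      fix k assume k: "k \<in> G1"
      have kn: "k \<in> {1..n}" "\<tau> k \<in> {1..n}" using k G1_sub tau_range by blast+
      note lk = simple_row_less[OF kn(1)] and lt = simple_row_less[OF kn(2)]
      have "d k / d (simple_row k) * (d (simple_row (\<tau> k)) / d (\<tau> k)) = 1"
        using h[rule_format, OF lk(2,1) lt simple_chain_coeff[OF k]] .
      thus "sc D k = sc D (\<tau> k)"
        using d0[OF lk(1)] d0[OF lk(2)] d0[OF lt(1)] d0[OF lt(2)] unfolding sc_def d_def[symmetric] by (simp add: field_simps)
    qed
  next
    assume eq: "\<forall>k\<in>G1. sc D k = sc D (\<tau> k)"
    define ch where "ch a = (\<Prod>k\<in>{1..n}. sc D k powi a k)" for a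
    have chr: "d i / d j = ch (rt i j)" if "root_pair i j" "i < j" for i j
      unfolding ch_def d_def by (rule torus_character[OF G diag that])
    have tau: "ch b = ch a" if "(a, b) \<in> tau_lin_graph G1 \<tau> ^^ q" for a b q
      using that
    proof (induction q arbitrary: b)
      case (Suc q)
      then obtain c where c: "(a, c) \<in> tau_lin_graph G1 \<tau> ^^ q" "(c, b) \<in> tau_lin_graph G1 \<tau>" by auto
      have "supp c \<subseteq> G1" "b = tau_lin G1 \<tau> c" using c(2) unfolding tau_lin_graph_iff by auto
      thus ?case using Suc.IH[OF c(1)] character_tau[OF G diag, of c] eq unfolding ch_def by simp
    qed simp
    have chn: "ch a = ch b" if "(a, q, b) \<in> chains" for a q b using tau that unfolding chains_def by fastforce
    show "\<forall>i<m. \<forall>j<m. \<forall>k<m. \<forall>l<m. \<rho> i j k l \<noteq> 0 \<longrightarrow> d i / d j * (d k / d l) = 1"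
    proof (intro allI impI)
      fix i j k l assume l: "i < m" "j < m" "k < m" "l < m" and ne: "\<rho> i j k l \<noteq> 0"
      note dn = d0[OF l(1)] d0[OF l(2)] d0[OF l(3)] d0[OF l(4)]
      have fin: "d i / d j * (d k / d l) = 1" if "d j / d i = d k / d l" using that dn by (simp add: field_simps)
      have fin': "d i / d j * (d k / d l) = 1" if "d i / d j = d l / d k" using that dn by (simp add: field_simps)
      show "d i / d j * (d k / d l) = 1"
      proof (rule \<rho>_cases[OF l ne])
        assume "i = j" "k = l"
        thus ?thesis using dn by simp
      next
        fix a assume a: "a \<in> PR" "e (neg_root a) $$ (i, j) \<noteq> 0" "e a $$ (k, l) \<noteq> 0"
        note A = e_neg_index[OF a(1) l(1,2) a(2)] and B = e_pos_index[OF a(1) l(3,4) a(3)]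
        show ?thesis by (rule fin) (simp only: chr[OF A(1,3)] chr[OF B(1,3)] A(2)[symmetric] B(2)[symmetric])
      next
        fix a q b assume c: "(a, q, b) \<in> chains" and a: "e (neg_root a) $$ (i, j) \<noteq> 0" "e b $$ (k, l) \<noteq> 0"
        note A = e_neg_index[OF chainsD(1)[OF c] l(1,2) a(1)] and B = e_pos_index[OF chainsD(2)[OF c] l(3,4) a(2)]
        show ?thesis by (rule fin) (simp only: chr[OF A(1,3)] chr[OF B(1,3)] A(2)[symmetric] B(2)[symmetric] chn[OF c])
      next
        fix a q b assume c: "(a, q, b) \<in> chains" and a: "e b $$ (i, j) \<noteq> 0" "e (neg_root a) $$ (k, l) \<noteq> 0"
        note B = e_pos_index[OF chainsD(2)[OF c] l(1,2) a(1)] and A = e_neg_index[OF chainsD(1)[OF c] l(3,4) a(2)]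
        show ?thesis by (rule fin') (simp only: chr[OF A(1,3)] chr[OF B(1,3)] A(2)[symmetric] B(2)[symmetric] chn[OF c])
      qed
    qed
  qed
  finally show ?thesis using centralizer_coeffs[OF G] True by blast
next
  case False
  thus ?thesis using centralizer_diagonal[of D] by (auto simp: bd_centralizer_def)
qed

end

section \<open>Cohomology\<close>

text \<open>\<open>F\<close> is constant on classes and separates them, so its value at an
  arbitrarily chosen element gives the bijection.\<close>

lemma quotient_by_invariant:
  assumes "E = {(x, y). x \<in> Z \<and> y \<in> Z \<and> F x = F y}"
  shows "\<exists>f. bij_betw f (Z // E) (F ` Z)"
proof -
  have cl: "E `` {x} = {y \<in> Z. F y = F x}" if "x \<in> Z" for x using that assms by auto
  have v: "F (SOME y. y \<in> E `` {x}) = F x" if x: "x \<in> Z" for x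
  proof -
    have "x \<in> E `` {x}" using cl[OF x] x by simp
    hence "(SOME y. y \<in> E `` {x}) \<in> E `` {x}" by (rule someI)
    thus ?thesis unfolding cl[OF x] by simp
  qed
  have "bij_betw (\<lambda>c. F (SOME y. y \<in> c)) (Z // E) (F ` Z)"
    unfolding bij_betw_def
  proof
    show "inj_on (\<lambda>c. F (SOME y. y \<in> c)) (Z // E)"
    proof (rule inj_onI)
      fix c c' assume cc: "c \<in> Z // E" "c' \<in> Z // E" "F (SOME y. y \<in> c) = F (SOME y. y \<in> c')"
      obtain x where x: "x \<in> Z" "c = E `` {x}" using cc(1) by (rule quotientE)
      obtain y where y: "y \<in> Z" "c' = E `` {y}" using cc(2) by (rule quotientE)
      have "F x = F y" using cc(3) unfolding x(2) y(2) v[OF x(1)] v[OF y(1)] .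
      thus "c = c'" unfolding x(2) y(2) cl[OF x(1)] cl[OF y(1)] by simp
    qed
    show "(\<lambda>c. F (SOME y. y \<in> c)) ` (Z // E) = F ` Z"
    proof
      show "(\<lambda>c. F (SOME y. y \<in> c)) ` (Z // E) \<subseteq> F ` Z"
      proof
        fix w assume "w \<in> (\<lambda>c. F (SOME y. y \<in> c)) ` (Z // E)"
        then obtain c where c: "c \<in> Z // E" "w = F (SOME y. y \<in> c)" by blast
        obtain x where x: "x \<in> Z" "c = E `` {x}" using c(1) by (rule quotientE)
        show "w \<in> F ` Z" unfolding c(2) x(2) v[OF x(1)] using x(1) by blast
      qed
      show "F ` Z \<subseteq> (\<lambda>c. F (SOME y. y \<in> c)) ` (Z // E)"
      proof
        fix w assume "w \<in> F ` Z"
        then obtain x where x: "x \<in> Z" "w = F x" by blast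
        have "w = F (SOME y. y \<in> E `` {x})" unfolding x(2) v[OF x(1)] ..
        thus "w \<in> (\<lambda>c. F (SOME y. y \<in> c)) ` (Z // E)" using quotientI[OF x(1)] by blast
      qed
    qed
  qed
  thus ?thesis by blast
qed

lemma quotient_trivial:
  assumes "Z \<noteq> {}" "E \<subseteq> Z \<times> Z" "\<And>x y. x \<in> Z \<Longrightarrow> y \<in> Z \<Longrightarrow> (x, y) \<in> E"
  shows "\<exists>!c. c \<in> Z // E"
proof -
  have "E `` {x} = Z" if "x \<in> Z" for x using assms(2,3) that by blast
  hence "Z // E = {Z}" using assms(1) unfolding quotient_def by blast
  thus ?thesis by blast
qed

lemma square_classes_eq: "(square_classes :: 'f::field set set) = (\<lambda>a. {x\<^sup>2 * a | x. x \<noteq> 0}) ` {a. a \<noteq> 0}"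
proof -
  let ?G = "mult_of (ring_of_type_algebra :: 'f ring)"
  have c: "carrier ?G = {a. a \<noteq> 0}" by (auto simp: ring_of_type_algebra_def)
  have r: "r_coset ?G {x\<^sup>2 | x. x \<noteq> 0} a = {x\<^sup>2 * a | x. x \<noteq> 0}" for a
    by (auto simp: r_coset_def ring_of_type_algebra_def)
  have "carrier (?G Mod {x\<^sup>2 | x. x \<noteq> 0}) = (\<Union>a\<in>carrier ?G. {r_coset ?G {x\<^sup>2 | x. x \<noteq> 0} a})"
    by (simp only: FactGroup_def RCOSETS_def partial_object.select_convs)
  thus ?thesis unfolding square_classes_def c r by blast
qed

lemma square_class_eq_iff:
  assumes "(a :: 'f::field) \<noteq> 0" "b \<noteq> 0"
  shows "{x\<^sup>2 * a | x. x \<noteq> 0} = {x\<^sup>2 * b | x. x \<noteq> 0} \<longleftrightarrow> (\<exists>s. s \<noteq> 0 \<and> a = s\<^sup>2 * b)"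
proof
  assume h: "{x\<^sup>2 * a | x. x \<noteq> 0} = {x\<^sup>2 * b | x. x \<noteq> 0}"
  have "a = 1\<^sup>2 * a \<and> (1 :: 'f) \<noteq> 0" by simp
  hence "a \<in> {x\<^sup>2 * a | x. x \<noteq> 0}" by blast
  thus "\<exists>s. s \<noteq> 0 \<and> a = s\<^sup>2 * b" unfolding h by blast
next
  assume "\<exists>s. s \<noteq> 0 \<and> a = s\<^sup>2 * b"
  then obtain s where s: "s \<noteq> 0" "a = s\<^sup>2 * b" by blast
  show "{x\<^sup>2 * a | x. x \<noteq> 0} = {x\<^sup>2 * b | x. x \<noteq> 0}"
  proof (intro equalityI subsetI)
    fix y assume "y \<in> {x\<^sup>2 * a | x. x \<noteq> 0}"
    then obtain x where x: "y = x\<^sup>2 * a" "x \<noteq> 0" by blast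
    have "y = (x * s)\<^sup>2 * b \<and> x * s \<noteq> 0" using x s by (simp add: power_mult_distrib mult.assoc)
    thus "y \<in> {x\<^sup>2 * b | x. x \<noteq> 0}" by blast
  next
    fix y assume "y \<in> {x\<^sup>2 * b | x. x \<noteq> 0}"
    then obtain x where x: "y = x\<^sup>2 * b" "x \<noteq> 0" by blast
    have "y = (x / s)\<^sup>2 * a \<and> x / s \<noteq> 0" using x s by (simp add: power_divide)
    thus "y \<in> {x\<^sup>2 * a | x. x \<noteq> 0}" by blast
  qed
qed

section \<open>Base change to the algebraic closure and descent\<close>

lemma to_ac_hom: "comm_ring_hom (to_ac :: 'f::field \<Rightarrow> 'f alg_closure)"
  by unfold_locales simp_all

abbreviation ac_mat :: "'f::field mat \<Rightarrow> 'f alg_closure mat" where "ac_mat \<equiv> map_mat to_ac"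

lemma ac_mat_mult: "A \<in> carrier_mat m m \<Longrightarrow> B \<in> carrier_mat m m \<Longrightarrow> ac_mat (A * B) = ac_mat A * ac_mat B"
  by (rule semiring_hom.mat_hom_mult[of _ _ m m _ m]) (use to_ac_hom comm_ring_hom.axioms(1) ring_hom.axioms in \<open>unfold_locales, auto\<close>)

lemma ac_mat_det: "det (ac_mat A) = to_ac (det A)"
  by (rule comm_ring_hom.hom_det[OF to_ac_hom])

lemma ac_mat_group:
  assumes "A \<in> carrier_mat (std_dim t n) (std_dim t n)"
  shows "ac_mat A \<in> classical_group t n \<longleftrightarrow> A \<in> classical_group t n"
proof -
  let ?m = "std_dim t n"
  have B: "form_mat t n = ac_mat (form_mat t n)" by (rule eq_matI) (auto simp: form_mat_def)
  have T: "transpose_mat (ac_mat A) = ac_mat (transpose_mat A)" by (rule eq_matI) auto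
  have c: "(form_mat t n :: 'a mat) \<in> carrier_mat ?m ?m" "transpose_mat A \<in> carrier_mat ?m ?m"
    using assms by (auto simp: form_mat_def)
  have "ac_mat A * form_mat t n * transpose_mat (ac_mat A) = ac_mat (A * form_mat t n * transpose_mat A)"
    unfolding T B ac_mat_mult[OF assms c(1)] ac_mat_mult[OF mult_carrier_mat[OF assms c(1)] c(2)] ..
  moreover have "ac_mat x = ac_mat y \<longleftrightarrow> x = y" for x y :: "'a mat"
    by (auto simp: mat_eq_iff)
  ultimately show ?thesis
    using assms unfolding classical_group_def by (simp add: ac_mat_det B[symmetric]) (metis B)
qed

locale bd_cohomology_data = bd_data "TYPE(('f::field_char_0) alg_closure)" t n G1 G2 \<tau> e r0 r
  for t :: cartan_type and n :: nat and G1 G2 :: "nat set" and \<tau> :: "nat \<Rightarrow> nat"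
    and e :: "lattice_vec \<Rightarrow> ('f::field_char_0) alg_closure mat" and r0 r :: "('f::field_char_0) alg_closure mat"
begin

text \<open>The same root data over F: names with the prefix \<open>base\<close> refer to rational
  matrices, those without it to the algebraic closure.\<close>

sublocale base: classical_type "TYPE('f)" t n
  using rank_pos rank_D by unfold_locales

abbreviation "rat \<equiv> (range to_ac :: 'f alg_closure set)"

lemma rat_mult: "x \<in> rat \<Longrightarrow> y \<in> rat \<Longrightarrow> x * y \<in> rat"
  and rat_inverse: "x \<in> rat \<Longrightarrow> inverse x \<in> rat"
  and rat_divide: "x \<in> rat \<Longrightarrow> y \<in> rat \<Longrightarrow> x / y \<in> rat"
  and rat_1: "1 \<in> rat"
proof -
  show m: "x * y \<in> rat" if xy: "x \<in> rat" "y \<in> rat" for x y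
  proof -
    obtain u v where "x = to_ac u" "y = to_ac v" using xy by blast
    hence "x * y = to_ac (u * v)" by simp
    thus ?thesis by blast
  qed
  show i: "inverse x \<in> rat" if x: "x \<in> rat" for x
  proof -
    obtain u where "x = to_ac u" using x by blast
    hence "inverse x = to_ac (inverse u)" by simp
    thus ?thesis by blast
  qed
  show "x / y \<in> rat" if "x \<in> rat" "y \<in> rat" for x y unfolding divide_inverse using m[OF that(1) i[OF that(2)]] .
  have "1 = to_ac (1 :: 'f)" by simp
  thus "1 \<in> rat" by blast
qed

lemma galois_hom:
  assumes "\<sigma> \<in> galois_group"
  shows "\<sigma> (x * y) = \<sigma> x * \<sigma> y" "\<sigma> (to_ac c) = to_ac c" "\<sigma> 0 = 0" "\<sigma> 1 = 1" "\<sigma> x = 0 \<longleftrightarrow> x = 0" "\<sigma> (x / y) = \<sigma> x / \<sigma> y"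
proof -
  have b: "bij \<sigma>" and m: "\<And>x y. \<sigma> (x * y) = \<sigma> x * \<sigma> y" and f: "\<And>x. \<sigma> (to_ac x) = to_ac x"
    using assms unfolding galois_group_def by auto
  show "\<sigma> (x * y) = \<sigma> x * \<sigma> y" "\<sigma> (to_ac c) = to_ac c" using m f by auto
  show z: "\<sigma> 0 = 0" and o: "\<sigma> 1 = 1" using f[of 0] f[of 1] by simp_all
  have zi: "\<sigma> x = 0 \<longleftrightarrow> x = 0" for x using bij_is_inj[OF b] z by (metis injD)
  thus "\<sigma> x = 0 \<longleftrightarrow> x = 0" .
  show "\<sigma> (x / y) = \<sigma> x / \<sigma> y"
  proof (cases "y = 0")
    case False
    have "\<sigma> (x / y) * \<sigma> y = \<sigma> x" using m[of "x / y" y] False by simp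
    thus ?thesis using zi False by (simp add: eq_divide_eq)
  qed (simp add: z)
qed

text \<open>Descent enters here: rationality is tested by the action of the Galois group.\<close>

lemma rat_iff: "x \<in> rat \<longleftrightarrow> (\<forall>\<sigma>\<in>galois_group. \<sigma> x = x)"
  using fixed_field_galois_group[of x] galois_hom(2) by blast

abbreviation "Z \<equiv> bd_cocycles t n r"
abbreviation "C \<equiv> bd_centralizer t n r"

text \<open>Rationality of these ratios is equivalent to \<sigma>(d)/d lying in C(r) for all
  \<sigma>.\<close>

definition torus_cocycle :: "(nat \<Rightarrow> 'f alg_closure) \<Rightarrow> bool" where
  "torus_cocycle d \<longleftrightarrow> dmat d \<in> classical_group t n \<and> (\<forall>k\<in>G1. sc (dmat d) k / sc (dmat d) (\<tau> k) \<in> rat)"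

lemma dmat_groupD:
  assumes "dmat d \<in> classical_group t n"
  shows "i < m \<Longrightarrow> d i * d (opp i) = 1" "isB \<Longrightarrow> d n = 1"
  using assms unfolding dmat_group by simp_all

lemma torus_nz: "dmat d \<in> classical_group t n \<Longrightarrow> i < m \<Longrightarrow> d i \<noteq> 0"
  using torus_mult(2)[of "dmat d" i] by simp

lemma G1_n: "k \<in> G1 \<Longrightarrow> k \<in> {1..n} \<and> \<tau> k \<in> {1..n}"
  using G1_sub tau_range by blast

lemma sc_nz:
  assumes "dmat d \<in> classical_group t n" "k \<in> {1..n}"
  shows "sc (dmat d) k \<noteq> 0"
  using torus_nz[OF assms(1)] simple_row_less[OF assms(2)] by (simp add: sc_dmat[OF assms(2)])

text \<open>The Galois group scales each column of a cocycle, so dividing every column by one of its nonzero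
  entries gives a rational matrix. The factors \<open>g j\<close> are rational corrections that move the remaining
  diagonal matrix into the torus.\<close>

lemma cocycle_decomp:
  assumes x: "x \<in> Z"
  obtains Q d where "Q \<in> classical_group t n" "torus_cocycle d" "x = ac_mat Q * dmat d"
proof -
  have G: "x \<in> classical_group t n" and coc: "\<And>\<sigma>. \<sigma> \<in> galois_group \<Longrightarrow> mat_inv x * map_mat \<sigma> x \<in> C"
    using x unfolding bd_cocycles_def by auto
  note xc = group_carrier[OF G] and Y = group_inv[OF G]
  define D where "D \<sigma> = mat_inv x * map_mat \<sigma> x" for \<sigma>
  have DC: "D \<sigma> \<in> C" if "\<sigma> \<in> galois_group" for \<sigma> unfolding D_def by (rule coc[OF that])
  have DG: "D \<sigma> \<in> classical_group t n" "diagonal_mat (D \<sigma>)" "\<And>k. k \<in> G1 \<Longrightarrow> sc (D \<sigma>) k = sc (D \<sigma>) (\<tau> k)"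
    if "\<sigma> \<in> galois_group" for \<sigma>
    using DC[OF that] unfolding centralizer_iff by blast+
  have act: "\<sigma> (x $$ (i, j)) = x $$ (i, j) * D \<sigma> $$ (j, j)" if s: "\<sigma> \<in> galois_group" and ij: "i < m" "j < m" for \<sigma> i j
  proof -
    have sx: "map_mat \<sigma> x \<in> carrier_mat m m" using xc by simp
    have "x * D \<sigma> = x * mat_inv x * map_mat \<sigma> x" unfolding D_def by (rule assoc_mult_mat[OF xc Y(1) sx, symmetric])
    also have "\<dots> = map_mat \<sigma> x" unfolding Y(2) by (rule left_mult_one_mat[OF sx])
    finally have "map_mat \<sigma> x $$ (i, j) = (x * D \<sigma>) $$ (i, j)" by simp
    also have "\<dots> = x $$ (i, j) * D \<sigma> $$ (j, j)"
      by (rule mat_mult_diag_right[OF group_carrier[OF DG(1)[OF s]] xc DG(2)[OF s] ij])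
    finally show ?thesis using ij xc by simp
  qed
  have "\<exists>p<m. x $$ (p, j) \<noteq> 0" if j: "j < m" for j
  proof -
    have "(mat_inv x * x) $$ (j, j) \<noteq> 0" unfolding Y(3) using j by simp
    hence "(\<Sum>k<m. mat_inv x $$ (j, k) * x $$ (k, j)) \<noteq> 0" unfolding mat_mult_index[OF Y(1) xc j j] .
    then obtain k where "k \<in> {..<m}" "mat_inv x $$ (j, k) * x $$ (k, j) \<noteq> 0" by (rule sum.not_neutral_contains_not_neutral)
    thus ?thesis by auto
  qed
  then obtain p where p: "\<And>j. j < m \<Longrightarrow> p j < m" "\<And>j. j < m \<Longrightarrow> x $$ (p j, j) \<noteq> 0" by metis
  define u where "u j = x $$ (p j, j)" for j
  \<comment> \<open>This makes \<open>d j\<close> the inverse of \<open>u (opp j)\<close> in the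
    first half, \<open>u j\<close> in the second and 1 in the middle, so opposite entries of
    \<open>d\<close> multiply to 1. The products in \<open>g\<close> are rational because opposite
    entries of \<open>D \<sigma>\<close> multiply to 1, and the middle one because that entry of
    \<open>D \<sigma>\<close> is 1.\<close>
  define g where "g j = (if j < n then u j * u (opp j) else if opp j < n then 1 else u j)" for j
  define d where "d j = u j / g j" for j
  have u0: "u j \<noteq> 0" if "j < m" for j unfolding u_def by (rule p(2)[OF that])
  have us: "\<sigma> (u j) = u j * D \<sigma> $$ (j, j)" if "\<sigma> \<in> galois_group" "j < m" for \<sigma> j
    unfolding u_def by (rule act[OF that(1) p(1)[OF that(2)] that(2)])
  have g0: "g j \<noteq> 0" if "j < m" for j using u0[OF that] u0[OF opp_less[OF that]] by (simp add: g_def)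
  have gr: "g j \<in> rat" if j: "j < m" for j
    unfolding rat_iff
  proof
    fix \<sigma> :: "'f alg_closure \<Rightarrow> 'f alg_closure" assume s: "\<sigma> \<in> galois_group"
    note tm = torus_mult[OF DG(1,2)[OF s]]
    show "\<sigma> (g j) = g j"
    proof (cases "j < n")
      case True
      have "\<sigma> (u j * u (opp j)) = u j * u (opp j) * (D \<sigma> $$ (j, j) * D \<sigma> $$ (opp j, opp j))"
        unfolding galois_hom(1)[OF s] us[OF s j] us[OF s opp_less[OF j]] by (simp only: mult_ac)
      thus ?thesis using True tm(1)[OF j] by (simp add: g_def)
    next
      case False
      show ?thesis
      proof (cases "opp j < n")
        case True
        thus ?thesis using False galois_hom(4)[OF s] by (simp add: g_def)
      next
        case o: False
        hence jn: isB "j = n" using opp_less_n(2)[OF j False] by blast+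
        have "D \<sigma> $$ (n, n) = 1" using torus_iff[OF group_carrier[OF DG(1)[OF s]] DG(2)[OF s]] DG(1)[OF s] jn(1) by blast
        hence "\<sigma> (u j) = u j" using us[OF s j] jn(2) by simp
        thus ?thesis using False o by (simp add: g_def)
      qed
    qed
  qed
  have qr: "x $$ (i, j) / d j \<in> rat" if ij: "i < m" "j < m" for i j
  proof -
    have r: "x $$ (i, j) / u j \<in> rat"
      unfolding rat_iff
    proof
      fix \<sigma> :: "'f alg_closure \<Rightarrow> 'f alg_closure" assume s: "\<sigma> \<in> galois_group"
      have "D \<sigma> $$ (j, j) \<noteq> 0" by (rule torus_mult(2)[OF DG(1,2)[OF s] ij(2)])
      thus "\<sigma> (x $$ (i, j) / u j) = x $$ (i, j) / u j"
        unfolding galois_hom(6)[OF s] act[OF s ij] us[OF s ij(2)] by simp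
    qed
    have q: "x $$ (i, j) / d j = x $$ (i, j) / u j * g j" by (simp add: d_def)
    show ?thesis unfolding q by (rule rat_mult[OF r gr[OF ij(2)]])
  qed
  have d0: "d j \<noteq> 0" if "j < m" for j using u0[OF that] g0[OF that] by (simp add: d_def)
  have dG: "dmat d \<in> classical_group t n"
    unfolding dmat_group
  proof (intro conjI allI impI)
    have *: "d i * d (opp i) = 1" if i: "i < n" for i
    proof -
      have im: "i < m" using i n_le_m by simp
      show ?thesis using opp_less_n(1)[OF i] opp_opp[OF im] i u0[OF im] u0[OF opp_less[OF im]]
        unfolding d_def g_def by simp
    qed
    fix i assume i: "i < m"
    show "d i * d (opp i) = 1"
    proof (cases "i < n")
      case False
      show ?thesis
      proof (cases "opp i < n")
        case True
        show ?thesis using *[OF True] opp_opp[OF i] by (simp add: mult.commute)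
      next
        case o: False
        hence "opp i = i" using opp_less_n(2)[OF i False] by blast
        thus ?thesis using False o u0[OF i] by (simp add: d_def g_def)
      qed
    qed (rule *)
  next
    assume B: isB
    have "n < m" "opp n = n" using m_B[OF B] by (simp_all add: opp_def)
    thus "d n = 1" using u0[of n] by (simp add: d_def g_def)
  qed
  define Q where "Q = mat m m (\<lambda>(i, j). of_ac (x $$ (i, j) / d j))"
  have Qc: "Q \<in> carrier_mat m m" by (simp add: Q_def)
  have Qi: "ac_mat Q $$ (i, j) = x $$ (i, j) / d j" if "i < m" "j < m" for i j
    using that to_ac_of_ac[OF qr[OF that]] by (simp add: Q_def)
  have xe: "x = ac_mat Q * dmat d"
  proof (rule eq_matI)
    fix i j assume "i < dim_row (ac_mat Q * dmat d)" "j < dim_col (ac_mat Q * dmat d)"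
    hence ij: "i < m" "j < m" using Qc by (auto simp: dmat_def)
    have Qa: "ac_mat Q \<in> carrier_mat m m" using Qc by simp
    show "x $$ (i, j) = (ac_mat Q * dmat d) $$ (i, j)"
      unfolding mult_dmat_index[OF Qa ij] Qi[OF ij] using d0[OF ij(2)] by simp
  qed (use xc Qc in \<open>auto simp: dmat_def\<close>)
  have "ac_mat Q = x * mat_inv (dmat d)"
  proof -
    have Qa: "ac_mat Q \<in> carrier_mat m m" using Qc by simp
    have "x * mat_inv (dmat d) = ac_mat Q * (dmat d * mat_inv (dmat d))"
      unfolding xe by (rule assoc_mult_mat[OF Qa dmat(1) group_inv(1)[OF dG]])
    also have "\<dots> = ac_mat Q" unfolding group_inv(2)[OF dG] by (rule right_mult_one_mat[OF Qa])
    finally show ?thesis by (rule sym)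
  qed
  hence "ac_mat Q \<in> classical_group t n" using group_mult[OF G group_mat_inv[OF dG]] by simp
  hence QG: "Q \<in> classical_group t n" using ac_mat_group[OF Qc] by blast
  have "torus_cocycle d"
    unfolding torus_cocycle_def
  proof (intro conjI ballI)
    fix k assume k: "k \<in> G1"
    have kn: "k \<in> {1..n}" "\<tau> k \<in> {1..n}" using G1_n[OF k] by auto
    show "sc (dmat d) k / sc (dmat d) (\<tau> k) \<in> rat"
      unfolding rat_iff
    proof
      fix \<sigma> :: "'f alg_closure \<Rightarrow> 'f alg_closure" assume s: "\<sigma> \<in> galois_group"
      have ds: "\<sigma> (d j) = d j * D \<sigma> $$ (j, j)" if "j < m" for j
        unfolding d_def galois_hom(6)[OF s] us[OF s that] using gr[OF that] s unfolding rat_iff by simp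
      have scs: "\<sigma> (sc (dmat d) l) = sc (dmat d) l * sc (D \<sigma>) l" if "l \<in> {1..n}" for l
        using simple_row_less[OF that] unfolding sc_dmat[OF that] galois_hom(6)[OF s] by (simp add: ds sc_def)
      have "sc (D \<sigma>) (\<tau> k) \<noteq> 0"
        using torus_mult(2)[OF DG(1,2)[OF s]] simple_row_less[OF kn(2)] by (simp add: sc_def)
      thus "\<sigma> (sc (dmat d) k / sc (dmat d) (\<tau> k)) = sc (dmat d) k / sc (dmat d) (\<tau> k)"
        unfolding galois_hom(6)[OF s] scs[OF kn(1)] scs[OF kn(2)] DG(3)[OF s k] by simp
    qed
  qed (rule dG)
  thus ?thesis using that QG xe by blast
qed

text \<open>The rational factor is fixed by the Galois group, so \<sigma> acts as right
  multiplication by the diagonal matrix of \<sigma>(d)/d; this matrix satisfies the equations of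
  C(r) because the ratios are rational.\<close>

lemma torus_cocycle_in:
  assumes Q: "Q \<in> classical_group t n" and d: "torus_cocycle d"
  shows "ac_mat Q * dmat d \<in> Z"
proof -
  have dG: "dmat d \<in> classical_group t n" using d by (simp add: torus_cocycle_def)
  have Qc: "Q \<in> carrier_mat m m" by (rule group_carrier[OF Q])
  have Qa: "ac_mat Q \<in> classical_group t n" using ac_mat_group[OF Qc] Q by blast
  note Qac = group_carrier[OF Qa]
  have xG: "ac_mat Q * dmat d \<in> classical_group t n" by (rule group_mult[OF Qa dG])
  note xc = group_carrier[OF xG]
  have "mat_inv (ac_mat Q * dmat d) * map_mat \<sigma> (ac_mat Q * dmat d) \<in> C" if s: "\<sigma> \<in> galois_group" for \<sigma>
  proof -
    define c where "c i = \<sigma> (d i) / d i" for i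
    have d0: "d i \<noteq> 0" if "i < m" for i by (rule torus_nz[OF dG that])
    have dd: "d i * d (opp i) = 1" if "i < m" for i by (rule dmat_groupD(1)[OF dG that])
    have eq: "map_mat \<sigma> (ac_mat Q * dmat d) = ac_mat Q * dmat d * dmat c"
    proof (rule eq_matI)
      fix i j assume "i < dim_row (ac_mat Q * dmat d * dmat c)" "j < dim_col (ac_mat Q * dmat d * dmat c)"
      hence ij: "i < m" "j < m" using Qac by (auto simp: dmat_def)
      have "map_mat \<sigma> (ac_mat Q * dmat d) $$ (i, j) = \<sigma> ((ac_mat Q * dmat d) $$ (i, j))"
        by (rule index_map_mat(1)) (simp_all only: carrier_matD[OF xc] ij)
      also have "\<dots> = ac_mat Q $$ (i, j) * \<sigma> (d j)"
        unfolding mult_dmat_index[OF Qac ij] galois_hom(1)[OF s] using Qc ij by (simp add: galois_hom(2)[OF s])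
      also have "\<dots> = (ac_mat Q * dmat d * dmat c) $$ (i, j)"
        unfolding mult_dmat_index[OF xc ij] mult_dmat_index[OF Qac ij] using d0[OF ij(2)] by (simp add: c_def)
      finally show "map_mat \<sigma> (ac_mat Q * dmat d) $$ (i, j) = (ac_mat Q * dmat d * dmat c) $$ (i, j)" .
    qed (use xc in \<open>auto simp: dmat_def\<close>)
    have "mat_inv (ac_mat Q * dmat d) * map_mat \<sigma> (ac_mat Q * dmat d) = mat_inv (ac_mat Q * dmat d) * (ac_mat Q * dmat d) * dmat c"
      unfolding eq by (rule assoc_mult_mat[OF group_inv(1)[OF xG] xc dmat(1), symmetric])
    also have "\<dots> = dmat c" unfolding group_inv(3)[OF xG] by (rule left_mult_one_mat[OF dmat(1)])
    also have "dmat c \<in> C"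
      unfolding centralizer_iff
    proof (intro conjI ballI)
      show "dmat c \<in> classical_group t n" unfolding dmat_group
      proof (intro conjI allI impI)
        fix i assume i: "i < m"
        have "c i * c (opp i) = \<sigma> (d i * d (opp i)) / (d i * d (opp i))" by (simp add: c_def galois_hom(1)[OF s])
        thus "c i * c (opp i) = 1" unfolding dd[OF i] using galois_hom(4)[OF s] by simp
      next
        assume isB
        hence "d n = 1" by (rule dmat_groupD(2)[OF dG])
        thus "c n = 1" unfolding c_def by (simp only: galois_hom(4)[OF s] div_by_1)
      qed
      fix k assume k: "k \<in> G1"
      have kn: "k \<in> {1..n}" "\<tau> k \<in> {1..n}" using G1_n[OF k] by auto
      have scs: "sc (dmat c) l = \<sigma> (sc (dmat d) l) / sc (dmat d) l" if "l \<in> {1..n}" for l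
        unfolding sc_dmat[OF that] galois_hom(6)[OF s] by (simp add: c_def)
      have r: "sc (dmat d) k / sc (dmat d) (\<tau> k) \<in> rat" using d k unfolding torus_cocycle_def by blast
      have "\<sigma> (sc (dmat d) k) / \<sigma> (sc (dmat d) (\<tau> k)) = sc (dmat d) k / sc (dmat d) (\<tau> k)"
        using r s unfolding rat_iff galois_hom(6)[OF s, symmetric] by blast
      moreover have "sc (dmat d) k \<noteq> 0" "sc (dmat d) (\<tau> k) \<noteq> 0" using sc_nz[OF dG] kn by blast+
      moreover have "\<sigma> (sc (dmat d) (\<tau> k)) \<noteq> 0" using calculation(3) galois_hom(5)[OF s] by blast
      ultimately show "sc (dmat c) k = sc (dmat c) (\<tau> k)"
        unfolding scs[OF kn(1)] scs[OF kn(2)] by (simp add: field_simps)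
    qed simp
    finally show ?thesis .
  qed
  thus ?thesis using xG unfolding bd_cocycles_def by simp
qed

text \<open>If P in G(F) realizes the equivalence, the rational matrix
  \<open>mat_inv Q * P * Q'\<close> is a product of torus elements and thus a rational torus
  element, while factors from C(r) leave the ratios unchanged. Conversely, a rational torus element
  with the right ratios is transported back to G(F) by \<open>Q\<close> and
  \<open>Q'\<close>.\<close>

lemma equiv_iff:
  assumes Q: "Q \<in> classical_group t n" "Q' \<in> classical_group t n" and d: "torus_cocycle d" "torus_cocycle d'"
  shows "(ac_mat Q * dmat d, ac_mat Q' * dmat d') \<in> bd_equiv t n r \<longleftrightarrow>
    (\<exists>a. base.dmat a \<in> classical_group t n \<and>
      (\<forall>k\<in>G1. sc (dmat d) k / sc (dmat d) (\<tau> k) = sc (dmat d') k / sc (dmat d') (\<tau> k) * to_ac (base.sc (base.dmat a) k / base.sc (base.dmat a) (\<tau> k))))"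
    (is "?L \<longleftrightarrow> ?R")
proof -
  have dG: "dmat d \<in> classical_group t n" "dmat d' \<in> classical_group t n" using d by (auto simp: torus_cocycle_def)
  have Qa: "ac_mat Q \<in> classical_group t n" "ac_mat Q' \<in> classical_group t n"
    using ac_mat_group[OF group_carrier[OF Q(1)]] ac_mat_group[OF group_carrier[OF Q(2)]] Q by blast+
  have acd: "ac_mat (base.dmat a) = dmat (\<lambda>i. to_ac (a i))" for a
    by (rule eq_matI) (auto simp: dmat_def base.dmat_def)
  have scac: "sc (dmat (\<lambda>i. to_ac (a i))) k = to_ac (base.sc (base.dmat a) k)" if "k \<in> {1..n}" for a k
    by (simp add: sc_dmat[OF that] base.sc_dmat[OF that])
  have scm: "sc (dmat (\<lambda>i. a i * b i)) k = sc (dmat a) k * sc (dmat b) k" if "k \<in> {1..n}" for a b k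
    by (simp add: sc_dmat[OF that])
  have ratio: "(sc (dmat c) k = sc (dmat c) (\<tau> k)) \<longleftrightarrow>
      sc (dmat d) k / sc (dmat d) (\<tau> k) = sc (dmat d') k / sc (dmat d') (\<tau> k) * to_ac (base.sc (base.dmat a) k / base.sc (base.dmat a) (\<tau> k))"
    if k: "k \<in> G1" and cG: "dmat c \<in> classical_group t n" and aG: "dmat (\<lambda>i. to_ac (a i)) \<in> classical_group t n"
      and de: "dmat d = dmat (\<lambda>i. to_ac (a i) * d' i * c i)" for k c a
  proof -
    have kn: "k \<in> {1..n}" "\<tau> k \<in> {1..n}" using G1_n[OF k] by auto
    have e: "sc (dmat d) l = to_ac (base.sc (base.dmat a) l) * sc (dmat d') l * sc (dmat c) l" if "l \<in> {1..n}" for l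
      unfolding de scm[OF that] scac[OF that] ..
    have nz: "to_ac (base.sc (base.dmat a) l) \<noteq> 0" "sc (dmat d') l \<noteq> 0" "sc (dmat c) l \<noteq> 0" if "l \<in> {1..n}" for l
      using sc_nz[OF aG that] sc_nz[OF dG(2) that] sc_nz[OF cG that] unfolding scac[OF that] by blast+
    define A1 where "A1 = to_ac (base.sc (base.dmat a) k)"
    define A2 where "A2 = to_ac (base.sc (base.dmat a) (\<tau> k))"
    define B1 where "B1 = sc (dmat d') k"
    define B2 where "B2 = sc (dmat d') (\<tau> k)"
    define C1 where "C1 = sc (dmat c) k"
    define C2 where "C2 = sc (dmat c) (\<tau> k)"
    have "A1 \<noteq> 0" "A2 \<noteq> 0" "B1 \<noteq> 0" "B2 \<noteq> 0" "C1 \<noteq> 0" "C2 \<noteq> 0"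
      unfolding A1_def A2_def B1_def B2_def C1_def C2_def using nz kn by blast+
    hence "C1 = C2 \<longleftrightarrow> A1 * B1 * C1 / (A2 * B2 * C2) = B1 / B2 * (A1 / A2)"
      by (simp add: field_simps)
    thus ?thesis
      unfolding e[OF kn(1)] e[OF kn(2)] to_ac_divide A1_def A2_def B1_def B2_def C1_def C2_def .
  qed
  show ?thesis
  proof
    assume ?L
    then obtain P c where P: "P \<in> classical_group t n" and cC: "c \<in> C"
      and eq: "ac_mat Q * dmat d = ac_mat P * (ac_mat Q' * dmat d') * c" unfolding bd_equiv_def by blast
    have cG: "c \<in> classical_group t n" "diagonal_mat c" "\<forall>k\<in>G1. sc c k = sc c (\<tau> k)" using cC unfolding centralizer_iff by blast+
    define cc where "cc i = c $$ (i, i)" for i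
    have cd: "c = dmat cc" unfolding cc_def by (rule diag_dmat[OF group_carrier[OF cG(1)] cG(2)])
    have c0: "cc i \<noteq> 0" if "i < m" for i using torus_nz[of cc i] cG(1) that unfolding cd by blast
    define A where "A = mat_inv Q * P * Q'"
    have AG: "A \<in> classical_group t n" unfolding A_def by (intro group_mult group_mat_inv Q P)
    note cA = group_carrier[OF AG] and cQ = group_carrier[OF Q(1)] and cQ' = group_carrier[OF Q(2)] and cP = group_carrier[OF P]
    have QA: "Q * A = P * Q'"
    proof -
      note Y = group_inv[OF Q(1)]
      have "Q * A = Q * (mat_inv Q * (P * Q'))" unfolding A_def by (simp only: assoc_mult_mat[OF Y(1) cP cQ'])
      also have "\<dots> = Q * mat_inv Q * (P * Q')" by (rule assoc_mult_mat[OF cQ Y(1) mult_carrier_mat[OF cP cQ'], symmetric])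
      also have "\<dots> = P * Q'" unfolding Y(2) by (rule left_mult_one_mat[OF mult_carrier_mat[OF cP cQ']])
      finally show ?thesis .
    qed
    have aA: "ac_mat A \<in> carrier_mat m m" "ac_mat Q \<in> carrier_mat m m" "ac_mat Q' \<in> carrier_mat m m" "ac_mat P \<in> carrier_mat m m"
      using cA cQ cQ' cP by auto
    have "ac_mat Q * dmat d = ac_mat P * ac_mat Q' * (dmat d' * dmat cc)"
    proof -
      have "ac_mat Q * dmat d = ac_mat P * ac_mat Q' * dmat d' * dmat cc"
        unfolding eq cd by (simp only: assoc_mult_mat[OF aA(4,3) dmat(1)])
      also have "\<dots> = ac_mat P * ac_mat Q' * (dmat d' * dmat cc)"
        by (rule assoc_mult_mat[OF mult_carrier_mat[OF aA(4,3)] dmat(1) dmat(1)])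
      finally show ?thesis .
    qed
    also have "\<dots> = ac_mat Q * ac_mat A * (dmat d' * dmat cc)"
      unfolding ac_mat_mult[OF cP cQ', symmetric] ac_mat_mult[OF cQ cA, symmetric] QA ..
    also have "\<dots> = ac_mat Q * (ac_mat A * (dmat d' * dmat cc))"
      by (rule assoc_mult_mat[OF aA(2,1) mult_carrier_mat[OF dmat(1) dmat(1)]])
    finally have "mat_inv (ac_mat Q) * (ac_mat Q * dmat d) = mat_inv (ac_mat Q) * (ac_mat Q * (ac_mat A * (dmat d' * dmat cc)))" by simp
    hence "mat_inv (ac_mat Q) * ac_mat Q * dmat d = mat_inv (ac_mat Q) * ac_mat Q * (ac_mat A * (dmat d' * dmat cc))"
      using assoc_mult_mat[OF group_inv(1)[OF Qa(1)] aA(2) dmat(1)]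
        assoc_mult_mat[OF group_inv(1)[OF Qa(1)] aA(2) mult_carrier_mat[OF aA(1) mult_carrier_mat[OF dmat(1) dmat(1)]]] by simp
    hence DA: "dmat d = ac_mat A * dmat (\<lambda>i. d' i * cc i)"
      unfolding group_inv(3)[OF Qa(1)] dmat_mult left_mult_one_mat[OF dmat(1)] left_mult_one_mat[OF mult_carrier_mat[OF aA(1) dmat(1)]] .
    have ent: "dmat d $$ (i, j) = to_ac (A $$ (i, j)) * (d' j * cc j)" if "i < m" "j < m" for i j
      unfolding DA mult_dmat_index[OF aA(1) that] using cA that by simp
    have off: "A $$ (i, j) = 0" if ij: "i < m" "j < m" "i \<noteq> j" for i j
      using ent[OF ij(1,2)] ij c0[OF ij(2)] torus_nz[OF dG(2) ij(2)] by (simp add: dmat_index)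
    have "diagonal_mat A" using off cA unfolding diagonal_mat_def by auto
    hence Ad: "A = base.dmat (\<lambda>i. A $$ (i, i))" by (rule base.diag_dmat[OF cA])
    define a where "a i = A $$ (i, i)" for i
    have aG: "base.dmat a \<in> classical_group t n" using AG Ad unfolding a_def by simp
    have aG': "dmat (\<lambda>i. to_ac (a i)) \<in> classical_group t n"
      using ac_mat_group[OF group_carrier[OF aG]] aG unfolding acd by blast
    have de: "dmat d = dmat (\<lambda>i. to_ac (a i) * d' i * cc i)"
    proof (rule eq_matI)
      fix i j assume "i < dim_row (dmat (\<lambda>i. to_ac (a i) * d' i * cc i))" "j < dim_col (dmat (\<lambda>i. to_ac (a i) * d' i * cc i))"
      hence ij: "i < m" "j < m" by (simp_all add: dmat_def)
      show "dmat d $$ (i, j) = dmat (\<lambda>i. to_ac (a i) * d' i * cc i) $$ (i, j)"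
      proof (cases "i = j")
        case True
        show ?thesis unfolding ent[OF ij] unfolding dmat_index[OF ij] using True by (simp add: a_def)
      qed (simp add: dmat_index[OF ij])
    qed (simp_all add: dmat_def)
    have "\<forall>k\<in>G1. sc (dmat d) k / sc (dmat d) (\<tau> k) = sc (dmat d') k / sc (dmat d') (\<tau> k) * to_ac (base.sc (base.dmat a) k / base.sc (base.dmat a) (\<tau> k))"
      using ratio[OF _ _ aG' de] cG unfolding cd by blast
    thus ?R using aG by blast
  next
    assume ?R
    then obtain a where aG: "base.dmat a \<in> classical_group t n" and
      a: "\<forall>k\<in>G1. sc (dmat d) k / sc (dmat d) (\<tau> k) = sc (dmat d') k / sc (dmat d') (\<tau> k) * to_ac (base.sc (base.dmat a) k / base.sc (base.dmat a) (\<tau> k))"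
      by blast
    have aG': "dmat (\<lambda>i. to_ac (a i)) \<in> classical_group t n"
      using ac_mat_group[OF group_carrier[OF aG]] aG unfolding acd by blast
    \<comment> \<open>The torus factor left over after the rational one; equality of the ratios says
      that it lies in C(r).\<close>
    define c where "c i = d i / (to_ac (a i) * d' i)" for i
    have n0: "d i \<noteq> 0" "d' i \<noteq> 0" "to_ac (a i) \<noteq> 0" if "i < m" for i
      using torus_nz[OF dG(1) that] torus_nz[OF dG(2) that] torus_nz[OF aG' that] by blast+
    have cG: "dmat c \<in> classical_group t n"
    proof -
      have h: "d i * d (opp i) = 1" "d' i * d' (opp i) = 1" "to_ac (a i) * to_ac (a (opp i)) = 1" if "i < m" for i
        using dmat_groupD(1)[OF dG(1) that] dmat_groupD(1)[OF dG(2) that] dmat_groupD(1)[OF aG' that] .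
      have "c i * c (opp i) = 1" if i: "i < m" for i
      proof -
        have "c i * c (opp i) = (d i * d (opp i)) / ((to_ac (a i) * to_ac (a (opp i))) * (d' i * d' (opp i)))"
          by (simp add: c_def mult_ac)
        thus ?thesis unfolding h[OF i] by simp
      qed
      moreover have "c n = 1" if isB
        unfolding c_def dmat_groupD(2)[OF dG(1) that] dmat_groupD(2)[OF dG(2) that] dmat_groupD(2)[OF aG' that] by simp
      ultimately show ?thesis unfolding dmat_group by (intro conjI allI impI)
    qed
    have de: "dmat d = dmat (\<lambda>i. to_ac (a i) * d' i * c i)"
    proof (rule eq_matI)
      fix i j assume "i < dim_row (dmat (\<lambda>i. to_ac (a i) * d' i * c i))" "j < dim_col (dmat (\<lambda>i. to_ac (a i) * d' i * c i))"
      hence ij: "i < m" "j < m" by (simp_all add: dmat_def)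
      show "dmat d $$ (i, j) = dmat (\<lambda>i. to_ac (a i) * d' i * c i) $$ (i, j)"
        unfolding dmat_index[OF ij] c_def using n0[OF ij(1)] n0[OF ij(2)] by simp
    qed (simp_all add: dmat_def)
    have cC: "dmat c \<in> C"
      unfolding centralizer_iff using cG ratio[OF _ cG aG' de] a by simp
    define P where "P = Q * base.dmat a * mat_inv Q'"
    have PG: "P \<in> classical_group t n" unfolding P_def by (intro group_mult group_mat_inv Q aG)
    note cQ = group_carrier[OF Q(1)] and cQ' = group_carrier[OF Q(2)] and cP = group_carrier[OF PG] and Y = group_inv[OF Q(2)]
    have PQ: "P * Q' = Q * base.dmat a"
    proof -
      note cQa = mult_carrier_mat[OF cQ base.dmat(1)]
      have "P * Q' = Q * base.dmat a * (mat_inv Q' * Q')" unfolding P_def by (rule assoc_mult_mat[OF cQa Y(1) cQ'])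
      also have "\<dots> = Q * base.dmat a" unfolding Y(3) by (rule right_mult_one_mat[OF cQa])
      finally show ?thesis .
    qed
    have aQ: "ac_mat Q \<in> carrier_mat m m" "ac_mat Q' \<in> carrier_mat m m" "ac_mat P \<in> carrier_mat m m"
      using cQ cQ' cP by auto
    have "ac_mat P * (ac_mat Q' * dmat d') * dmat c = ac_mat P * ac_mat Q' * dmat d' * dmat c"
      by (simp only: assoc_mult_mat[OF aQ(3,2) dmat(1)])
    also have "ac_mat P * ac_mat Q' = ac_mat Q * dmat (\<lambda>i. to_ac (a i))"
      unfolding ac_mat_mult[OF cP cQ', symmetric] PQ ac_mat_mult[OF cQ base.dmat(1)] acd ..
    also have "ac_mat Q * dmat (\<lambda>i. to_ac (a i)) * dmat d' * dmat c = ac_mat Q * dmat d"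
      unfolding assoc_mult_mat[OF aQ(1) dmat(1) dmat(1)] dmat_mult de ..
    finally have "ac_mat Q * dmat d = ac_mat P * (ac_mat Q' * dmat d') * dmat c" by (rule sym)
    thus ?L unfolding bd_equiv_def using torus_cocycle_in[OF Q(1) d(1)] torus_cocycle_in[OF Q(2) d(2)] PG cC by blast
  qed
qed

end

section \<open>The two characters at the fork of type D\<close>

context classical_type
begin

text \<open>Both roots sit in row n - 2, whose entry cancels; what remains is
  \<open>d (n - 1) / d n\<close>, and these two entries are inverse to each other.\<close>

lemma sc_last_two:
  assumes D: isD and d: "dmat (d :: nat \<Rightarrow> 'k) \<in> classical_group t n"
  shows "sc (dmat d) n / sc (dmat d) (n - 1) = (d (n - 1))\<^sup>2"
proof -
  have n3: "3 \<le> n" by (rule rank_D'[OF D])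
  have l: "n - 1 < m" "opp (n - 1) = n" using m_D[OF D] n3 by (simp_all add: opp_def)
  have dd: "d (n - 1) * d n = 1" using d l unfolding dmat_group by metis
  hence nz: "d n \<noteq> 0" "d (n - 1) \<noteq> 0" by auto
  have dm: "dmat d \<in> classical_group t n \<Longrightarrow> i < m \<Longrightarrow> d i \<noteq> 0" for i
    using torus_mult(2)[of "dmat d" i] by simp
  have r: "simple_row n = n - 2" "simple_row (n - 1) = n - 2" using D n3 by (auto simp: simple_row_def numeral_2_eq_2)
  have "n - 2 < m" using m_D[OF D] n3 by simp
  hence n2: "d (n - 2) \<noteq> 0" using dm[OF d] by simp
  have "n \<in> {1..n}" "n - 1 \<in> {1..n}" using n3 by auto
  hence "sc (dmat d) n / sc (dmat d) (n - 1) = (d (n - 2) / d n) / (d (n - 2) / d (n - 1))"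
    by (simp only: sc_dmat r)
  also have "\<dots> = d (n - 1) / d n" using n2 by simp
  also have "\<dots> = (d (n - 1))\<^sup>2" using dd nz by (simp add: divide_eq_eq power2_eq_square mult.assoc)
  finally show ?thesis .
qed

end

lemma to_ac_inject: "to_ac x = to_ac y \<longleftrightarrow> x = y"
  by simp

section \<open>Orbits of simple roots and classes of torus cocycles\<close>

context bd_cohomology_data
begin

text \<open>Since \<tau> is an injective partial map, being joined by a path in one of the two
  directions is the relation of lying in the same orbit.\<close>

definition conn :: "nat \<Rightarrow> nat \<Rightarrow> bool" where "conn x y \<longleftrightarrow> (x, y) \<in> T\<^sup>* \<or> (y, x) \<in> T\<^sup>*"

lemma conn_refl: "conn x x" and conn_sym: "conn x y \<Longrightarrow> conn y x"
  by (auto simp: conn_def)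

text \<open>Uniqueness of the image handles the paths that leave \<open>k\<close>, injectivity of
  \<tau> those that arrive at \<open>\<tau> k\<close>.\<close>

lemma conn_tau:
  assumes k: "k \<in> G1"
  shows "conn k y \<longleftrightarrow> conn (\<tau> k) y"
proof -
  have kt: "(k, \<tau> k) \<in> T" using k by (simp add: tau_graph_iff)
  show ?thesis
  proof
    assume "conn k y"
    then consider "(k, y) \<in> T\<^sup>*" | "(y, k) \<in> T\<^sup>*" unfolding conn_def by (elim disjE)
    thus "conn (\<tau> k) y"
    proof cases
      case 1
      thus ?thesis
      proof (cases rule: converse_rtranclE)
        case base
        hence "(y, \<tau> k) \<in> T\<^sup>*" using kt by (simp add: r_into_rtrancl)
        thus ?thesis unfolding conn_def by (rule disjI2)
      next
        case (step z)
        have "z = \<tau> k" using step(1) by (simp add: tau_graph_iff)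
        hence "(\<tau> k, y) \<in> T\<^sup>*" using step(2) by simp
        thus ?thesis unfolding conn_def by (rule disjI1)
      qed
    next
      case 2
      have "(y, \<tau> k) \<in> T\<^sup>*" by (rule rtrancl_into_rtrancl[OF 2 kt])
      thus ?thesis unfolding conn_def by (rule disjI2)
    qed
  next
    assume "conn (\<tau> k) y"
    then consider "(\<tau> k, y) \<in> T\<^sup>*" | "(y, \<tau> k) \<in> T\<^sup>*" unfolding conn_def by (elim disjE)
    thus "conn k y"
    proof cases
      case 1
      have "(k, y) \<in> T\<^sup>*" by (rule converse_rtrancl_into_rtrancl[OF kt 1])
      thus ?thesis unfolding conn_def by (rule disjI1)
    next
      case 2
      thus ?thesis
      proof (cases rule: rtranclE)
        case base
        hence "(k, y) \<in> T\<^sup>*" using kt by (simp add: r_into_rtrancl)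
        thus ?thesis unfolding conn_def by (rule disjI1)
      next
        case (step z)
        have "z \<in> G1" "\<tau> k = \<tau> z" using step(2) by (simp_all add: tau_graph_iff)
        hence "z = k" using tau_inj[of k z] k by simp
        hence "(y, k) \<in> T\<^sup>*" using step(1) by simp
        thus ?thesis unfolding conn_def by (rule disjI2)
      qed
    qed
  qed
qed

lemma conn_range:
  assumes "conn x y" "x \<in> {1..n}"
  shows "y \<in> {1..n}"
proof -
  consider "(x, y) \<in> T\<^sup>*" | "(y, x) \<in> T\<^sup>*" using assms(1) unfolding conn_def by (elim disjE)
  thus ?thesis
  proof cases
    case 1
    thus ?thesis by (cases rule: rtranclE) (use assms(2) T_sub in blast)+
  next
    case 2
    thus ?thesis by (cases rule: converse_rtranclE) (use assms(2) T_sub in blast)+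
  qed
qed

lemma conn_invariant:
  assumes f: "\<And>k. k \<in> G1 \<Longrightarrow> f k = f (\<tau> k)" and c: "conn x y"
  shows "f x = f y"
proof -
  have *: "f x = f y" if "(x, y) \<in> T\<^sup>*" for x y
    using that
  proof (induction rule: rtrancl_induct)
    case (step y z)
    thus ?case using f[of y] by (simp add: tau_graph_iff)
  qed simp
  from c consider "(x, y) \<in> T\<^sup>*" | "(y, x) \<in> T\<^sup>*" unfolding conn_def by (elim disjE)
  thus ?thesis by cases (use * in simp_all)
qed

text \<open>The definition gives rational ratios for single steps of \<tau>; along an orbit they
  multiply, and a backward path gives the inverse.\<close>

lemma ratio_rat:
  assumes d: "torus_cocycle d" and c: "conn x y" "x \<in> {1..n}"
  shows "sc (dmat d) x / sc (dmat d) y \<in> rat"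
proof -
  have dG: "dmat d \<in> classical_group t n" using d by (simp add: torus_cocycle_def)
  have *: "sc (dmat d) x / sc (dmat d) y \<in> rat" if "(x, y) \<in> T\<^sup>*" "x \<in> {1..n}" for x y
    using that
  proof (induction rule: rtrancl_induct)
    case base
    thus ?case using sc_nz[OF dG] rat_1 by simp
  next
    case (step y z)
    have y: "y \<in> G1" "z = \<tau> y" using step(2) by (simp_all add: tau_graph_iff)
    have "sc (dmat d) x / sc (dmat d) y * (sc (dmat d) y / sc (dmat d) z) \<in> rat"
      by (rule rat_mult[OF step.IH[OF step.prems]]) (use d y in \<open>simp add: torus_cocycle_def\<close>)
    thus ?case using sc_nz[OF dG] G1_n[OF y(1)] by simp
  qed
  from c(1) consider "(x, y) \<in> T\<^sup>*" | "(y, x) \<in> T\<^sup>*" unfolding conn_def by (elim disjE)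
  thus ?thesis
  proof cases
    case 1
    thus ?thesis using * c(2) by blast
  next
    case 2
    have "inverse (sc (dmat d) y / sc (dmat d) x) \<in> rat"
      by (rule rat_inverse[OF *[OF 2 conn_range[OF c]]])
    thus ?thesis by simp
  qed
qed

text \<open>A representative of each \<open>\<tau>\<close>-orbit, normalized at the two ends of the fork in type \<open>D\<close>.\<close>

definition orbit_rep :: "nat \<Rightarrow> nat" where
  "orbit_rep k = (if conn k n then n else if conn k (n - 1) then n - 1 else (SOME y. conn k y))"

lemma orbit_rep_tau: "k \<in> G1 \<Longrightarrow> orbit_rep k = orbit_rep (\<tau> k)"
  by (simp only: orbit_rep_def conn_tau)

lemma conn_orbit_rep: "conn k (orbit_rep k)"
  using someI[of "conn k" k] conn_refl by (simp add: orbit_rep_def)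

text \<open>Dividing each simple character by its value at the orbit representative gives rational
  values \<open>v\<close> with the same ratios along \<tau>. A rational torus element realizes them
  once its last coordinate s exists. As \<open>v n\<close> is 1, s = 1 works unless n - 1 and n
  share an orbit in type D; then \<open>v (n - 1)\<close> is the inverse square of
  \<open>d (n - 1)\<close>, and the hypothesis supplies s.\<close>

lemma torus_cocycle_trivial:
  assumes d: "torus_cocycle d"
    and s: "isD \<Longrightarrow> conn (n - 1) n \<Longrightarrow> \<exists>s. (to_ac s)\<^sup>2 = (d (n - 1))\<^sup>2"
  obtains a where "base.dmat a \<in> classical_group t n"
    "\<And>k. k \<in> G1 \<Longrightarrow> sc (dmat d) k / sc (dmat d) (\<tau> k) = to_ac (base.sc (base.dmat a) k / base.sc (base.dmat a) (\<tau> k))"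
proof -
  have dG: "dmat d \<in> classical_group t n" using d by (simp add: torus_cocycle_def)
  have n1: "n \<in> {1..n}" using rank_pos by simp
  define v where "v k = of_ac (sc (dmat d) k / sc (dmat d) (orbit_rep k))" for k
  have v: "to_ac (v k) = sc (dmat d) k / sc (dmat d) (orbit_rep k)" if "k \<in> {1..n}" for k
    unfolding v_def by (rule to_ac_of_ac[OF ratio_rat[OF d conn_orbit_rep that]])
  have repn: "orbit_rep k \<in> {1..n}" if "k \<in> {1..n}" for k by (rule conn_range[OF conn_orbit_rep that])
  have "to_ac (v k) \<noteq> 0" if "k \<in> {1..n}" for k
    unfolding v[OF that] using sc_nz[OF dG that] sc_nz[OF dG repn[OF that]] by simp
  hence v0: "v k \<noteq> 0" if "k \<in> {1..n}" for k using that to_ac_0 by metis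
  have "to_ac (v n) = 1" unfolding v[OF n1] using sc_nz[OF dG n1] conn_refl by (simp add: orbit_rep_def)
  hence vn: "v n = 1" by simp
  have "\<exists>s. s \<noteq> 0 \<and> (isB \<longrightarrow> s = v n) \<and> (isC \<longrightarrow> s\<^sup>2 = v n) \<and> (isD \<longrightarrow> s\<^sup>2 * v (n - 1) = v n)"
  proof (cases "isD \<and> conn (n - 1) n")
    case True
    then obtain s where s: "(to_ac s)\<^sup>2 = (d (n - 1))\<^sup>2" using assms(2) by blast
    have D: isD using True by simp
    have n3: "3 \<le> n" by (rule rank_D'[OF D])
    hence p: "n - 1 \<in> {1..n}" "n - 1 < m" using m_D[OF D] by auto
    have "to_ac s \<noteq> 0" using s torus_nz[OF dG p(2)] by auto
    hence s0: "s \<noteq> 0" by auto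
    have "to_ac (v (n - 1)) = sc (dmat d) (n - 1) / sc (dmat d) n"
      unfolding v[OF p(1)] using True by (simp add: orbit_rep_def)
    also have "\<dots> = inverse ((d (n - 1))\<^sup>2)" unfolding sc_last_two[OF D dG, symmetric] by simp
    finally have "to_ac (s\<^sup>2 * v (n - 1)) = to_ac 1"
      using s torus_nz[OF dG p(2)] by simp
    hence "s\<^sup>2 * v (n - 1) = v n" unfolding vn to_ac_inject .
    moreover have "\<not> isB" "\<not> isC" using D type_cases by blast+
    ultimately show ?thesis using s0 by (intro exI[of _ s]) simp
  next
    case False
    have "v (n - 1) = 1" if D: isD
    proof -
      have p: "n - 1 \<in> {1..n}" using rank_D'[OF D] by auto
      have "\<not> conn (n - 1) n" using False D by simp
      hence "to_ac (v (n - 1)) = 1"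
        unfolding v[OF p] using conn_refl sc_nz[OF dG p] by (simp add: orbit_rep_def)
      thus ?thesis by simp
    qed
    thus ?thesis using vn by (intro exI[of _ 1]) simp
  qed
  then obtain s where s: "s \<noteq> 0" "isB \<Longrightarrow> s = v n" "isC \<Longrightarrow> s\<^sup>2 = v n" "isD \<Longrightarrow> s\<^sup>2 * v (n - 1) = v n" by blast
  obtain a where a: "base.dmat a \<in> classical_group t n" "\<And>k. k \<in> {1..n} \<Longrightarrow> base.sc (base.dmat a) k = v k"
    using base.torus_exists[of v s, OF v0 s] by blast
  have "sc (dmat d) k / sc (dmat d) (\<tau> k) = to_ac (base.sc (base.dmat a) k / base.sc (base.dmat a) (\<tau> k))"
    if k: "k \<in> G1" for k
  proof -
    have kn: "k \<in> {1..n}" "\<tau> k \<in> {1..n}" using G1_n[OF k] by auto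
    show ?thesis
      unfolding a(2)[OF kn(1)] a(2)[OF kn(2)] to_ac_divide v[OF kn(1)] v[OF kn(2)] orbit_rep_tau[OF k]
      using sc_nz[OF dG repn[OF kn(2)]] by simp
  qed
  thus ?thesis using that a(1) by blast
qed

text \<open>The entrywise quotient of two torus cocycles is again one, and the two are equivalent as
  soon as this quotient has the ratios of a rational torus element.\<close>

lemma bd_equivI:
  assumes Q: "Q \<in> classical_group t n" "Q' \<in> classical_group t n" and d: "torus_cocycle d" "torus_cocycle d'"
    and s: "isD \<Longrightarrow> conn (n - 1) n \<Longrightarrow> \<exists>s. (d (n - 1))\<^sup>2 = (to_ac s)\<^sup>2 * (d' (n - 1))\<^sup>2"
  shows "(ac_mat Q * dmat d, ac_mat Q' * dmat d') \<in> bd_equiv t n r"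
proof -
  have dG: "dmat d \<in> classical_group t n" "dmat d' \<in> classical_group t n" using d by (auto simp: torus_cocycle_def)
  define \<delta> where "\<delta> i = d i / d' i" for i
  have scd: "sc (dmat \<delta>) k = sc (dmat d) k / sc (dmat d') k" if "k \<in> {1..n}" for k
    by (simp add: sc_dmat[OF that] \<delta>_def)
  have \<delta>G: "dmat \<delta> \<in> classical_group t n"
    unfolding dmat_group
  proof (intro conjI allI impI)
    fix i assume i: "i < m"
    have "\<delta> i * \<delta> (opp i) = (d i * d (opp i)) / (d' i * d' (opp i))" by (simp add: \<delta>_def)
    thus "\<delta> i * \<delta> (opp i) = 1" unfolding dmat_groupD(1)[OF dG(1) i] dmat_groupD(1)[OF dG(2) i] by simp
  next
    assume B: isB
    show "\<delta> n = 1" unfolding \<delta>_def dmat_groupD(2)[OF dG(1) B] dmat_groupD(2)[OF dG(2) B] by simp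
  qed
  have \<delta>: "torus_cocycle \<delta>"
    unfolding torus_cocycle_def
  proof (intro conjI ballI)
    fix k assume k: "k \<in> G1"
    have kn: "k \<in> {1..n}" "\<tau> k \<in> {1..n}" using G1_n[OF k] by auto
    have "(sc (dmat d) k / sc (dmat d) (\<tau> k)) / (sc (dmat d') k / sc (dmat d') (\<tau> k)) \<in> rat"
      by (rule rat_divide) (use d k in \<open>simp_all add: torus_cocycle_def\<close>)
    thus "sc (dmat \<delta>) k / sc (dmat \<delta>) (\<tau> k) \<in> rat"
      unfolding scd[OF kn(1)] scd[OF kn(2)] by (simp add: mult.commute)
  qed (rule \<delta>G)
  have s': "\<exists>s. (to_ac s)\<^sup>2 = (\<delta> (n - 1))\<^sup>2" if D: isD and c: "conn (n - 1) n"
  proof -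
    obtain s where s: "(d (n - 1))\<^sup>2 = (to_ac s)\<^sup>2 * (d' (n - 1))\<^sup>2" using assms(5)[OF D c] by blast
    have "n - 1 < m" using m_D[OF D] rank_pos by simp
    hence "d' (n - 1) \<noteq> 0" by (rule torus_nz[OF dG(2)])
    hence "(to_ac s)\<^sup>2 = (\<delta> (n - 1))\<^sup>2" using s unfolding \<delta>_def power_divide by (simp add: eq_divide_eq)
    thus ?thesis by blast
  qed
  obtain a where a: "base.dmat a \<in> classical_group t n"
    "\<And>k. k \<in> G1 \<Longrightarrow> sc (dmat \<delta>) k / sc (dmat \<delta>) (\<tau> k) = to_ac (base.sc (base.dmat a) k / base.sc (base.dmat a) (\<tau> k))"
    using torus_cocycle_trivial[OF \<delta> s'] by blast
  have "sc (dmat d) k / sc (dmat d) (\<tau> k) = sc (dmat d') k / sc (dmat d') (\<tau> k) * to_ac (base.sc (base.dmat a) k / base.sc (base.dmat a) (\<tau> k))"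
    if k: "k \<in> G1" for k
  proof -
    have kn: "k \<in> {1..n}" "\<tau> k \<in> {1..n}" using G1_n[OF k] by auto
    show ?thesis
      unfolding a(2)[OF k, symmetric] scd[OF kn(1)] scd[OF kn(2)]
      using sc_nz[OF dG(2) kn(1)] sc_nz[OF dG(2) kn(2)] by simp
  qed
  thus ?thesis unfolding equiv_iff[OF Q d] using a(1) by blast
qed

lemma one_in_group: "base.dmat (\<lambda>_. 1) \<in> classical_group t n" "dmat (\<lambda>_. 1) \<in> classical_group t n"
  by (simp_all add: base.dmat_group dmat_group)

lemma cohomology_trivial:
  assumes "\<not> (isD \<and> conn (n - 1) n)"
  shows "\<exists>!c. c \<in> bd_cohomology t n r"
  unfolding bd_cohomology_def
proof (rule quotient_trivial)
  have "torus_cocycle (\<lambda>_. 1)"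
    using one_in_group(2) rat_1 G1_n by (auto simp: torus_cocycle_def sc_dmat)
  from torus_cocycle_in[OF one_in_group(1) this] show "Z \<noteq> {}" by blast
  show "bd_equiv t n r \<subseteq> Z \<times> Z" unfolding bd_equiv_def by blast
  fix x y assume "x \<in> Z" "y \<in> Z"
  obtain Q d where x: "Q \<in> classical_group t n" "torus_cocycle d" "x = ac_mat Q * dmat d"
    using cocycle_decomp[OF \<open>x \<in> Z\<close>] by blast
  obtain Q' d' where y: "Q' \<in> classical_group t n" "torus_cocycle d'" "y = ac_mat Q' * dmat d'"
    using cocycle_decomp[OF \<open>y \<in> Z\<close>] by blast
  show "(x, y) \<in> bd_equiv t n r" unfolding x(3) y(3) by (rule bd_equivI[OF x(1) y(1) x(2) y(2)]) (use assms in simp)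
qed

section \<open>The square class invariant when the two ends of the fork share an orbit\<close>

context
  assumes D: isD and c: "conn (n - 1) n"
begin

lemma fork_range: "n - 1 \<in> {1..n}" "n - 1 < m" "n \<in> {1..n}" "n - 1 \<noteq> n"
  using rank_D'[OF D] m_D[OF D] by auto

text \<open>Dividing the simple characters of d by those of d' and of the rational torus element
  gives a function constant along \<tau>. It agrees at n - 1 and n, where the quotient of characters
  is the square of the last coordinate.\<close>

lemma equiv_square:
  assumes Q: "Q \<in> classical_group t n" "Q' \<in> classical_group t n" and d: "torus_cocycle d" "torus_cocycle d'"
  shows "(ac_mat Q * dmat d, ac_mat Q' * dmat d') \<in> bd_equiv t n r \<longleftrightarrow>
    (\<exists>s. s \<noteq> 0 \<and> (d (n - 1))\<^sup>2 = (to_ac s)\<^sup>2 * (d' (n - 1))\<^sup>2)"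
proof
  have dG: "dmat d \<in> classical_group t n" "dmat d' \<in> classical_group t n" using d by (auto simp: torus_cocycle_def)
  assume "(ac_mat Q * dmat d, ac_mat Q' * dmat d') \<in> bd_equiv t n r"
  then obtain a where aG: "base.dmat a \<in> classical_group t n"
    and a: "\<And>k. k \<in> G1 \<Longrightarrow> sc (dmat d) k / sc (dmat d) (\<tau> k) = sc (dmat d') k / sc (dmat d') (\<tau> k) * to_ac (base.sc (base.dmat a) k / base.sc (base.dmat a) (\<tau> k))"
    unfolding equiv_iff[OF Q d] by blast
  have a0: "a i \<noteq> 0" if "i < m" for i using aG that unfolding base.dmat_group by (metis mult_zero_left zero_neq_one)
  have sa: "to_ac (base.sc (base.dmat a) k) \<noteq> 0" if "k \<in> {1..n}" for k
    using a0 simple_row_less[OF that] by (simp add: base.sc_dmat[OF that])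
  define f where "f k = sc (dmat d) k / (sc (dmat d') k * to_ac (base.sc (base.dmat a) k))" for k
  have "f k = f (\<tau> k)" if k: "k \<in> G1" for k
  proof -
    have kn: "k \<in> {1..n}" "\<tau> k \<in> {1..n}" using G1_n[OF k] by auto
    note nz = sc_nz[OF dG(1) kn(1)] sc_nz[OF dG(1) kn(2)] sc_nz[OF dG(2) kn(1)] sc_nz[OF dG(2) kn(2)] sa[OF kn(1)] sa[OF kn(2)]
    have cross: "x1 / (y1 * z1) = x2 / (y2 * z2)" if "x1 / x2 = y1 / y2 * (z1 / z2)"
      "x2 \<noteq> 0" "y1 \<noteq> 0" "y2 \<noteq> 0" "z1 \<noteq> 0" "z2 \<noteq> 0" for x1 x2 y1 y2 z1 z2 :: "'f alg_closure"
      using that by (simp add: field_simps)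
    show ?thesis unfolding f_def by (rule cross[OF a[OF k, unfolded to_ac_divide] nz(2-6)])
  qed
  from conn_invariant[of f, OF this conn_sym[OF c]] have ff: "f n = f (n - 1)" .
  note nz = sc_nz[OF dG(1) fork_range(1)] sc_nz[OF dG(2) fork_range(3)] sc_nz[OF dG(2) fork_range(1)] sa[OF fork_range(3)] sa[OF fork_range(1)]
  have cross: "x1 / x2 = (z1 / z2) * (y1 / y2)" if "x1 / (y1 * z1) = x2 / (y2 * z2)"
    "x2 \<noteq> 0" "y1 \<noteq> 0" "y2 \<noteq> 0" "z1 \<noteq> 0" "z2 \<noteq> 0" for x1 x2 y1 y2 z1 z2 :: "'f alg_closure"
    using that by (simp add: field_simps)
  have "sc (dmat d) n / sc (dmat d) (n - 1) = (to_ac (base.sc (base.dmat a) n) / to_ac (base.sc (base.dmat a) (n - 1))) * (sc (dmat d') n / sc (dmat d') (n - 1))"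
    by (rule cross[OF ff[unfolded f_def] nz])
  hence "(d (n - 1))\<^sup>2 = to_ac ((a (n - 1))\<^sup>2) * (d' (n - 1))\<^sup>2"
    unfolding sc_last_two[OF D dG(1)] sc_last_two[OF D dG(2)] to_ac_divide[symmetric] base.sc_last_two[OF D aG] .
  hence "(d (n - 1))\<^sup>2 = (to_ac (a (n - 1)))\<^sup>2 * (d' (n - 1))\<^sup>2" by simp
  thus "\<exists>s. s \<noteq> 0 \<and> (d (n - 1))\<^sup>2 = (to_ac s)\<^sup>2 * (d' (n - 1))\<^sup>2" using a0[OF fork_range(2)] by blast
next
  assume "\<exists>s. s \<noteq> 0 \<and> (d (n - 1))\<^sup>2 = (to_ac s)\<^sup>2 * (d' (n - 1))\<^sup>2"
  thus "(ac_mat Q * dmat d, ac_mat Q' * dmat d') \<in> bd_equiv t n r"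
    by (intro bd_equivI[OF Q d]) blast
qed

text \<open>The square of the last torus coordinate, which is rational although the coordinate need
  not be. It depends on the chosen decomposition, but its class modulo squares does not.\<close>

definition disc :: "'f alg_closure mat \<Rightarrow> 'f" where
  "disc x = (SOME c. \<exists>Q d. Q \<in> classical_group t n \<and> torus_cocycle d \<and> x = ac_mat Q * dmat d \<and> to_ac c = (d (n - 1))\<^sup>2)"

lemma disc:
  assumes x: "x \<in> Z"
  obtains Q d where "Q \<in> classical_group t n" "torus_cocycle d" "x = ac_mat Q * dmat d"
    "to_ac (disc x) = (d (n - 1))\<^sup>2" "disc x \<noteq> 0"
proof -
  let ?P = "\<lambda>c. \<exists>Q d. Q \<in> classical_group t n \<and> torus_cocycle d \<and> x = ac_mat Q * dmat d \<and> to_ac c = (d (n - 1))\<^sup>2"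
  obtain Q d where q: "Q \<in> classical_group t n" "torus_cocycle d" "x = ac_mat Q * dmat d"
    using cocycle_decomp[OF x] by blast
  have dG: "dmat d \<in> classical_group t n" using q(2) by (simp add: torus_cocycle_def)
  have "(d (n - 1))\<^sup>2 \<in> rat"
    using ratio_rat[OF q(2) conn_sym[OF c] fork_range(3)] unfolding sc_last_two[OF D dG] .
  then obtain z where "(d (n - 1))\<^sup>2 = to_ac z" by (rule imageE)
  hence "?P z" using q by metis
  hence "?P (disc x)" unfolding disc_def by (rule someI)
  then obtain Q' d' where p: "Q' \<in> classical_group t n" "torus_cocycle d'" "x = ac_mat Q' * dmat d'"
    "to_ac (disc x) = (d' (n - 1))\<^sup>2" by (elim exE conjE)
  have "dmat d' \<in> classical_group t n" using p(2) by (simp add: torus_cocycle_def)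
  hence "d' (n - 1) \<noteq> 0" using fork_range(2) by (rule torus_nz)
  hence "to_ac (disc x) \<noteq> 0" unfolding p(4) by simp
  hence "disc x \<noteq> 0" by auto
  thus ?thesis using that p by blast
qed

text \<open>One of the cocycles is given by an explicit decomposition, so that the criterion also
  applies to a cocycle constructed with a prescribed invariant u, which may differ from the chosen
  \<open>disc\<close> by a square.\<close>

lemma equiv_disc:
  assumes Q: "Q \<in> classical_group t n" "torus_cocycle d" "to_ac u = (d (n - 1))\<^sup>2" and y: "y \<in> Z"
  shows "(ac_mat Q * dmat d, y) \<in> bd_equiv t n r \<longleftrightarrow> (\<exists>s. s \<noteq> 0 \<and> u = s\<^sup>2 * disc y)"
proof -
  obtain Q' d' where p: "Q' \<in> classical_group t n" "torus_cocycle d'" "y = ac_mat Q' * dmat d'"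
    "to_ac (disc y) = (d' (n - 1))\<^sup>2" "disc y \<noteq> 0" by (rule disc[OF y])
  have e: "to_ac u = (to_ac s)\<^sup>2 * to_ac (disc y) \<longleftrightarrow> u = s\<^sup>2 * disc y" for s
    unfolding to_ac_power[symmetric] to_ac_mult[symmetric] to_ac_inject ..
  have "(ac_mat Q * dmat d, ac_mat Q' * dmat d') \<in> bd_equiv t n r \<longleftrightarrow> (\<exists>s. s \<noteq> 0 \<and> u = s\<^sup>2 * disc y)"
    unfolding equiv_square[OF Q(1) p(1) Q(2) p(2)] Q(3)[symmetric] p(4)[symmetric] e ..
  thus ?thesis unfolding p(3)[symmetric] .
qed

lemma bd_equiv_disc:
  "bd_equiv t n r = {(x, y). x \<in> Z \<and> y \<in> Z \<and> {s\<^sup>2 * disc x | s. s \<noteq> 0} = {s\<^sup>2 * disc y | s. s \<noteq> 0}}"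
proof -
  have *: "(x, y) \<in> bd_equiv t n r \<longleftrightarrow> {s\<^sup>2 * disc x | s. s \<noteq> 0} = {s\<^sup>2 * disc y | s. s \<noteq> 0}"
    if xy: "x \<in> Z" "y \<in> Z" for x y
  proof -
    obtain Q d where q: "Q \<in> classical_group t n" "torus_cocycle d" "x = ac_mat Q * dmat d"
      "to_ac (disc x) = (d (n - 1))\<^sup>2" and x0: "disc x \<noteq> 0" by (rule disc[OF xy(1)])
    have y0: "disc y \<noteq> 0" by (rule disc[OF xy(2)])
    have "(x, y) \<in> bd_equiv t n r \<longleftrightarrow> (\<exists>s. s \<noteq> 0 \<and> disc x = s\<^sup>2 * disc y)"
      using equiv_disc[OF q(1,2,4) xy(2)] unfolding q(3)[symmetric] .
    thus ?thesis unfolding square_class_eq_iff[OF x0 y0] .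
  qed
  have sub: "bd_equiv t n r \<subseteq> Z \<times> Z" unfolding bd_equiv_def by blast
  have Z: "x \<in> Z" "y \<in> Z" if "(x, y) \<in> bd_equiv t n r" for x y using subsetD[OF sub that] by simp_all
  show ?thesis
  proof (intro equalityI subrelI)
    fix x y assume xy: "(x, y) \<in> bd_equiv t n r"
    thus "(x, y) \<in> {(x, y). x \<in> Z \<and> y \<in> Z \<and> {s\<^sup>2 * disc x | s. s \<noteq> 0} = {s\<^sup>2 * disc y | s. s \<noteq> 0}}"
      unfolding *[OF Z[OF xy]] mem_Collect_eq case_prod_conv using Z[OF xy] by (intro conjI)
  next
    fix x y assume "(x, y) \<in> {(x, y). x \<in> Z \<and> y \<in> Z \<and> {s\<^sup>2 * disc x | s. s \<noteq> 0} = {s\<^sup>2 * disc y | s. s \<noteq> 0}}"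
    hence h: "x \<in> Z \<and> y \<in> Z \<and> {s\<^sup>2 * disc x | s. s \<noteq> 0} = {s\<^sup>2 * disc y | s. s \<noteq> 0}"
      unfolding mem_Collect_eq case_prod_conv .
    show "(x, y) \<in> bd_equiv t n r"
      unfolding *[OF conjunct1[OF h] conjunct1[OF conjunct2[OF h]]] by (rule conjunct2[OF conjunct2[OF h]])
  qed
qed

lemma cohomology_square_classes: "\<exists>f. bij_betw f (bd_cohomology t n r) (square_classes :: 'f set set)"
proof -
  let ?F = "\<lambda>x. {s\<^sup>2 * disc x | s. s \<noteq> 0}"
  have "?F ` Z = square_classes"
    unfolding square_classes_eq
  proof
    show "?F ` Z \<subseteq> (\<lambda>a. {x\<^sup>2 * a | x. x \<noteq> 0}) ` {a. a \<noteq> 0}"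
    proof
      fix w assume "w \<in> ?F ` Z"
      then obtain x where x: "x \<in> Z" "w = ?F x" by (rule imageE)
      have "disc x \<noteq> 0" by (rule disc[OF x(1)])
      thus "w \<in> (\<lambda>a. {x\<^sup>2 * a | x. x \<noteq> 0}) ` {a. a \<noteq> 0}" unfolding x(2) by blast
    qed
    show "(\<lambda>a. {x\<^sup>2 * a | x. x \<noteq> 0}) ` {a. a \<noteq> 0} \<subseteq> ?F ` Z"
    proof
      fix w assume "w \<in> (\<lambda>a. {x\<^sup>2 * a | x. x \<noteq> 0}) ` {a :: 'f. a \<noteq> 0}"
      then obtain u :: 'f where u: "u \<noteq> 0" "w = {x\<^sup>2 * u | x. x \<noteq> 0}" by blast
      obtain q where q: "q\<^sup>2 = to_ac u" using nth_root_exists[of 2 "to_ac u"] by auto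
      have q0: "q \<noteq> 0" using q u(1) by auto
      \<comment> \<open>With last coordinate q, a square root of u, the relation between the two
        ends of the fork holds for the value 1/u at n - 1 and 1 elsewhere. All simple characters are
        then rational, so the torus element is a cocycle even if q is not rational.\<close>
      define v where "v k = (if k = n - 1 then to_ac (inverse u) else 1)" for k
      have v0: "v k \<noteq> 0" for k using u(1) by (simp add: v_def)
      have v: "v k \<in> rat" for k
        unfolding v_def by (cases "k = n - 1") (simp_all only: if_True if_False rat_1 rangeI simp_thms)
      have nb: "\<not> isB" "\<not> isC" using D type_cases by blast+
      have qv: "q\<^sup>2 * v (n - 1) = v n" using q u(1) fork_range(4) by (simp add: v_def)
      obtain d where d: "dmat d \<in> classical_group t n" "\<And>k. k \<in> {1..n} \<Longrightarrow> sc (dmat d) k = v k" "d (n - 1) = q"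
        using torus_exists[of v q, OF v0 q0] nb qv by blast
      have dc: "torus_cocycle d"
        unfolding torus_cocycle_def
      proof (intro conjI ballI)
        fix k assume "k \<in> G1"
        hence kn: "k \<in> {1..n}" "\<tau> k \<in> {1..n}" using G1_n by blast+
        show "sc (dmat d) k / sc (dmat d) (\<tau> k) \<in> rat"
          unfolding d(2)[OF kn(1)] d(2)[OF kn(2)] by (rule rat_divide[OF v v])
      qed (rule d(1))
      let ?x = "ac_mat (base.dmat (\<lambda>_. 1)) * dmat d"
      have xZ: "?x \<in> Z" by (rule torus_cocycle_in[OF one_in_group(1) dc])
      have "to_ac u = (d (n - 1))\<^sup>2" unfolding d(3) q ..
      note eq = equiv_disc[OF one_in_group(1) dc this xZ]
      have "(?x, ?x) \<in> bd_equiv t n r" unfolding bd_equiv_disc using xZ by simp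
      hence us: "\<exists>s. s \<noteq> 0 \<and> u = s\<^sup>2 * disc ?x" unfolding eq .
      have x0: "disc ?x \<noteq> 0" by (rule disc[OF xZ])
      have "w = ?F ?x" unfolding u(2) square_class_eq_iff[OF u(1) x0] by (rule us)
      thus "w \<in> ?F ` Z" using xZ by (rule image_eqI)
    qed
  qed
  thus ?thesis using quotient_by_invariant[OF bd_equiv_disc] unfolding bd_cohomology_def by simp
qed

end

end

text \<open>Negative powers are powers of the converse relation, so the two signs account for the
  two directions of reachability.\<close>

lemma ex_rel_int_pow: "(\<exists>k. (x, y) \<in> rel_int_pow R k) \<longleftrightarrow> (x, y) \<in> R\<^sup>* \<or> (y, x) \<in> R\<^sup>*"
proof
  assume "\<exists>k. (x, y) \<in> rel_int_pow R k"
  then obtain k where k: "(x, y) \<in> rel_int_pow R k" by blast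
  show "(x, y) \<in> R\<^sup>* \<or> (y, x) \<in> R\<^sup>*"
  proof (cases "0 \<le> k")
    case True
    hence "(x, y) \<in> R ^^ nat k" using k by (simp add: rel_int_pow_def)
    thus ?thesis using relpow_imp_rtrancl by blast
  next
    case False
    hence "(x, y) \<in> (R\<inverse>) ^^ nat (- k)" using k by (simp add: rel_int_pow_def)
    hence "(x, y) \<in> (R\<inverse>)\<^sup>*" by (rule relpow_imp_rtrancl)
    thus ?thesis by (simp add: rtrancl_converse)
  qed
next
  assume "(x, y) \<in> R\<^sup>* \<or> (y, x) \<in> R\<^sup>*"
  thus "\<exists>k. (x, y) \<in> rel_int_pow R k"
  proof
    assume "(x, y) \<in> R\<^sup>*"
    then obtain j where "(x, y) \<in> R ^^ j" using rtrancl_imp_relpow by blast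
    hence "(x, y) \<in> rel_int_pow R (int j)" by (simp add: rel_int_pow_def)
    thus ?thesis ..
  next
    assume "(y, x) \<in> R\<^sup>*"
    hence "(x, y) \<in> (R\<inverse>)\<^sup>*" by (simp add: rtrancl_converse)
    then obtain j where j: "(x, y) \<in> (R\<inverse>) ^^ j" using rtrancl_imp_relpow by blast
    have "(x, y) \<in> rel_int_pow R (- int j)"
    \<comment> \<open>For j = 0 the exponent falls into the branch of non-negative powers, where
      both relational powers are the identity.\<close>
    proof (cases "j = 0")
      case False
      thus ?thesis using j by (simp add: rel_int_pow_def)
    qed (use j in \<open>simp add: rel_int_pow_def\<close>)
    thus ?thesis ..
  qed
qed

theorem theorem3p3:
  fixes t :: cartan_type and n :: nat
    and \<Gamma>\<^sub>1 \<Gamma>\<^sub>2 :: "nat set" and \<tau> :: "nat \<Rightarrow> nat"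
    and r :: "'f::field_char_0 alg_closure mat"
  assumes rank: "1 \<le> n" "t = TypeD \<Longrightarrow> 3 \<le> n"
    and triple: "admissible_triple TYPE('f alg_closure) t n \<Gamma>\<^sub>1 \<Gamma>\<^sub>2 \<tau>"
    and r: "bd_r_matrix t n \<Gamma>\<^sub>1 \<Gamma>\<^sub>2 \<tau> r"
  shows "(t = TypeB \<or> t = TypeC \<longrightarrow> (\<exists>!c. c \<in> bd_cohomology t n r)) \<and>
    (t = TypeD \<longrightarrow>
      (if \<exists>k::int. (n - 1, n) \<in> rel_int_pow (tau_graph \<Gamma>\<^sub>1 \<tau>) k
       then \<exists>f. bij_betw f (bd_cohomology t n r) (square_classes :: 'f set set)
       else \<exists>!c. c \<in> bd_cohomology t n r))"
proof -
  obtain e r0 where er: "root_vectors t n \<Gamma>\<^sub>1 \<Gamma>\<^sub>2 \<tau> e" "cartan_part t n \<Gamma>\<^sub>1 \<tau> r0"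
    "r = r0 + mat_sum (std_dim t n * std_dim t n) (\<lambda>a. kron (e (neg_root a)) (e a)) (pos_roots TYPE('f alg_closure) t n)
         + mat_sum (std_dim t n * std_dim t n) (\<lambda>(a, k, b). wedge (e (neg_root a)) (e b))
             {(a, k, b). a \<in> pos_roots TYPE('f alg_closure) t n \<and> supp a \<subseteq> \<Gamma>\<^sub>1 \<and> 1 \<le> k \<and> (a, b) \<in> tau_lin_graph \<Gamma>\<^sub>1 \<tau> ^^ k}"
    using r unfolding bd_r_matrix_def Let_def by (elim exE conjE)
  interpret bd_cohomology_data t n \<Gamma>\<^sub>1 \<Gamma>\<^sub>2 \<tau> e r0 r
    by unfold_locales (fact rank(1) rank(2) triple er)+
  have c: "(\<exists>k. (n - 1, n) \<in> rel_int_pow (tau_graph \<Gamma>\<^sub>1 \<tau>) k) \<longleftrightarrow> conn (n - 1) n"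
    unfolding ex_rel_int_pow conn_def ..
  show ?thesis
  proof (intro conjI impI)
    assume "t = TypeB \<or> t = TypeC"
    hence "\<not> isD" unfolding isD_def by auto
    thus "\<exists>!c. c \<in> bd_cohomology t n r" by (intro cohomology_trivial) simp
  next
    assume "t = TypeD"
    hence D: isD unfolding isD_def .
    show "if \<exists>k. (n - 1, n) \<in> rel_int_pow (tau_graph \<Gamma>\<^sub>1 \<tau>) k
        then \<exists>f. bij_betw f (bd_cohomology t n r) (square_classes :: 'f set set) else \<exists>!c. c \<in> bd_cohomology t n r"
    proof (cases "conn (n - 1) n")
      case True
      show ?thesis unfolding c if_P[OF True] by (rule cohomology_square_classes[OF D True])
    next
      case False
      show ?thesis unfolding c if_not_P[OF False] by (rule cohomology_trivial) (use False in simp)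
    qed
  qed
qed

end
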